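(* Assume Assumptions (LS), (UT) and (LT) below hold, with $\alpha>0$ the common exponent in (UT) and (LT). Then there exist constants $c>0$, $r_0$ and $\theta_0$ (depending on $\alpha$) such that for all $\theta>\theta_0$ and $r>r_0$, $$\mathbb{P}\left(X_r-\mathbb{E}[X_r]\le-\theta r^{1/3}\right)\le\exp\left(-c\theta^3\right).$$
   Context: Let $\{\xi_v:v\in\mathbb{Z}^2\}$ be i.i.d. random variables with a common law $\nu$ supported on $[0,\infty)$. A directed path is an up-right nearest-neighbour path in $\mathbb{Z}^2$, and its weight is $\ell(\gamma)=\sum_{u\in\gamma}\xi_u$. For $u\preceq v$ coordinatewise, $X_{u,v}=\max_{\gamma:u\to v}\ell(\gamma)$ over directed paths from $u$ to $v$ ($-\infty$ if none). For $r\in\mathbb{N}$, $z\in\mathbb{Z}$, $X_r^z=X_{(1,1),(r-z,r+z)}$ and $X_r=X_r^0$. It is assumed that $\mu=\lim_{r\to\infty}r^{-1}\mathbb{E}[X_r]<\infty$. Assumption (LS): there exist positive finite constants $\rho,G,H,g_1,g_2$ such that for all large enough $r$ and all $z\in[-\rho r,\rho r]$, $\mathbb{E}[X_r^z]\in \mu r-G\frac{z^2}{r}+\left[-H\frac{z^4}{r^3},0\right]+\left[-g_1r^{1/3},-g_2r^{1/3}\right]$. Assumptions (UT) and (LT): there exists $\alpha>0$ such that for every $\varepsilon>0$ there exist positive finite $c,\theta_0,r_0$ (depending only on $\varepsilon$) such that for all $r>r_0$, $\theta>\theta_0$ and $|z|\le(1-\varepsilon)r$: (UT) $\mathbb{P}(X_r^z-\mathbb{E}[X_r^z]>\theta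 r^{1/3})\le\exp(-c\theta^\alpha)$ and (LT) $\mathbb{P}(X_r^z-\mathbb{E}[X_r^z]<-\theta r^{1/3})\le\exp(-c\theta^\alpha)$. *)

theory Defs
  imports "HOL-Probability.Probability"
begin

type_synonym point = "int \<times> int"

definition dpath :: "point \<Rightarrow> point \<Rightarrow> point list \<Rightarrow> bool" where
  "dpath u v p \<longleftrightarrow> p \<noteq> [] \<and> hd p = u \<and> last p = v \<and>
     (\<forall>i. Suc i < length p \<longrightarrow>
        p ! Suc i = (fst (p ! i) + 1, snd (p ! i)) \<or> p ! Suc i = (fst (p ! i), snd (p ! i) + 1))"

definition path_weight :: "(point \<Rightarrow> real) \<Rightarrow> point list \<Rightarrow> real" where
  "path_weight w p = (\<Sum>u\<leftarrow>p. w u)"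

text \<open>Last passage value X_{u,v} for a fixed environment w (only used when a path exists).\<close>
definition lpp :: "(point \<Rightarrow> real) \<Rightarrow> point \<Rightarrow> point \<Rightarrow> real" where
  "lpp w u v = Max (path_weight w ` {p. dpath u v p})"

definition Xrz :: "(point \<Rightarrow> 'a \<Rightarrow> real) \<Rightarrow> nat \<Rightarrow> int \<Rightarrow> 'a \<Rightarrow> real" where
  "Xrz \<xi> r z \<omega> = lpp (\<lambda>v. \<xi> v \<omega>) (1, 1) (int r - z, int r + z)"

end

theory Submission
  imports Defs "HOL-Real_Asymp.Real_Asymp"
begin

text \<open>
  By (LS), deviations of the passage values of length m may be measured from \<open>\<mu> m\<close>; call
  \<open>\<mu> m\<close> minus the passage value the deficit.

  A path that leaves a strip of width x about the diagonal passes through a point at offset x.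
  If the passage value to the first such point were too high, an independent diagonal continuation
  would produce a point-to-point value that contradicts the curvature in (LS) and the upper tail;
  hence with high probability near-optimal paths stay in a strip of width of order
  \<open>T\<^sup>1\<^sup>/\<^sup>2 m\<^sup>2\<^sup>/\<^sup>3\<close>, and the lower tail
  survives the restriction to such a strip.

  Cutting a strip of length m into \<open>k = T\<^sup>3\<^sup>/\<^sup>2\<close> pieces (up to a constant) turns
  a deficit \<open>T m\<^sup>1\<^sup>/\<^sup>3\<close> into a deficit of constant order per piece on the scale
  \<open>(m/k)\<^sup>1\<^sup>/\<^sup>3\<close>; concentration for independent stretched exponential variables improves a
  tail exponent \<open>a \<le> 1\<close> to \<open>3a/2\<close>, so after finitely many rounds the exponent is at least 1.

  Finally \<open>\<theta>\<^sup>3\<^sup>/\<^sup>2\<close> disjoint corridors, each cut into \<open>\<theta>\<^sup>3\<^sup>/\<^sup>2\<close> independent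
  pieces, fit between the two end points at an admissible cost.  All of them fail together with probability
  \<open>exp (- c \<theta>\<^sup>3)\<close>.  The corridors are reached from the two end points by fans of length r/512, where the
  same deficit is twice as large on the natural scale; the failure of a fan is therefore bounded by
  induction on r at level \<open>2 \<theta>\<close>, and \<open>exp (- c (2 \<theta>)\<^sup>3)\<close> beats the number of corridors.
\<close>

subsection \<open>Directed paths and restricted passage values\<close>

text \<open>The exponents come from scaling. Sharing a deficit \<theta> r^(1/3) among k pieces as
  order (r/k)^(1/3) each forces k = \<theta>^(3/2). A corridor then has width of order (r/k)^(2/3) =
  r^(2/3) / \<theta>, while an end point may be displaced by order \<theta>^(1/2) r^(2/3) before the
  curvature cost exceeds \<theta> r^(1/3); the quotient \<theta>^(3/2) is the number of corridors.
  Concentration of k pieces yields at best exp (- c k), so cutting alone stops at exponent 3/2 and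
  the remaining factor must come from parallel corridors. These can be packed densely enough only if
  their width does not grow with the deficit. The strip estimates therefore carry a width exponent
  besides the tail exponent; a round of cutting lowers it from 1/2 to 0. Pieces may be short, so the
  estimates must hold for every length m \<ge> 1. Nonnegative weights make this possible: a deficit
  above \<mu> m cannot occur, so only T < \<mu> m^(2/3) matters, and there m is large once T
  is.\<close>

definition up_right :: "point \<Rightarrow> point \<Rightarrow> bool" where
  "up_right u v \<longleftrightarrow> v = (fst u + 1, snd u) \<or> v = (fst u, snd u + 1)"

lemma dpath_iff_successively:
  "dpath u v p \<longleftrightarrow> p \<noteq> [] \<and> hd p = u \<and> last p = v \<and> successively up_right p"
  by (auto simp: dpath_def successively_conv_nth up_right_def)

text \<open>Strict growth of the coordinate sum is what makes a path distinct, and hence the set of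
  paths between two points finite.\<close>

lemma dpath_sorted:
  assumes "dpath u v p"
  shows "sorted_wrt (\<lambda>a b. fst a \<le> fst b \<and> snd a \<le> snd b \<and> fst a + snd a < fst b + snd b) p"
proof -
  have "successively (\<lambda>a b. fst a \<le> fst b \<and> snd a \<le> snd b \<and> fst a + snd a < fst b + snd b) p"
    using assms unfolding dpath_iff_successively
    by (auto elim!: successively_mono simp: up_right_def)
  then show ?thesis
    by (subst (asm) successively_conv_sorted_wrt) (auto intro!: transpI)
qed

lemma dpath_distinct: "dpath u v p \<Longrightarrow> distinct p"
  by (drule dpath_sorted, induction p) auto

lemma dpath_bounds:
  assumes "dpath u v p" "q \<in> set p"
  shows "fst u \<le> fst q" "snd u \<le> snd q" "fst q \<le> fst v" "snd q \<le> snd v"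
proof -
  obtain xs ys where p: "p = xs @ q # ys" using assms(2) by (meson split_list)
  have s: "sorted_wrt (\<lambda>a b. fst a \<le> fst b \<and> snd a \<le> snd b \<and> fst a + snd a < fst b + snd b) p"
    by (rule dpath_sorted[OF assms(1)])
  have "hd p = u" "last p = v" using assms(1) by (auto simp: dpath_def)
  then have "u = q \<or> u \<in> set xs" "v = q \<or> v \<in> set ys"
    unfolding p by (cases xs; cases ys; auto)+
  then show "fst u \<le> fst q" "snd u \<le> snd q" "fst q \<le> fst v" "snd q \<le> snd v"
    using s unfolding p by (auto simp: sorted_wrt_append)
qed

lemma finite_dpaths: "finite {p. dpath u v p}"
proof (rule finite_subset)
  show "{p. dpath u v p} \<subseteq> {p. set p \<subseteq> {fst u..fst v} \<times> {snd u..snd v} \<and> distinct p}"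
  proof clarify
    fix p assume p: "dpath u v p"
    have "q \<in> {fst u..fst v} \<times> {snd u..snd v}" if "q \<in> set p" for q
      using dpath_bounds[OF p that] by (simp add: mem_Times_iff)
    then show "set p \<subseteq> {fst u..fst v} \<times> {snd u..snd v} \<and> distinct p"
      using dpath_distinct[OF p] by blast
  qed
  show "finite {p. set p \<subseteq> {fst u..fst v} \<times> {snd u..snd v} \<and> distinct p}"
    by (rule finite_subset_distinct) auto
qed

lemma dpath_append:
  "dpath u v p \<Longrightarrow> dpath u' v' q \<Longrightarrow> up_right v u' \<Longrightarrow> dpath u v' (p @ q)"
  unfolding dpath_iff_successively by (auto simp: successively_append_iff)

lemma dpath_singleton: "dpath u u [u]"
  by (simp add: dpath_def)

lemma dpath_split:
  assumes "dpath u v p" "q \<in> set p"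
  obtains p1 p2 where "dpath u q (p1 @ [q])" "dpath q v (q # p2)" "p = p1 @ q # p2"
proof -
  obtain xs ys where p: "p = xs @ q # ys" using assms(2) by (meson split_list)
  have "successively up_right ((xs @ [q]) @ ys)" "hd p = u" "last p = v"
    using assms(1) p by (auto simp: dpath_iff_successively)
  then have "dpath u q (xs @ [q])"
    using p by (auto simp: dpath_iff_successively successively_append_iff hd_append)
  moreover have "dpath q v (q # ys)"
    using assms(1) unfolding p dpath_iff_successively by (auto simp: successively_append_iff)
  ultimately show ?thesis using p that by blast
qed

text \<open>The value 0 is adjoined so that the maximum is meaningful when no admissible path exists;
  for nonnegative weights it changes nothing otherwise.\<close>
definition clpp :: "(point \<Rightarrow> real) \<Rightarrow> point set \<Rightarrow> point \<Rightarrow> point \<Rightarrow> real" where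
  "clpp w R u v = Max (insert 0 (path_weight w ` {p. dpath u v p \<and> set p \<subseteq> R}))"

lemma finite_cdpaths: "finite {p. dpath u v p \<and> set p \<subseteq> R}"
  by (rule finite_subset[OF _ finite_dpaths[of u v]]) auto

lemma clpp_nonneg: "0 \<le> clpp w R u v"
  unfolding clpp_def using finite_cdpaths[of u v R] by (intro Max_ge) auto

lemma clpp_ge: "dpath u v p \<Longrightarrow> set p \<subseteq> R \<Longrightarrow> path_weight w p \<le> clpp w R u v"
  unfolding clpp_def using finite_cdpaths[of u v R] by (intro Max_ge) auto

lemma clpp_le:
  "0 \<le> a \<Longrightarrow> (\<And>p. dpath u v p \<Longrightarrow> set p \<subseteq> R \<Longrightarrow> path_weight w p \<le> a) \<Longrightarrow> clpp w R u v \<le> a"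
  unfolding clpp_def using finite_cdpaths[of u v R] by (subst Max_le_iff) auto

lemma path_weight_nonneg: "(\<And>v. 0 \<le> w v) \<Longrightarrow> 0 \<le> path_weight w p"
  unfolding path_weight_def by (intro sum_list_nonneg) auto

lemma path_weight_append: "path_weight w (p @ q) = path_weight w p + path_weight w q"
  by (simp add: path_weight_def)

lemma path_weight_Cons: "path_weight w (v # p) = w v + path_weight w p"
  by (simp add: path_weight_def)

lemma path_weight_Nil: "path_weight w [] = 0"
  by (simp add: path_weight_def)

lemma clpp_attained:
  assumes "\<And>v. 0 \<le> w v" "\<exists>p. dpath u v p \<and> set p \<subseteq> R"
  shows "\<exists>p. dpath u v p \<and> set p \<subseteq> R \<and> path_weight w p = clpp w R u v"
proof -
  let ?A = "path_weight w ` {p. dpath u v p \<and> set p \<subseteq> R}"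
  have fin: "finite ?A" using finite_cdpaths[of u v R] by auto
  have ne: "?A \<noteq> {}" using assms(2) by auto
  have "0 \<le> Max ?A"
    using ne fin path_weight_nonneg[of w, OF assms(1)] by (subst Max_ge_iff) auto
  then have "clpp w R u v = Max ?A"
    unfolding clpp_def using fin ne by (simp add: Max_insert)
  then show ?thesis using Max_in[OF fin ne] by auto
qed

lemma clpp_mono: "R \<subseteq> R' \<Longrightarrow> clpp w R u v \<le> clpp w R' u v"
  by (intro clpp_le clpp_nonneg clpp_ge) auto

lemma lpp_eq_clpp:
  assumes "\<And>v. 0 \<le> w v" "\<exists>p. dpath u v p"
  shows "lpp w u v = clpp w UNIV u v"
proof -
  let ?A = "path_weight w ` {p. dpath u v p}"
  have fin: "finite ?A" using finite_dpaths[of u v] by auto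
  have ne: "?A \<noteq> {}" using assms(2) by auto
  have "0 \<le> Max ?A"
    using ne fin path_weight_nonneg[of w, OF assms(1)] by (subst Max_ge_iff) auto
  then show ?thesis unfolding clpp_def lpp_def using fin ne by (simp add: Max_insert)
qed

lemma clpp_cong:
  assumes "\<And>q. q \<in> R \<Longrightarrow> fst u \<le> fst q \<Longrightarrow> snd u \<le> snd q \<Longrightarrow> fst q \<le> fst v \<Longrightarrow> snd q \<le> snd v \<Longrightarrow> w q = w' q"
  shows "clpp w R u v = clpp w' R u v"
proof -
  have "path_weight w p = path_weight w' p" if "dpath u v p" "set p \<subseteq> R" for p
    unfolding path_weight_def using that dpath_bounds[OF that(1)] assms
    by (intro arg_cong[where f = sum_list] map_cong) auto
  then show ?thesis unfolding clpp_def
    by (intro arg_cong[where f = Max] arg_cong[where f = "insert 0"] image_cong) auto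
qed

text \<open>The second piece starts diagonally after v, and the vertex used in between only adds a
  nonnegative weight. Starting at v + (1, 1) makes the two pieces use disjoint weights, and makes
  the second a translate of a piece starting at (1, 1).\<close>

lemma clpp_concat:
  assumes w: "\<And>v. 0 \<le> w v"
    and p: "\<exists>p. dpath u v p \<and> set p \<subseteq> R1" "\<exists>p. dpath (fst v + 1, snd v + 1) v' p \<and> set p \<subseteq> R2"
    and R: "R1 \<subseteq> R" "R2 \<subseteq> R" "(fst v, snd v + 1) \<in> R"
  shows "clpp w R1 u v + clpp w R2 (fst v + 1, snd v + 1) v' \<le> clpp w R u v'"
proof -
  let ?q = "(fst v, snd v + 1)" and ?u = "(fst v + 1, snd v + 1)"
  obtain p1 where p1: "dpath u v p1" "set p1 \<subseteq> R1" "path_weight w p1 = clpp w R1 u v"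
    using clpp_attained[of w, OF w p(1)] by auto
  obtain p2 where p2: "dpath ?u v' p2" "set p2 \<subseteq> R2" "path_weight w p2 = clpp w R2 ?u v'"
    using clpp_attained[of w, OF w p(2)] by auto
  have "dpath u ?q (p1 @ [?q])" by (rule dpath_append[OF p1(1) dpath_singleton]) (simp add: up_right_def)
  then have "dpath u v' ((p1 @ [?q]) @ p2)"
    by (rule dpath_append[OF _ p2(1)]) (simp add: up_right_def)
  then have "path_weight w ((p1 @ [?q]) @ p2) \<le> clpp w R u v'"
    by (rule clpp_ge) (use p1 p2 R in auto)
  then show ?thesis using p1(3) p2(3) w[of ?q]
    by (simp add: path_weight_append path_weight_Cons path_weight_Nil)
qed

section \<open>Strips about the diagonal, superadditivity and exit points\<close>

definition pt :: "nat \<Rightarrow> int \<Rightarrow> point" where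
  "pt m z = (int m - z, int m + z)"

text \<open>The factor 2 is there because \<open>pt m z\<close> has coordinate difference 2 z: thus
  x bounds the offset z itself.\<close>

definition strip :: "real \<Rightarrow> point set" where
  "strip x = {p. \<bar>real_of_int (snd p - fst p)\<bar> \<le> 2 * x}"

definition shift_field :: "point \<Rightarrow> (point \<Rightarrow> real) \<Rightarrow> point \<Rightarrow> real" where
  "shift_field p w = (\<lambda>v. w (v + p))"

definition slpp :: "real \<Rightarrow> nat \<Rightarrow> int \<Rightarrow> (point \<Rightarrow> real) \<Rightarrow> real" where
  "slpp x m z w = clpp w (strip x) (1, 1) (pt m z)"

lemma dpath_translate: "dpath u v p \<Longrightarrow> dpath (u + d) (v + d) (map (\<lambda>q. q + d) p)"
  unfolding dpath_def by (auto simp: hd_map last_map prod_eq_iff)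

lemma clpp_shift_field: "clpp (shift_field d w) R u v = clpp w ((\<lambda>q. q + d) ` R) (u + d) (v + d)"
proof (rule antisym)
  show "clpp (shift_field d w) R u v \<le> clpp w ((\<lambda>q. q + d) ` R) (u + d) (v + d)"
  proof (rule clpp_le[OF clpp_nonneg])
    fix p assume p: "dpath u v p" "set p \<subseteq> R"
    have "path_weight w (map (\<lambda>q. q + d) p) \<le> clpp w ((\<lambda>q. q + d) ` R) (u + d) (v + d)"
      by (rule clpp_ge[OF dpath_translate[OF p(1)]]) (use p(2) in auto)
    then show "path_weight (shift_field d w) p \<le> clpp w ((\<lambda>q. q + d) ` R) (u + d) (v + d)"
      by (simp add: path_weight_def shift_field_def comp_def)
  qed
  show "clpp w ((\<lambda>q. q + d) ` R) (u + d) (v + d) \<le> clpp (shift_field d w) R u v"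
  proof (rule clpp_le[OF clpp_nonneg])
    fix p assume p: "dpath (u + d) (v + d) p" "set p \<subseteq> (\<lambda>q. q + d) ` R"
    have "dpath u v (map (\<lambda>q. q + (- d)) p)"
      using dpath_translate[OF p(1), of "- d"] by simp
    then have "path_weight (shift_field d w) (map (\<lambda>q. q + (- d)) p) \<le> clpp (shift_field d w) R u v"
      by (rule clpp_ge) (use p(2) in auto)
    then show "path_weight w p \<le> clpp (shift_field d w) R u v"
      by (simp add: path_weight_def shift_field_def comp_def)
  qed
qed

text \<open>Go back from v by lowering the larger coordinate, which moves towards the diagonal. From
  the diagonal itself one step gives a coordinate difference of absolute value 1, which is where x
  \<ge> 1/2 enters.\<close>

lemma dpath_in_strip:
  assumes "1 \<le> fst v" "1 \<le> snd v" "v \<in> strip x" "1 / 2 \<le> x"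
  shows "\<exists>p. dpath (1, 1) v p \<and> set p \<subseteq> strip x"
  using assms(1-3)
proof (induction "nat (fst v + snd v)" arbitrary: v rule: less_induct)
  case less
  have ext: "\<exists>p. dpath (1, 1) v p \<and> set p \<subseteq> strip x"
    if v': "up_right v' v" "1 \<le> fst v'" "1 \<le> snd v'" "v' \<in> strip x" for v'
  proof -
    have "nat (fst v' + snd v') < nat (fst v + snd v)" using v' by (auto simp: up_right_def)
    then obtain p where "dpath (1, 1) v' p" "set p \<subseteq> strip x" using less(1) v' by blast
    then have "dpath (1, 1) v (p @ [v])" "set (p @ [v]) \<subseteq> strip x"
      using dpath_append[OF _ dpath_singleton v'(1)] less by auto
    then show ?thesis by blast
  qed
  consider "fst v < snd v" | "snd v < fst v" | "fst v = 1" "snd v = 1" | "fst v = snd v" "1 < fst v"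
    using less by linarith
  then show ?case
  proof cases
    case 1
    then show ?thesis using less assms(4)
      by (intro ext[of "(fst v, snd v - 1)"]) (auto simp: up_right_def strip_def)
  next
    case 2
    then show ?thesis using less assms(4)
      by (intro ext[of "(fst v - 1, snd v)"]) (auto simp: up_right_def strip_def)
  next
    case 3
    then have "v = (1, 1)" by (simp add: prod_eq_iff)
    then have "dpath (1,1) v [v] \<and> set [v] \<subseteq> strip x" using less by (auto simp: dpath_singleton)
    then show ?thesis by blast
  next
    case 4
    then show ?thesis using less assms(4)
      by (intro ext[of "(fst v, snd v - 1)"]) (auto simp: up_right_def strip_def prod_eq_iff)
  qed
qed

lemma pt_path_exists:
  assumes "\<bar>z\<bar> < int m" "real_of_int \<bar>z\<bar> \<le> x" "1 / 2 \<le> x"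
  shows "\<exists>p. dpath (1, 1) (pt m z) p \<and> set p \<subseteq> strip x"
  by (rule dpath_in_strip) (use assms in \<open>auto simp: pt_def strip_def\<close>)

lemma pt_add: "pt m z + pt m' z' = pt (m + m') (z + z')"
  by (simp add: pt_def)

lemma slpp_nonneg: "0 \<le> slpp x m z w"
  by (simp add: slpp_def clpp_nonneg)

lemma slpp_mono: "x \<le> y \<Longrightarrow> slpp x m z w \<le> slpp y m z w"
  unfolding slpp_def by (intro clpp_mono) (auto simp: strip_def)

lemma shift_field_shift_field: "shift_field p (shift_field q w) = shift_field (p + q) w"
  by (simp add: shift_field_def add_ac)

lemma slpp_superadd:
  assumes w: "\<And>v. 0 \<le> w v"
    and mz: "m = 0 \<and> z = 0 \<or> \<bar>z\<bar> < int m \<and> real_of_int \<bar>z\<bar> \<le> x"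
    and mz': "\<bar>z'\<bar> < int m'" "real_of_int \<bar>z'\<bar> \<le> x'" "1 \<le> x'" "real_of_int \<bar>z\<bar> + x' \<le> x"
  shows "slpp x m z w + slpp x' m' z' (shift_field (pt m z) w) \<le> slpp x (m + m') (z + z') w"
proof (cases "m = 0")
  case True
  then have "z = 0" using mz by auto
  \<comment> \<open>No path leads from (1, 1) back to (0, 0), so the adjoined default value 0 is the
    passage value of an empty first piece; this lets a chain start from the empty sum.\<close>
  have "\<not> (\<exists>p. dpath (1, 1) (pt 0 0) p)"
  proof
    assume "\<exists>p. dpath (1, 1) (pt 0 0) p"
    then obtain p where p: "dpath (1, 1) (pt 0 0) p" ..
    then have "(1, 1) \<in> set p" by (metis dpath_def hd_in_set)
    from dpath_bounds(3)[OF p this] show False by (simp add: pt_def)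
  qed
  then have "slpp x m z w = 0" using True \<open>z = 0\<close> by (simp add: slpp_def clpp_def)
  moreover have "shift_field (pt m z) w = w" using True \<open>z = 0\<close> by (simp add: pt_def shift_field_def flip: zero_prod_def)
  ultimately show ?thesis using True \<open>z = 0\<close> mz' slpp_mono[of x' x] by simp
next
  case False
  then have z: "\<bar>z\<bar> < int m" "real_of_int \<bar>z\<bar> \<le> x" using mz by auto
  let ?v = "pt m z" and ?u = "(fst (pt m z) + 1, snd (pt m z) + 1)" and ?R = "(\<lambda>q. q + pt m z) ` strip x'"
  have a: "\<exists>p. dpath (1, 1) ?v p \<and> set p \<subseteq> strip x"
    by (rule pt_path_exists) (use z mz' in auto)
  obtain p where p: "dpath (1, 1) (pt m' z') p" "set p \<subseteq> strip x'"
    using pt_path_exists[of z' m' x'] mz' by auto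
  have v': "pt m' z' + ?v = pt (m + m') (z + z')" by (simp add: pt_add add_ac)
  have u: "(1, 1) + ?v = ?u" by (simp add: prod_eq_iff)
  have b: "\<exists>p. dpath ?u (pt (m + m') (z + z')) p \<and> set p \<subseteq> ?R"
    using dpath_translate[OF p(1), of ?v] p(2) unfolding v' u
    by (intro exI[of _ "map (\<lambda>q. q + pt m z) p"]) auto
  have "clpp w (strip x) (1, 1) ?v + clpp w ?R ?u (pt (m + m') (z + z'))
      \<le> clpp w (strip x) (1, 1) (pt (m + m') (z + z'))"
  proof (rule clpp_concat[OF w a b])
    show "?R \<subseteq> strip x"
    proof
      fix q assume "q \<in> ?R"
      then obtain q' where q': "q = q' + pt m z" "q' \<in> strip x'" by auto
      have "snd q - fst q = (snd q' - fst q') + 2 * z" unfolding q' by (simp add: pt_def)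
      then have "\<bar>real_of_int (snd q - fst q)\<bar> \<le> \<bar>real_of_int (snd q' - fst q')\<bar> + 2 * real_of_int \<bar>z\<bar>" by simp
      then show "q \<in> strip x" using q'(2) mz'(4) unfolding strip_def by simp
    qed
    show "(fst ?v, snd ?v + 1) \<in> strip x" using mz'(3,4) by (auto simp: strip_def pt_def)
  qed auto
  moreover have "slpp x' m' z' (shift_field ?v w) = clpp w ?R ?u (pt (m + m') (z + z'))"
    unfolding slpp_def clpp_shift_field v' u ..
  ultimately show ?thesis by (simp add: slpp_def)
qed

lemma slpp_chain:
  assumes w: "\<And>v. 0 \<le> w v"
    and init: "M 0 = 0" "Z 0 = 0"
    and Z: "\<And>i. i \<le> k \<Longrightarrow> real_of_int \<bar>Z i\<bar> + x' \<le> x" "1 \<le> x'"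
    and step: "\<And>i. i < k \<Longrightarrow> M i \<le> M (Suc i)"
      "\<And>i. i < k \<Longrightarrow> \<bar>Z (Suc i) - Z i\<bar> < int (M (Suc i) - M i)"
      "\<And>i. i < k \<Longrightarrow> real_of_int \<bar>Z (Suc i) - Z i\<bar> \<le> x'"
  shows "(\<Sum>i<k. slpp x' (M (Suc i) - M i) (Z (Suc i) - Z i) (shift_field (pt (M i) (Z i)) w)) \<le> slpp x (M k) (Z k) w"
proof -
  \<comment> \<open>The second conjunct is the form in which \<open>slpp_superadd\<close> accepts
    the part already built.\<close>
  have "(\<Sum>i<n. slpp x' (M (Suc i) - M i) (Z (Suc i) - Z i) (shift_field (pt (M i) (Z i)) w)) \<le> slpp x (M n) (Z n) w
      \<and> (M n = 0 \<and> Z n = 0 \<or> \<bar>Z n\<bar> < int (M n))" if "n \<le> k" for n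
    using that
  proof (induction n)
    case 0
    show ?case using init by (simp add: slpp_nonneg)
  next
    case (Suc n)
    have IH: "(\<Sum>i<n. slpp x' (M (Suc i) - M i) (Z (Suc i) - Z i) (shift_field (pt (M i) (Z i)) w)) \<le> slpp x (M n) (Z n) w"
      "M n = 0 \<and> Z n = 0 \<or> \<bar>Z n\<bar> < int (M n)" using Suc by auto
    have n: "n < k" "n \<le> k" using Suc by auto
    have "real_of_int \<bar>Z n\<bar> \<le> x" using Z(1)[OF n(2)] Z(2) by linarith
    then have "slpp x (M n) (Z n) w + slpp x' (M (Suc n) - M n) (Z (Suc n) - Z n) (shift_field (pt (M n) (Z n)) w)
        \<le> slpp x (M n + (M (Suc n) - M n)) (Z n + (Z (Suc n) - Z n)) w"
      using IH(2) step(2,3)[OF n(1)] Z(1)[OF n(2)] Z(2)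
      by (intro slpp_superadd w) auto
    then have "(\<Sum>i<Suc n. slpp x' (M (Suc i) - M i) (Z (Suc i) - Z i) (shift_field (pt (M i) (Z i)) w)) \<le> slpp x (M (Suc n)) (Z (Suc n)) w"
      using IH(1) step(1)[OF n(1)] by simp
    moreover have "\<bar>Z (Suc n)\<bar> < int (M (Suc n))" using IH(2) step(1,2)[OF n(1)] by auto
    ultimately show ?case by auto
  qed
  then show ?thesis by simp
qed

lemma slpp_cong:
  assumes "\<And>q. q \<in> strip x \<Longrightarrow> 2 \<le> fst q + snd q \<Longrightarrow> fst q + snd q \<le> 2 * int m \<Longrightarrow>
     1 \<le> fst q \<Longrightarrow> 1 \<le> snd q \<Longrightarrow> fst q \<le> int m - z \<Longrightarrow> snd q \<le> int m + z \<Longrightarrow> w q = w' q"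
  shows "slpp x m z w = slpp x m z w'"
  unfolding slpp_def by (rule clpp_cong) (auto simp: pt_def intro!: assms)

text \<open>All vertices of a path lie in a box where the coordinate difference is at most 2 m.
  Unrestricted values thus inherit the lemmas about strips.\<close>

lemma slpp_wide:
  assumes "real m \<le> x"
  shows "slpp x m z w = clpp w UNIV (1, 1) (pt m z)"
proof (rule antisym)
  show "slpp x m z w \<le> clpp w UNIV (1, 1) (pt m z)" unfolding slpp_def by (rule clpp_mono) simp
  show "clpp w UNIV (1, 1) (pt m z) \<le> slpp x m z w"
  proof (rule clpp_le[OF slpp_nonneg])
    fix p assume p: "dpath (1, 1) (pt m z) p"
    have "set p \<subseteq> strip x"
    proof
      fix q assume "q \<in> set p"
      note b = dpath_bounds[OF p this]
      have "\<bar>snd q - fst q\<bar> \<le> 2 * int m" using b by (simp add: pt_def abs_le_iff)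
      then have "\<bar>real_of_int (snd q - fst q)\<bar> \<le> 2 * real m" by linarith
      then show "q \<in> strip x" using assms by (simp add: strip_def)
    qed
    then show "path_weight w p \<le> slpp x m z w" unfolding slpp_def by (rule clpp_ge[OF p])
  qed
qed

text \<open>The coordinate difference changes by 1 at each step, so it takes the value 2 y or - 2 y
  on the way out of the strip. Since this value is even, the vertex found there has the form
  \<open>pt s \<sigma>\<close>.\<close>

lemma path_exits_strip:
  assumes p: "dpath (1, 1) (pt m z) p" "\<not> set p \<subseteq> strip x" and y: "0 \<le> y" "real_of_int y \<le> x"
  shows "\<exists>s \<sigma>. \<sigma> \<in> {y, - y} \<and> 1 \<le> s \<and> s \<le> m \<and> pt s \<sigma> \<in> set p"
proof -
  obtain q where q: "q \<in> set p" "2 * x < \<bar>real_of_int (snd q - fst q)\<bar>"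
  proof -
    obtain q where "q \<in> set p" "q \<notin> strip x" using p(2) by blast
    then show ?thesis using that by (auto simp: strip_def)
  qed
  define f where "f i = snd (p ! i) - fst (p ! i)" for i
  have p0: "p \<noteq> []" "p ! 0 = (1, 1)" using p(1) by (auto simp: dpath_def hd_conv_nth)
  have f0: "f 0 = 0" using p0 by (simp add: f_def)
  obtain j where j: "j < length p" "p ! j = q" using q(1) by (auto simp: in_set_conv_nth)
  have step: "\<bar>f (Suc i) - f i\<bar> \<le> 1" if "i < j" for i
  proof -
    have "Suc i < length p" using that j by simp
    then have "p ! Suc i = (fst (p ! i) + 1, snd (p ! i)) \<or> p ! Suc i = (fst (p ! i), snd (p ! i) + 1)"
      using p(1) by (auto simp: dpath_def)
    then show ?thesis by (auto simp: f_def)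
  qed
  have fj: "2 * y \<le> \<bar>f j\<bar>" using q(2) y j by (simp add: f_def)
  have "\<exists>i\<le>j. f i = 2 * y \<or> f i = - 2 * y"
  proof (cases "0 \<le> f j")
    case True
    then have "\<exists>i\<ge>0. i \<le> j \<and> f i = 2 * y"
      by (intro nat_intermed_int_val) (use step fj f0 y in auto)
    then show ?thesis by auto
  next
    case False
    then have "\<exists>i\<ge>0. i \<le> j \<and> - f i = 2 * y"
      by (intro nat_intermed_int_val[of 0 j "\<lambda>i. - f i"]) (use step fj f0 y in \<open>auto simp: abs_minus_commute\<close>)
    then show ?thesis by auto
  qed
  then obtain i \<sigma> where i: "i \<le> j" "f i = 2 * \<sigma>" "\<sigma> \<in> {y, - y}" by force
  have pi: "p ! i \<in> set p" using i j by auto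
  note b = dpath_bounds[OF p(1) pi]
  define s where "s = nat (fst (p ! i) + \<sigma>)"
  have "2 * (fst (p ! i) + \<sigma>) = fst (p ! i) + snd (p ! i)" using i(2) by (simp add: f_def)
  then have s: "1 \<le> fst (p ! i) + \<sigma>" "fst (p ! i) + \<sigma> \<le> int m" using b by (auto simp: pt_def)
  then have "p ! i = pt s \<sigma>" using i(2) by (auto simp: pt_def s_def f_def prod_eq_iff)
  moreover have "1 \<le> s" "s \<le> m" using s by (auto simp: s_def)
  ultimately show ?thesis using i(3) pi by metis
qed

text \<open>A point reflection, followed by reversal, maps up-right paths to up-right paths. It
  turns passage to a fixed end point into passage from (1, 1), so one estimate serves both parts of
  a path.\<close>

definition reflect :: "point \<Rightarrow> (point \<Rightarrow> real) \<Rightarrow> point \<Rightarrow> real" where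
  "reflect d w = (\<lambda>v. w (d - v))"

lemma dpath_reflect: "dpath u v p \<Longrightarrow> dpath (d - v) (d - u) (rev (map (\<lambda>q. d - q) p))"
  unfolding dpath_iff_successively
proof (intro conjI; (elim conjE)?)
  assume "successively up_right p"
  then show "successively up_right (rev (map (\<lambda>q. d - q) p))"
    unfolding successively_rev successively_map
    by (rule successively_mono) (auto simp: up_right_def prod_eq_iff)
qed (auto simp: hd_rev last_rev hd_map last_map)

lemma path_weight_through:
  assumes w: "\<And>v. 0 \<le> w v" and p: "dpath (1, 1) (pt m z) p" "pt s \<sigma> \<in> set p" and s: "s \<le> m"
  shows "path_weight w p \<le> clpp w UNIV (1, 1) (pt s \<sigma>)
     + clpp (reflect (pt (Suc m) z) w) UNIV (1, 1) (pt (Suc m - s) (z - \<sigma>))"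
proof -
  \<comment> \<open>With \<open>Suc m\<close> in place of m the end point is sent to (1, 1) and not
    to the origin.\<close>
  let ?d = "pt (Suc m) z"
  obtain p1 p2 where sp: "dpath (1, 1) (pt s \<sigma>) (p1 @ [pt s \<sigma>])" "dpath (pt s \<sigma>) (pt m z) (pt s \<sigma> # p2)"
    "p = p1 @ pt s \<sigma> # p2" using dpath_split[OF p] .
  have e: "?d - pt m z = (1, 1)" "?d - pt s \<sigma> = pt (Suc m - s) (z - \<sigma>)"
    using s by (auto simp: pt_def)
  have "path_weight (reflect ?d w) (rev (map (\<lambda>q. ?d - q) (pt s \<sigma> # p2)))
      \<le> clpp (reflect ?d w) UNIV (1, 1) (pt (Suc m - s) (z - \<sigma>))"
    using dpath_reflect[OF sp(2), of ?d] unfolding e by (rule clpp_ge) simp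
  moreover have "path_weight (reflect ?d w) (rev (map (\<lambda>q. ?d - q) (pt s \<sigma> # p2))) = path_weight w (pt s \<sigma> # p2)"
    by (simp add: path_weight_def reflect_def rev_map[symmetric] comp_def)
  moreover have "path_weight w (p1 @ [pt s \<sigma>]) \<le> clpp w UNIV (1, 1) (pt s \<sigma>)"
    by (rule clpp_ge[OF sp(1)]) simp
  \<comment> \<open>The crossing vertex is counted in both parts, which is harmless for an upper
    bound.\<close>
  moreover have "path_weight w p \<le> path_weight w (p1 @ [pt s \<sigma>]) + path_weight w (pt s \<sigma> # p2)"
    using w[of "pt s \<sigma>"] sp(3) by (simp add: path_weight_append path_weight_Cons path_weight_Nil)
  ultimately show ?thesis by linarith
qed

subsection \<open>The i.i.d. environment\<close>

abbreviation field_space :: "(point \<Rightarrow> real) measure" where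
  "field_space \<equiv> PiM UNIV (\<lambda>_. borel)"

lemma path_weight_measurable [measurable]: "(\<lambda>w. path_weight w p) \<in> borel_measurable field_space"
  unfolding path_weight_def by (induction p) simp_all

lemma clpp_measurable [measurable]: "(\<lambda>w. clpp w R u v) \<in> borel_measurable field_space"
proof (cases "{p. dpath u v p \<and> set p \<subseteq> R} = {}")
  case True
  show ?thesis unfolding clpp_def True by simp
next
  case False
  have "(\<lambda>w. clpp w R u v) = (\<lambda>w. max 0 (Max ((\<lambda>p. path_weight w p) ` {p. dpath u v p \<and> set p \<subseteq> R})))"
    unfolding clpp_def using False finite_cdpaths[of u v R] by (intro ext Max_insert) auto
  then show ?thesis
    using finite_cdpaths[of u v R] by (auto intro!: borel_measurable_max borel_measurable_Max)
qed

lemma slpp_measurable [measurable]: "slpp x m z \<in> borel_measurable field_space"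
  unfolding slpp_def by measurable

lemma reindex_measurable: "(\<lambda>w v. w (\<phi> v)) \<in> measurable field_space field_space"
  by (rule measurable_PiM_single') (auto simp: space_PiM)

lemma shift_field_measurable [measurable]: "shift_field d \<in> measurable field_space field_space"
  unfolding shift_field_def by (rule reindex_measurable)

lemma reflect_measurable [measurable]: "reflect d \<in> measurable field_space field_space"
  unfolding reflect_def by (rule reindex_measurable)

locale iid_field = prob_space M for M :: "'a measure" +
  fixes \<xi> :: "point \<Rightarrow> 'a \<Rightarrow> real" and \<nu> :: "real measure"
  assumes rv: "\<xi> v \<in> borel_measurable M"
    and indep: "indep_vars (\<lambda>_. borel) \<xi> UNIV"
    and law: "distr M borel (\<xi> v) = \<nu>"
    and nonneg: "0 \<le> \<xi> v \<omega>"
begin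

definition env :: "'a \<Rightarrow> point \<Rightarrow> real" where
  "env \<omega> = (\<lambda>v. \<xi> v \<omega>)"

lemma env_nonneg: "0 \<le> env \<omega> v"
  by (simp add: env_def nonneg)

lemma env_measurable [measurable]: "env \<in> measurable M field_space"
  unfolding env_def by (rule measurable_PiM_single') (auto simp: rv)

text \<open>Independence of the restrictions to disjoint index sets passes to functionals once each
  is rewritten as a function of its restriction; the missing weights are filled with 0, which
  \<open>dep\<close> makes immaterial.\<close>

lemma indep_functionals:
  assumes f: "\<And>i. i \<in> I \<Longrightarrow> f i \<in> borel_measurable field_space"
    and J: "disjoint_family_on J I"
    and dep: "\<And>i w w'. i \<in> I \<Longrightarrow> (\<And>v. v \<in> J i \<Longrightarrow> w v = w' v) \<Longrightarrow> f i w = f i w'"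
  shows "indep_vars (\<lambda>_. borel) (\<lambda>i \<omega>. f i (env \<omega>) :: real) I"
proof -
  have "indep_vars (\<lambda>j. PiM (J j) (\<lambda>_. borel)) (\<lambda>j \<omega>. restrict (\<lambda>i. \<xi> i \<omega>) (J j)) I"
    by (rule indep_vars_restrict[OF indep _ J]) auto
  then have "indep_vars (\<lambda>_. borel)
      (\<lambda>j \<omega>. f j (\<lambda>v. if v \<in> J j then restrict (\<lambda>i. \<xi> i \<omega>) (J j) v else 0)) I"
  proof (rule indep_vars_compose2)
    fix i assume i: "i \<in> I"
    have "(\<lambda>u v. if v \<in> J i then u v else 0) \<in> measurable (PiM (J i) (\<lambda>_. borel :: real measure)) field_space"
    proof (rule measurable_PiM_single')
      fix v show "(\<lambda>u. if v \<in> J i then u v else 0) \<in> borel_measurable (PiM (J i) (\<lambda>_. borel :: real measure))"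
        by (cases "v \<in> J i") auto
    qed (auto simp: space_PiM)
    from measurable_compose[OF this f[OF i]]
    show "(\<lambda>u. f i (\<lambda>v. if v \<in> J i then u v else 0)) \<in> borel_measurable (PiM (J i) (\<lambda>_. borel))" .
  qed
  moreover have "f j (\<lambda>v. if v \<in> J j then restrict (\<lambda>i. \<xi> i \<omega>) (J j) v else 0) = f j (env \<omega>)" if "j \<in> I" for j \<omega>
    by (rule dep[OF that]) (simp add: env_def)
  ultimately show ?thesis by (subst indep_vars_cong[OF refl]) auto
qed

text \<open>Injectivity keeps the relabelled weights independent, so both sides are the same product
  of copies of \<open>\<nu>\<close>. Translations and reflections are the instances needed.\<close>

lemma distr_env_reindex:
  assumes "inj \<phi>"
  shows "distr M field_space (\<lambda>\<omega> v. \<xi> (\<phi> v) \<omega>) = distr M field_space env"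
proof -
  have 1: "distr M field_space (\<lambda>\<omega> v. \<xi> (\<psi> v) \<omega>) = PiM UNIV (\<lambda>_. \<nu>)" if "inj \<psi>" for \<psi>
  proof -
    have "indep_vars (\<lambda>_. borel) (\<lambda>v \<omega>. (\<lambda>w. w (\<psi> v)) (env \<omega>)) UNIV"
      by (rule indep_functionals[where J = "\<lambda>v. {\<psi> v}"])
        (use that in \<open>auto simp: disjoint_family_on_def inj_eq\<close>)
    then have "indep_vars (\<lambda>_. borel) (\<lambda>v. \<xi> (\<psi> v)) UNIV" by (simp add: env_def)
    then have "distr M field_space (\<lambda>\<omega>. \<lambda>v\<in>UNIV. \<xi> (\<psi> v) \<omega>) = PiM UNIV (\<lambda>v. distr M borel (\<xi> (\<psi> v)))"
      by (subst (asm) indep_vars_iff_distr_eq_PiM) (auto simp: rv)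
    then show ?thesis by (simp add: law restrict_UNIV)
  qed
  show ?thesis using 1[OF assms] 1[of "\<lambda>v. v"] by (simp add: env_def[abs_def])
qed

lemma prob_env_reindex:
  assumes "inj \<phi>" "{w. P w} \<in> sets field_space"
  shows "prob {\<omega> \<in> space M. P (\<lambda>v. env \<omega> (\<phi> v))} = prob {\<omega> \<in> space M. P (env \<omega>)}"
proof -
  have m: "(\<lambda>\<omega> v. \<xi> (\<phi> v) \<omega>) \<in> measurable M field_space"
    by (rule measurable_PiM_single') (auto simp: rv)
  have "prob {\<omega> \<in> space M. P (\<lambda>v. env \<omega> (\<phi> v))} = measure (distr M field_space (\<lambda>\<omega> v. \<xi> (\<phi> v) \<omega>)) {w. P w}"
    using assms(2) by (subst measure_distr[OF m]) (auto simp: env_def intro!: arg_cong[where f = prob])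
  also have "\<dots> = measure (distr M field_space env) {w. P w}"
    by (subst distr_env_reindex[OF assms(1)]) simp
  also have "\<dots> = prob {\<omega> \<in> space M. P (env \<omega>)}"
    using assms(2) by (subst measure_distr[OF env_measurable]) (auto intro!: arg_cong[where f = prob])
  finally show ?thesis .
qed

lemma prob_shift_field:
  assumes "{w. P w} \<in> sets field_space"
  shows "prob {\<omega> \<in> space M. P (shift_field d (env \<omega>))} = prob {\<omega> \<in> space M. P (env \<omega>)}"
  unfolding shift_field_def by (rule prob_env_reindex[OF _ assms]) (simp add: inj_def)

lemma prob_reflect:
  assumes "{w. P w} \<in> sets field_space"
  shows "prob {\<omega> \<in> space M. P (reflect d (env \<omega>))} = prob {\<omega> \<in> space M. P (env \<omega>)}"
  unfolding reflect_def by (rule prob_env_reindex[OF _ assms]) (simp add: inj_def)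

lemma indep_two_events:
  fixes P Q :: "(point \<Rightarrow> real) \<Rightarrow> bool"
  assumes A: "{w. P w} \<in> sets field_space" and B: "{w. Q w} \<in> sets field_space"
    and J: "J \<inter> J' = {}"
    and depA: "\<And>w w'. (\<And>v. v \<in> J \<Longrightarrow> w v = w' v) \<Longrightarrow> P w = P w'"
    and depB: "\<And>w w'. (\<And>v. v \<in> J' \<Longrightarrow> w v = w' v) \<Longrightarrow> Q w = Q w'"
  shows "prob {\<omega> \<in> space M. P (env \<omega>) \<and> Q (env \<omega>)}
    = prob {\<omega> \<in> space M. P (env \<omega>)} * prob {\<omega> \<in> space M. Q (env \<omega>)}"
proof -
  define f where "f i w = (if i then indicat_real {w. P w} w else indicat_real {w. Q w} w)"
    for i :: bool and w
  have "indep_vars (\<lambda>_. borel) (\<lambda>i \<omega>. f i (env \<omega>)) UNIV"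
  proof (rule indep_functionals[where J = "\<lambda>i. if i then J else J'"])
    fix i show "f i \<in> borel_measurable field_space"
      unfolding f_def using A B by (cases i) auto
  next
    show "disjoint_family_on (\<lambda>i. if i then J else J') UNIV"
      using J by (auto simp: disjoint_family_on_def)
  next
    fix i and w w' :: "point \<Rightarrow> real" assume "\<And>v. v \<in> (if i then J else J') \<Longrightarrow> w v = w' v"
    then show "f i w = f i w'" using depA[of w w'] depB[of w w'] by (cases i) (auto simp: f_def indicator_def)
  qed
  from indep_varsD[OF this, of UNIV "\<lambda>_. {1}"]
  have "prob (\<Inter>i. (\<lambda>\<omega>. f i (env \<omega>)) -` {1} \<inter> space M) = (\<Prod>i\<in>UNIV. prob ((\<lambda>\<omega>. f i (env \<omega>)) -` {1} \<inter> space M))"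
    by simp
  moreover have "(\<Inter>i. (\<lambda>\<omega>. f i (env \<omega>)) -` {1} \<inter> space M) = {\<omega> \<in> space M. P (env \<omega>) \<and> Q (env \<omega>)}"
    by (auto simp: f_def indicator_def UNIV_bool split: if_splits)
  moreover have "(\<lambda>\<omega>. f True (env \<omega>)) -` {1} \<inter> space M = {\<omega> \<in> space M. P (env \<omega>)}"
    "(\<lambda>\<omega>. f False (env \<omega>)) -` {1} \<inter> space M = {\<omega> \<in> space M. Q (env \<omega>)}"
    by (auto simp: f_def indicator_def split: if_splits)
  ultimately show ?thesis by (simp add: UNIV_bool)
qed

end

text \<open>Truncate at k and apply the exponential Markov inequality. For n \<le> k and a \<le> 1
  the choice of \<open>lam\<close> gives lam n \<le> (b/2) n^a, so half of the tail bound survives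
  and is summed by \<open>b1\<close>. The moment bound exp (2 lam) per variable uses up 2 k of the
  threshold 4 k and leaves exp (- 2 lam k) = exp (- b k^a), which is also the bound for one variable
  exceeding k; hence the factor k + 1.\<close>

lemma (in prob_space) chernoff_stretched:
  fixes V :: "'i \<Rightarrow> 'a \<Rightarrow> real"
  assumes I: "finite I" "card I = k" "1 \<le> k"
    and ind: "indep_vars (\<lambda>_. borel) V I"
    and a: "0 < a" "a \<le> 1" and b: "0 < b"
    and tail: "\<And>i n. i \<in> I \<Longrightarrow> 1 \<le> n \<Longrightarrow> n \<le> k \<Longrightarrow>
      prob {\<omega> \<in> space M. V i \<omega> > real n} \<le> exp (- b * real n powr a)"
    and b1: "(\<Sum>n=1..k. exp (- (b / 2) * real n powr a)) \<le> 1"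
  shows "prob {\<omega> \<in> space M. (\<Sum>i\<in>I. V i \<omega>) > 4 * real k} \<le> (real k + 1) * exp (- b * real k powr a)"
proof -
  have V[measurable]: "V i \<in> borel_measurable M" if "i \<in> I" for i
    using ind that by (auto simp: indep_vars_def)
  define lam where "lam = (b / 2) * real k powr (a - 1)"
  have lam: "0 < lam" using b I by (simp add: lam_def)
  \<comment> \<open>Values above k may be set to 0 because their event is bounded
    separately.\<close>
  define Y where "Y i \<omega> = (if V i \<omega> > real k then 0 else max 0 (V i \<omega>))" for i \<omega>
  have Ym[measurable]: "Y i \<in> borel_measurable M" if "i \<in> I" for i
    unfolding Y_def using that by measurable
  have Y: "0 \<le> Y i \<omega>" "Y i \<omega> \<le> real k" for i \<omega> by (auto simp: Y_def)
  have Yind: "indep_vars (\<lambda>_. borel) (\<lambda>i \<omega>. (\<lambda>x. exp (lam * (if x > real k then 0 else max 0 x))) (V i \<omega>)) I"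
    by (rule indep_vars_compose2[OF ind]) measurable
  then have Yind': "indep_vars (\<lambda>_. borel) (\<lambda>i \<omega>. exp (lam * Y i \<omega>)) I" by (simp add: Y_def)
  have Yint: "integrable M (\<lambda>\<omega>. exp (lam * Y i \<omega>))" if "i \<in> I" for i
  proof (rule integrable_const_bound[where B = "exp (lam * real k)"])
    show "AE \<omega> in M. norm (exp (lam * Y i \<omega>)) \<le> exp (lam * real k)"
      using Y[of i] lam by (auto intro!: mult_left_mono)
  qed (use that in measurable)
  have EY: "expectation (\<lambda>\<omega>. exp (lam * Y i \<omega>)) \<le> exp (2 * lam)" if i: "i \<in> I" for i
  proof -
    let ?u = "exp lam"
    have pt: "exp (lam * Y i \<omega>) \<le> ?u + (\<Sum>n=1..k. (?u - 1) * exp (lam * real n) * indicator {\<omega> \<in> space M. V i \<omega> > real n} \<omega>)"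
      if \<omega>: "\<omega> \<in> space M" for \<omega>
    proof -
      \<comment> \<open>The largest integer strictly below Y, or 0; strictness ensures that all
        levels 1, ..., N are exceeded.\<close>
      define N where "N = nat (\<lceil>Y i \<omega>\<rceil> - 1)"
      have N: "Y i \<omega> \<le> real N + 1" "N \<le> k" using Y[of i \<omega>] by (auto simp: N_def) linarith+
      have VN: "real n < V i \<omega>" if "1 \<le> n" "n \<le> N" for n
      proof -
        have "real n < Y i \<omega>" using that unfolding N_def by linarith
        then show ?thesis by (auto simp: Y_def split: if_splits)
      qed
      have tel: "?u + (\<Sum>n=1..N. (?u - 1) * exp (lam * real n)) = exp (lam * (real N + 1))"
      proof (induction N)
        case (Suc N)
        have "exp (lam * (real (Suc N) + 1)) = ?u * exp (lam * real (Suc N))"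
          unfolding exp_add[symmetric] by (simp add: algebra_simps)
        then show ?case using Suc by (simp add: algebra_simps)
      qed simp
      have "exp (lam * Y i \<omega>) \<le> exp (lam * (real N + 1))" using N lam by simp
      also have "\<dots> = ?u + (\<Sum>n=1..N. (?u - 1) * exp (lam * real n))" by (rule tel[symmetric])
      also have "(\<Sum>n=1..N. (?u - 1) * exp (lam * real n)) = (\<Sum>n=1..N. (?u - 1) * exp (lam * real n) * indicator {\<omega> \<in> space M. V i \<omega> > real n} \<omega>)"
        using VN \<omega> by (intro sum.cong) auto
      also have "\<dots> \<le> (\<Sum>n=1..k. (?u - 1) * exp (lam * real n) * indicator {\<omega> \<in> space M. V i \<omega> > real n} \<omega>)"
        using N(2) lam by (intro sum_mono2) auto
      finally show ?thesis by simp
    qed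
    have int: "integrable M (\<lambda>\<omega>. (?u - 1) * exp (lam * real n) * indicator {\<omega> \<in> space M. V i \<omega> > real n} \<omega>)" for n
      using i by (intro integrable_mult_right integrable_real_indicator) (auto simp: emeasure_eq_measure)
    have "expectation (\<lambda>\<omega>. exp (lam * Y i \<omega>)) \<le>
        expectation (\<lambda>\<omega>. ?u + (\<Sum>n=1..k. (?u - 1) * exp (lam * real n) * indicator {\<omega> \<in> space M. V i \<omega> > real n} \<omega>))"
      by (intro integral_mono Yint[OF i] pt Bochner_Integration.integrable_add
          Bochner_Integration.integrable_sum integrable_const int)
    also have "\<dots> = ?u + (\<Sum>n=1..k. (?u - 1) * exp (lam * real n) * prob {\<omega> \<in> space M. V i \<omega> > real n})"
    proof -
      have E: "expectation (\<lambda>\<omega>. (?u - 1) * exp (lam * real n) * indicator {\<omega> \<in> space M. V i \<omega> > real n} \<omega>)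
          = (?u - 1) * exp (lam * real n) * prob {\<omega> \<in> space M. V i \<omega> > real n}" for n
      proof -
        define A where "A = {\<omega> \<in> space M. V i \<omega> > real n}"
        have "A \<in> events" unfolding A_def using i by measurable
        then have "A \<inter> space M = A" by (simp add: sets.Int_space_eq2)
        then show ?thesis unfolding A_def[symmetric] by simp
      qed
      show ?thesis
        by (subst Bochner_Integration.integral_add[OF integrable_const Bochner_Integration.integrable_sum[OF int]],
            subst Bochner_Integration.integral_sum[OF int], simp only: E) (simp add: prob_space)
    qed
    also have "(\<Sum>n=1..k. (?u - 1) * exp (lam * real n) * prob {\<omega> \<in> space M. V i \<omega> > real n})
        \<le> (\<Sum>n=1..k. (?u - 1) * exp (- (b / 2) * real n powr a))"
    proof (rule sum_mono)
      fix n assume n: "n \<in> {1..k}"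
      have "lam * real n \<le> (b / 2) * real n powr a"
      proof -
        have "real k powr (a - 1) \<le> real n powr (a - 1)" using n a by (intro powr_mono2') auto
        then have "lam * real n \<le> (b / 2) * real n powr (a - 1) * real n"
          unfolding lam_def using b by (intro mult_right_mono) auto
        also have "\<dots> = (b / 2) * real n powr a" using n by (simp add: powr_mult_base powr_diff)
        finally show ?thesis .
      qed
      then have "exp (lam * real n) * prob {\<omega> \<in> space M. V i \<omega> > real n}
          \<le> exp ((b / 2) * real n powr a) * exp (- b * real n powr a)"
        using tail[OF i, of n] n by (intro mult_mono) auto
      also have "\<dots> = exp (- (b / 2) * real n powr a)" by (simp add: exp_add[symmetric])
      finally show "(?u - 1) * exp (lam * real n) * prob {\<omega> \<in> space M. V i \<omega> > real n}
          \<le> (?u - 1) * exp (- (b / 2) * real n powr a)"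
        unfolding mult.assoc using lam by (intro mult_left_mono) auto
    qed
    also have "\<dots> = (?u - 1) * (\<Sum>n=1..k. exp (- (b / 2) * real n powr a))" by (simp add: sum_distrib_left)
    also have "\<dots> \<le> (?u - 1) * 1" using b1 lam by (intro mult_left_mono) auto
    finally have "expectation (\<lambda>\<omega>. exp (lam * Y i \<omega>)) \<le> 2 * ?u - 1" by simp
    also have "\<dots> \<le> ?u ^ 2" using zero_le_power2[of "?u - 1"] by (simp add: power2_eq_square algebra_simps)
    also have "\<dots> = exp (2 * lam)" by (simp add: exp_double)
    finally show ?thesis .
  qed
  have "prob {\<omega> \<in> space M. (\<Sum>i\<in>I. V i \<omega>) > 4 * real k}
      \<le> prob ((\<Union>i\<in>I. {\<omega> \<in> space M. V i \<omega> > real k}) \<union> {\<omega> \<in> space M. (\<Sum>i\<in>I. Y i \<omega>) \<ge> 4 * real k})"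
  proof (rule finite_measure_mono)
    show "{\<omega> \<in> space M. (\<Sum>i\<in>I. V i \<omega>) > 4 * real k}
      \<subseteq> (\<Union>i\<in>I. {\<omega> \<in> space M. V i \<omega> > real k}) \<union> {\<omega> \<in> space M. (\<Sum>i\<in>I. Y i \<omega>) \<ge> 4 * real k}"
    proof
      fix \<omega> assume \<omega>: "\<omega> \<in> {\<omega> \<in> space M. (\<Sum>i\<in>I. V i \<omega>) > 4 * real k}"
      show "\<omega> \<in> (\<Union>i\<in>I. {\<omega> \<in> space M. V i \<omega> > real k}) \<union> {\<omega> \<in> space M. (\<Sum>i\<in>I. Y i \<omega>) \<ge> 4 * real k}"
      proof (cases "\<exists>i\<in>I. V i \<omega> > real k")
        case False
        then have "(\<Sum>i\<in>I. V i \<omega>) \<le> (\<Sum>i\<in>I. Y i \<omega>)" by (intro sum_mono) (auto simp: Y_def)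
        then show ?thesis using \<omega> by auto
      qed (use \<omega> in auto)
    qed
    show "(\<Union>i\<in>I. {\<omega> \<in> space M. V i \<omega> > real k}) \<union> {\<omega> \<in> space M. (\<Sum>i\<in>I. Y i \<omega>) \<ge> 4 * real k} \<in> events"
      using I by (intro sets.Un sets.finite_UN) auto
  qed
  also have "\<dots> \<le> prob (\<Union>i\<in>I. {\<omega> \<in> space M. V i \<omega> > real k}) + prob {\<omega> \<in> space M. (\<Sum>i\<in>I. Y i \<omega>) \<ge> 4 * real k}"
    using I by (intro measure_Un_le sets.finite_UN) auto
  also have "prob (\<Union>i\<in>I. {\<omega> \<in> space M. V i \<omega> > real k}) \<le> (\<Sum>i\<in>I. prob {\<omega> \<in> space M. V i \<omega> > real k})"
    using I by (intro finite_measure_subadditive_finite) auto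
  also have "\<dots> \<le> (\<Sum>i\<in>I. exp (- b * real k powr a))"
    using I by (intro sum_mono tail) auto
  also have "\<dots> = real k * exp (- b * real k powr a)" using I by simp
  also have "prob {\<omega> \<in> space M. (\<Sum>i\<in>I. Y i \<omega>) \<ge> 4 * real k} \<le> exp (- b * real k powr a)"
  proof -
    have "prob {\<omega> \<in> space M. (\<Sum>i\<in>I. Y i \<omega>) \<ge> 4 * real k}
        = prob {\<omega> \<in> space M. (\<Prod>i\<in>I. exp (lam * Y i \<omega>)) \<ge> exp (lam * (4 * real k))}"
      using lam I by (intro arg_cong[where f = prob] Collect_cong) (simp add: exp_sum[symmetric] sum_distrib_left[symmetric])
    also have "\<dots> \<le> expectation (\<lambda>\<omega>. \<Prod>i\<in>I. exp (lam * Y i \<omega>)) / exp (lam * (4 * real k))"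
      by (rule integral_Markov_inequality_measure[where A = "{}"])
        (auto intro!: prod_nonneg indep_vars_integrable[OF I(1) Yind'] Yint)
    also have "expectation (\<lambda>\<omega>. \<Prod>i\<in>I. exp (lam * Y i \<omega>)) = (\<Prod>i\<in>I. expectation (\<lambda>\<omega>. exp (lam * Y i \<omega>)))"
      by (rule indep_vars_lebesgue_integral[OF I(1) Yind' Yint])
    also have "\<dots> \<le> (\<Prod>i\<in>I. exp (2 * lam))"
      by (intro prod_mono conjI EY integral_nonneg) auto
    also have "\<dots> = exp (2 * lam * real k)" using I by (simp add: exp_of_nat_mult mult.commute)
    also have "exp (2 * lam * real k) / exp (lam * (4 * real k)) = exp (- (2 * (lam * real k)))"
      by (simp add: exp_diff[symmetric])
    also have "lam * real k = (b / 2) * real k powr a"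
      using I by (simp add: lam_def powr_diff)
    finally show ?thesis by (simp add: divide_right_mono)
  qed
  finally show ?thesis by (simp add: algebra_simps)
qed

subsection \<open>Independent corridors\<close>

context iid_field
begin

text \<open>If every corridor fails, then the sum of the deficits of all \<open>k N\<close> pieces is large, so a single
  concentration bound suffices.\<close>
lemma corridors_bound:
  fixes \<mu> s x x' a b :: real and \<Delta> :: int and L :: "nat \<Rightarrow> nat" and Z :: "nat \<Rightarrow> int"
  assumes k: "1 \<le> k" "1 \<le> N" and s: "0 < s" and a: "0 < a" "a \<le> 1" and b: "0 < b"
    and init: "L 0 = 0" "Z 0 = 0"
    and Z: "\<And>i. i \<le> k \<Longrightarrow> real_of_int \<bar>Z i\<bar> + x' \<le> x" "1 \<le> x'"
    and step: "\<And>i. i < k \<Longrightarrow> L i \<le> L (Suc i)"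
      "\<And>i. i < k \<Longrightarrow> \<bar>Z (Suc i) - Z i\<bar> < int (L (Suc i) - L i)"
      "\<And>i. i < k \<Longrightarrow> real_of_int \<bar>Z (Suc i) - Z i\<bar> \<le> x'"
    and sep: "2 * x' < real_of_int \<Delta>"
    and tail: "\<And>i n. i < k \<Longrightarrow> 1 \<le> n \<Longrightarrow> n \<le> k * N \<Longrightarrow>
      prob {\<omega> \<in> space M. slpp x' (L (Suc i) - L i) (Z (Suc i) - Z i) (env \<omega>)
         < \<mu> * real (L (Suc i) - L i) - real n * s} \<le> exp (- b * real n powr a)"
    and b1: "(\<Sum>n=1..k * N. exp (- (b / 2) * real n powr a)) \<le> 1"
  shows "prob {\<omega> \<in> space M. \<forall>j<N. slpp x (L k) (Z k) (shift_field (pt l (int j * \<Delta>)) (env \<omega>))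
      < \<mu> * real (L k) - 4 * real k * s} \<le> (real (k * N) + 1) * exp (- b * real (k * N) powr a)"
proof -
  define m where "m i = L (Suc i) - L i" for i
  define z where "z i = Z (Suc i) - Z i" for i
  define d where "d i j = pt (L i) (Z i) + pt l (int j * \<Delta>)" for i j
  define f where "f ij w = (\<mu> * real (m (fst ij)) - slpp x' (m (fst ij)) (z (fst ij)) (shift_field (d (fst ij) (snd ij)) w)) / s"
    for ij w
  \<comment> \<open>The weights seen by piece i of corridor j: a slab of antidiagonals cut with a
    translated strip. A slab starts two levels after the end of the previous one, as the connecting
    vertex in between belongs to no piece.\<close>
  define J where "J ij = {q :: point. 2 * int (L (fst ij) + l) + 2 \<le> fst q + snd q \<and> fst q + snd q \<le> 2 * int (L (Suc (fst ij)) + l)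
      \<and> \<bar>real_of_int (snd q - fst q - 2 * Z (fst ij) - 2 * int (snd ij) * \<Delta>)\<bar> \<le> 2 * x'}" for ij
  let ?I = "{..<k} \<times> {..<N}"
  have Mmono: "L i \<le> L i'" if "i \<le> i'" "i' \<le> k" for i i'
    using that by (induction i') (auto intro: order_trans[OF _ step(1)] simp: le_Suc_eq)
  have disj: "disjoint_family_on J ?I"
    unfolding disjoint_family_on_def
  proof (intro ballI impI equals0I)
    fix ij ij' q assume ij: "ij \<in> ?I" "ij' \<in> ?I" "ij \<noteq> ij'" "q \<in> J ij \<inter> J ij'"
    obtain i j i' j' where d: "ij = (i, j)" "ij' = (i', j')" by force
    have *: "i < k" "j < N" "i' < k" "j' < N" "(i, j) \<noteq> (i', j')" and q: "q \<in> J (i, j)" "q \<in> J (i', j')"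
      using ij d by auto
    show False
    proof (cases "i = i'")
      case True
      \<comment> \<open>In a common slab, a vertex in both strips would bring the offsets
        \<open>j * \<Delta>\<close> and \<open>j' * \<Delta>\<close> within 2 x' of each other,
        against \<open>sep\<close>.\<close>
      have "\<bar>real_of_int (2 * int j * \<Delta> - 2 * int j' * \<Delta>)\<bar> \<le> 4 * x'"
        using q True unfolding J_def by (simp add: abs_le_iff)
      moreover have "\<bar>real_of_int (2 * int j * \<Delta> - 2 * int j' * \<Delta>)\<bar> = 2 * \<bar>real_of_int (int j - int j')\<bar> * \<bar>real_of_int \<Delta>\<bar>"
      proof -
        have "2 * int j * \<Delta> - 2 * int j' * \<Delta> = 2 * (int j - int j') * \<Delta>" by (simp add: algebra_simps)
        then show ?thesis by (simp only: of_int_mult abs_mult)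
      qed
      moreover have "1 \<le> \<bar>real_of_int (int j - int j')\<bar>" using * True by auto
      then have "\<bar>real_of_int \<Delta>\<bar> \<le> \<bar>real_of_int (int j - int j')\<bar> * \<bar>real_of_int \<Delta>\<bar>"
        using mult_right_mono[of 1 "\<bar>real_of_int (int j - int j')\<bar>" "\<bar>real_of_int \<Delta>\<bar>"] by simp
      ultimately show False using sep by linarith
    next
      case False
      then consider "Suc i \<le> i'" | "Suc i' \<le> i" by linarith
      then show False
      proof cases
        case 1
        then show ?thesis using q Mmono[of "Suc i" i'] * unfolding J_def by simp
      next
        case 2
        then show ?thesis using q Mmono[of "Suc i'" i] * unfolding J_def by simp
      qed
    qed
  qed
  have ind: "indep_vars (\<lambda>_. borel) (\<lambda>ij \<omega>. f ij (env \<omega>)) ?I"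
  proof (rule indep_functionals[OF _ disj])
    show "f ij \<in> borel_measurable field_space" for ij unfolding f_def by measurable
  next
    fix ij and w w' :: "point \<Rightarrow> real" assume ij: "ij \<in> ?I" and eq: "\<And>v. v \<in> J ij \<Longrightarrow> w v = w' v"
    obtain i j where ijd: "ij = (i, j)" by force
    have "slpp x' (m i) (z i) (shift_field (d i j) w) = slpp x' (m i) (z i) (shift_field (d i j) w')"
    proof (rule slpp_cong)
      fix q assume q: "q \<in> strip x'" "2 \<le> fst q + snd q" "fst q + snd q \<le> 2 * int (m i)"
      have "L i \<le> L (Suc i)" using ij ijd step(1) by auto
      then have "q + d i j \<in> J ij"
        using q unfolding J_def ijd d_def pt_def strip_def m_def by (auto simp: algebra_simps)
      then show "shift_field (d i j) w q = shift_field (d i j) w' q"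
        unfolding shift_field_def by (rule eq)
    qed
    then show "f ij w = f ij w'" unfolding f_def ijd by simp
  qed
  have tail': "prob {\<omega> \<in> space M. f ij (env \<omega>) > real n} \<le> exp (- b * real n powr a)"
    if ij: "ij \<in> ?I" and n: "1 \<le> n" "n \<le> k * N" for ij n
  proof -
    obtain i j where ijd: "ij = (i, j)" "i < k" using ij by auto
    have "prob {\<omega> \<in> space M. f ij (env \<omega>) > real n}
      = prob {\<omega> \<in> space M. slpp x' (m i) (z i) (shift_field (d i j) (env \<omega>)) < \<mu> * real (m i) - real n * s}"
      unfolding f_def ijd using s by (intro arg_cong[where f = prob] Collect_cong) (auto simp: pos_less_divide_eq)
    also have "\<dots> = prob {\<omega> \<in> space M. slpp x' (m i) (z i) (env \<omega>) < \<mu> * real (m i) - real n * s}"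
    proof (rule prob_shift_field)
      have "slpp x' (m i) (z i) -` {..< \<mu> * real (m i) - real n * s} \<inter> space field_space \<in> sets field_space"
        by (rule measurable_sets[OF slpp_measurable]) simp
      then show "{w. slpp x' (m i) (z i) w < \<mu> * real (m i) - real n * s} \<in> sets field_space"
        by (simp add: space_PiM vimage_def)
    qed
    also have "\<dots> \<le> exp (- b * real n powr a)" using tail[OF ijd(2) n] by (simp add: m_def z_def)
    finally show ?thesis .
  qed
  have "{\<omega> \<in> space M. \<forall>j<N. slpp x (L k) (Z k) (shift_field (pt l (int j * \<Delta>)) (env \<omega>)) < \<mu> * real (L k) - 4 * real k * s}
      \<subseteq> {\<omega> \<in> space M. (\<Sum>ij\<in>?I. f ij (env \<omega>)) > 4 * real (k * N)}"
  proof safe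
    fix \<omega> assume \<omega>: "\<forall>j<N. slpp x (L k) (Z k) (shift_field (pt l (int j * \<Delta>)) (env \<omega>)) < \<mu> * real (L k) - 4 * real k * s"
    have row: "(\<Sum>i<k. f (i, j) (env \<omega>)) > 4 * real k" if j: "j < N" for j
    proof -
      let ?w = "shift_field (pt l (int j * \<Delta>)) (env \<omega>)"
      have "(\<Sum>i<k. slpp x' (m i) (z i) (shift_field (pt (L i) (Z i)) ?w)) \<le> slpp x (L k) (Z k) ?w"
        unfolding m_def z_def
        by (rule slpp_chain) (use init Z step in \<open>auto simp: shift_field_def env_nonneg\<close>)
      also have "\<dots> < \<mu> * real (L k) - 4 * real k * s" using \<omega> j by auto
      finally have *: "(\<Sum>i<k. slpp x' (m i) (z i) (shift_field (d i j) (env \<omega>))) < \<mu> * real (L k) - 4 * real k * s"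
        by (simp add: shift_field_shift_field d_def)
      have "(\<Sum>i<k. real (m i)) = (\<Sum>i<k. real (L (Suc i)) - real (L i))"
        using step(1) by (intro sum.cong) (auto simp: m_def of_nat_diff)
      also have "\<dots> = real (L k)" using init sum_lessThan_telescope[of "\<lambda>i. real (L i)" k] by simp
      finally have tot: "(\<Sum>i<k. real (m i)) = real (L k)" .
      have "(\<Sum>i<k. f (i, j) (env \<omega>)) = (\<mu> * (\<Sum>i<k. real (m i)) - (\<Sum>i<k. slpp x' (m i) (z i) (shift_field (d i j) (env \<omega>)))) / s"
        unfolding f_def fst_conv snd_conv by (simp add: sum_divide_distrib[symmetric] sum_subtractf sum_distrib_left)
      then show ?thesis using * s unfolding tot by (simp add: pos_less_divide_eq)
    qed
    have "4 * real (k * N) = (\<Sum>j<N. 4 * real k)" by simp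
    also have "\<dots> < (\<Sum>j<N. \<Sum>i<k. f (i, j) (env \<omega>))"
      using row k by (intro sum_strict_mono) (auto simp: lessThan_empty_iff)
    also have "\<dots> = (\<Sum>ij\<in>?I. f ij (env \<omega>))"
      by (subst sum.swap) (simp add: sum.cartesian_product)
    finally show "4 * real (k * N) < (\<Sum>ij\<in>?I. f ij (env \<omega>))" .
  qed
  then have "prob {\<omega> \<in> space M. \<forall>j<N. slpp x (L k) (Z k) (shift_field (pt l (int j * \<Delta>)) (env \<omega>)) < \<mu> * real (L k) - 4 * real k * s}
      \<le> prob {\<omega> \<in> space M. (\<Sum>ij\<in>?I. f ij (env \<omega>)) > 4 * real (k * N)}"
    by (rule finite_measure_mono) (simp add: f_def)
  also have "\<dots> \<le> (real (k * N) + 1) * exp (- b * real (k * N) powr a)"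
    by (rule chernoff_stretched[OF _ _ _ ind]) (use k a b tail' b1 in auto)
  finally show ?thesis .
qed

end

subsection \<open>Leaving a strip\<close>

abbreviation flpp :: "nat \<Rightarrow> int \<Rightarrow> (point \<Rightarrow> real) \<Rightarrow> real" where
  "flpp m z w \<equiv> clpp w UNIV (1, 1) (pt m z)"

abbreviation cbrt :: "nat \<Rightarrow> real" where
  "cbrt m \<equiv> real m powr (1 / 3)"

lemma cbrt_cube: "cbrt m ^ 3 = real m"
  by (cases "m = 0") (simp_all add: powr_powr flip: powr_numeral)

lemma cbrt_ge_1: "1 \<le> m \<Longrightarrow> 1 \<le> cbrt m"
  using powr_mono2[of "1/3" 1 "real m"] by simp

lemma flpp_superadd:
  assumes w: "\<And>v. 0 \<le> w v" and z: "\<bar>z\<bar> < int m" "\<bar>z'\<bar> < int m'"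
  shows "flpp m z w + flpp m' z' (shift_field (pt m z) w) \<le> flpp (m + m') (z + z') w"
proof -
  let ?x' = "real m' + 1" and ?x = "2 * real m + real m' + 1"
  have "slpp ?x m z w + slpp ?x' m' z' (shift_field (pt m z) w) \<le> slpp ?x (m + m') (z + z') w"
    by (rule slpp_superadd[OF w]) (use z in linarith)+
  then show ?thesis by (simp add: slpp_wide)
qed

lemma field_space_Collect: "Measurable.pred field_space P \<Longrightarrow> {w. P w} \<in> sets field_space"
  by (simp add: pred_def space_PiM)

text \<open>The three assumptions recentred at \<mu> r. Two curvature constants are kept: G measures
  the loss that confines paths, while A only bounds the price of an offset in lower estimates and
  may absorb the quartic term of (LS).\<close>

locale lpp_tails = iid_field M \<xi> \<nu> for M :: "'a measure" and \<xi> \<nu> +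
  fixes \<mu> \<alpha> \<rho> G A c \<theta>\<^sub>0 :: real and r\<^sub>0 :: nat
  assumes \<mu>: "0 < \<mu>" and \<alpha>: "0 < \<alpha>" and \<rho>: "0 < \<rho>" "\<rho> < 1" and G: "0 < G" and A: "0 < A" and c: "0 < c"
    and \<theta>\<^sub>0: "0 < \<theta>\<^sub>0"
    and lower_tail: "\<And>r z \<theta>. r\<^sub>0 \<le> r \<Longrightarrow> \<bar>real_of_int z\<bar> \<le> \<rho> * real r \<Longrightarrow> \<theta>\<^sub>0 \<le> \<theta> \<Longrightarrow>
      prob {\<omega> \<in> space M. flpp r z (env \<omega>) < \<mu> * real r - A * real_of_int z ^ 2 / real r - \<theta> * cbrt r}
        \<le> exp (- c * \<theta> powr \<alpha>)"
    and upper_tail: "\<And>r z \<theta>. r\<^sub>0 \<le> r \<Longrightarrow> \<bar>real_of_int z\<bar> \<le> \<rho> * real r \<Longrightarrow> \<theta>\<^sub>0 \<le> \<theta> \<Longrightarrow>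
      prob {\<omega> \<in> space M. flpp r z (env \<omega>) > \<mu> * real r - G * real_of_int z ^ 2 / real r + \<theta> * cbrt r}
        \<le> exp (- c * \<theta> powr \<alpha>)"
begin

text \<open>Only an eighth of the curvature is asked for: a diagonal continuation to height 2 n
  still meets half of G x^2 / n, so a gap of that order remains for the upper tail. The condition
  \<open>\<bar>x\<bar> < int s\<close> ensures that \<open>pt s x\<close> can be reached.\<close>

definition crosses_high :: "nat \<Rightarrow> int \<Rightarrow> (point \<Rightarrow> real) \<Rightarrow> bool" where
  "crosses_high n x w \<longleftrightarrow> (\<exists>s\<in>{1..n}. \<bar>x\<bar> < int s \<and> flpp s x w > \<mu> * real s - (G / 8) * real_of_int x ^ 2 / real n)"

lemma crosses_high_measurable [measurable]: "Measurable.pred field_space (crosses_high n x)"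
  unfolding crosses_high_def by measurable

text \<open>At the first bad height s the path is continued diagonally to height 2n using fresh weights.\<close>
lemma crosses_high_tail:
  "\<exists>L n\<^sub>0. 0 < L \<and> (\<forall>n x u. n\<^sub>0 \<le> n \<longrightarrow> 1 \<le> n \<longrightarrow> \<bar>real_of_int x\<bar> \<le> 2 * \<rho> * real n \<longrightarrow> L \<le> u \<longrightarrow>
     u * cbrt n ^ 4 \<le> real_of_int x ^ 2 \<longrightarrow>
     prob {\<omega> \<in> space M. crosses_high n x (env \<omega>)} \<le> 2 * exp (- c * (G / 8 * u) powr \<alpha>))"
proof -
  have "\<forall>\<^sub>F \<theta> in at_top. exp (- c * \<theta> powr \<alpha>) \<le> 1 / 2" using c \<alpha> by real_asymp
  then have "\<forall>\<^sub>F \<theta> in at_top. exp (- c * \<theta> powr \<alpha>) \<le> 1 / 2 \<and> \<theta>\<^sub>0 \<le> \<theta>"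
    by (intro eventually_conj eventually_ge_at_top)
  then obtain \<theta>\<^sub>1 where \<theta>\<^sub>1: "exp (- c * \<theta>\<^sub>1 powr \<alpha>) \<le> 1 / 2" "\<theta>\<^sub>0 \<le> \<theta>\<^sub>1"
    using eventually_happens'[OF trivial_limit_at_top_linorder] by blast
  \<comment> \<open>\<open>\<theta>\<^sub>1\<close> makes the continuation succeed with probability
    at least 1/2. The first term of L lets (G/8) x^2 / n pay for it, the second makes the upper tail
    applicable at level G u / 8.\<close>
  define L where "L = (16 * \<theta>\<^sub>1 + 8 * \<theta>\<^sub>0) / G"
  have L: "0 < L" using \<theta>\<^sub>1 \<theta>\<^sub>0 G by (simp add: L_def)
  show ?thesis
  proof (intro exI[of _ L] exI[of _ r\<^sub>0] conjI allI impI L)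
    fix n x and u :: real
    assume n: "r\<^sub>0 \<le> n" "1 \<le> n" and x: "\<bar>real_of_int x\<bar> \<le> 2 * \<rho> * real n" and u: "L \<le> u"
      and xu: "u * cbrt n ^ 4 \<le> real_of_int x ^ 2"
    define C where "C = 2 * \<theta>\<^sub>1"
    define a where "a s = \<mu> * real s - (G / 8) * real_of_int x ^ 2 / real n" for s
    define E where "E s w \<longleftrightarrow> \<bar>x\<bar> < int s \<and> flpp s x w > a s" for s w
    define E' where "E' s w \<longleftrightarrow> E s w \<and> (\<forall>s'\<in>{1..<s}. \<not> E s' w)" for s w
    define F where "F s w \<longleftrightarrow> flpp (2 * n - s) 0 (shift_field (pt s x) w) \<ge> \<mu> * real (2 * n - s) - C * cbrt n" for s w
    have Em[measurable]: "Measurable.pred field_space (E s)" for s unfolding E_def by measurable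
    have E'm[measurable]: "Measurable.pred field_space (E' s)" for s unfolding E'_def by measurable
    have Fm[measurable]: "Measurable.pred field_space (F s)" for s unfolding F_def by measurable
    have c2: "cbrt (2 * n) \<le> 2 * cbrt n"
    proof -
      have "cbrt (2 * n) = 2 powr (1/3) * cbrt n" by (simp add: powr_mult)
      moreover have "(2::real) powr (1/3) \<le> 2 powr 1" by (intro powr_mono) auto
      ultimately show ?thesis by (simp add: mult_right_mono)
    qed
    have PF: "1 / 2 \<le> prob {\<omega> \<in> space M. F s (env \<omega>)}" if s: "s \<in> {1..n}" for s
    proof -
      let ?l = "2 * n - s"
      have "prob {\<omega> \<in> space M. \<not> F s (env \<omega>)} = prob {\<omega> \<in> space M. flpp ?l 0 (shift_field (pt s x) (env \<omega>)) < \<mu> * real ?l - C * cbrt n}"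
        by (simp add: F_def not_le)
      also have "\<dots> = prob {\<omega> \<in> space M. flpp ?l 0 (env \<omega>) < \<mu> * real ?l - C * cbrt n}"
        by (rule prob_shift_field, rule field_space_Collect) measurable
      also have "\<dots> \<le> prob {\<omega> \<in> space M. flpp ?l 0 (env \<omega>) < \<mu> * real ?l - A * real_of_int 0 ^ 2 / real ?l - \<theta>\<^sub>1 * cbrt ?l}"
      proof (rule finite_measure_mono)
        have "cbrt ?l \<le> cbrt (2 * n)" by (intro powr_mono2) auto
        then have "\<theta>\<^sub>1 * cbrt ?l \<le> C * cbrt n" using c2 \<theta>\<^sub>1 \<theta>\<^sub>0 mult_left_mono[of "cbrt ?l" "2 * cbrt n" \<theta>\<^sub>1] by (simp add: C_def)
        then show "{\<omega> \<in> space M. flpp ?l 0 (env \<omega>) < \<mu> * real ?l - C * cbrt n}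
          \<subseteq> {\<omega> \<in> space M. flpp ?l 0 (env \<omega>) < \<mu> * real ?l - A * real_of_int 0 ^ 2 / real ?l - \<theta>\<^sub>1 * cbrt ?l}" by auto
      qed measurable
      also have "\<dots> \<le> exp (- c * \<theta>\<^sub>1 powr \<alpha>)"
        by (rule lower_tail) (use n s \<theta>\<^sub>1 \<rho> in auto)
      also have "\<dots> \<le> 1 / 2" by (rule \<theta>\<^sub>1)
      finally have "prob {\<omega> \<in> space M. \<not> F s (env \<omega>)} \<le> 1 / 2" .
      moreover have "prob {\<omega> \<in> space M. \<not> F s (env \<omega>)} = 1 - prob {\<omega> \<in> space M. F s (env \<omega>)}"
        by (rule prob_neg) measurable
      ultimately show ?thesis by linarith
    qed
    \<comment> \<open>The values at offset x up to height s use the box with upper corner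
      \<open>pt s x\<close>; the continuation lies strictly to the right of it.\<close>
    have ind: "prob {\<omega> \<in> space M. E' s (env \<omega>) \<and> F s (env \<omega>)} = prob {\<omega> \<in> space M. E' s (env \<omega>)} * prob {\<omega> \<in> space M. F s (env \<omega>)}" for s
    proof (rule indep_two_events[where J = "{q. fst q \<le> int s - x \<and> snd q \<le> int s + x}" and J' = "{q. fst q > int s - x}"])
      fix w w' :: "point \<Rightarrow> real" assume eq: "\<And>v. v \<in> {q. fst q \<le> int s - x \<and> snd q \<le> int s + x} \<Longrightarrow> w v = w' v"
      have "E s' w = E s' w'" if "s' \<le> s" for s'
      proof -
        have "flpp s' x w = flpp s' x w'"
          by (rule clpp_cong, rule eq) (use that in \<open>auto simp: pt_def\<close>)
        then show ?thesis by (simp add: E_def)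
      qed
      then show "E' s w = E' s w'" by (auto simp: E'_def)
    next
      fix w w' :: "point \<Rightarrow> real" assume eq: "\<And>v. v \<in> {q. fst q > int s - x} \<Longrightarrow> w v = w' v"
      have "flpp (2 * n - s) 0 (shift_field (pt s x) w) = flpp (2 * n - s) 0 (shift_field (pt s x) w')"
        by (rule clpp_cong) (auto simp: shift_field_def pt_def intro!: eq)
      then show "F s w = F s w'" by (simp add: F_def)
    qed (auto intro!: field_space_Collect Em E'm Fm)
    have incl: "{\<omega> \<in> space M. crosses_high n x (env \<omega>)} \<subseteq> (\<Union>s\<in>{1..n}. {\<omega> \<in> space M. E' s (env \<omega>)})"
    proof safe
      fix \<omega> assume \<omega>: "\<omega> \<in> space M" "crosses_high n x (env \<omega>)"
      let ?P = "\<lambda>s. s \<in> {1..n} \<and> E s (env \<omega>)"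
      have "\<exists>s. ?P s" using \<omega>(2) by (auto simp: crosses_high_def E_def a_def)
      then have "\<exists>s. ?P s \<and> (\<forall>s'<s. \<not> ?P s')" by (rule exists_least_iff[THEN iffD1])
      then obtain s where s: "?P s" "\<forall>s'<s. \<not> ?P s'" by blast
      then have "E' s (env \<omega>)" by (auto simp: E'_def)
      then show "\<omega> \<in> (\<Union>s\<in>{1..n}. {\<omega> \<in> space M. E' s (env \<omega>)})"
        using \<omega>(1) s(1) by blast
    qed
    \<comment> \<open>Budget in units of G x^2 / n: the curvature at height 2 n gives 1/2, the
      threshold takes 1/8, the continuation 1/8, and the remaining 1/4 covers (G/8) u
      \<open>cbrt (2 * n)\<close>.\<close>
    have incl2: "(\<Union>s\<in>{1..n}. {\<omega> \<in> space M. E' s (env \<omega>) \<and> F s (env \<omega>)})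
      \<subseteq> {\<omega> \<in> space M. flpp (2 * n) x (env \<omega>) > \<mu> * real (2 * n) - G * real_of_int x ^ 2 / real (2 * n) + (G / 8 * u) * cbrt (2 * n)}"
    proof safe
      fix s \<omega> assume s: "s \<in> {1..n}" and E: "E' s (env \<omega>)" and F: "F s (env \<omega>)"
      have xs: "\<bar>x\<bar> < int s" and Xs: "flpp s x (env \<omega>) > a s" using E by (auto simp: E'_def E_def)
      have "flpp s x (env \<omega>) + flpp (2 * n - s) 0 (shift_field (pt s x) (env \<omega>)) \<le> flpp (s + (2 * n - s)) (x + 0) (env \<omega>)"
        by (rule flpp_superadd) (use s xs in \<open>auto simp: env_nonneg\<close>)
      then have low: "flpp (2 * n) x (env \<omega>) > a s + \<mu> * real (2 * n - s) - C * cbrt n"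
        using Xs F s by (simp add: F_def)
      have as: "a s + \<mu> * real (2 * n - s) = \<mu> * real (2 * n) - (G / 8) * real_of_int x ^ 2 / real n"
        using s by (simp add: a_def of_nat_diff algebra_simps)
      have n0: "0 < cbrt n" "0 < real n" using n by auto
      have y: "u * cbrt n \<le> real_of_int x ^ 2 / real n"
      proof -
        have "u * cbrt n * real n = u * cbrt n ^ 4"
          by (subst cbrt_cube[symmetric]) (simp add: power_numeral_reduce)
        then show ?thesis unfolding pos_le_divide_eq[OF n0(2)] using xu by linarith
      qed
      define Y where "Y = real_of_int x ^ 2 / real n"
      have "L * cbrt n \<le> Y" using u y n0 mult_right_mono[of L u "cbrt n"] unfolding Y_def by linarith
      then have "(16 * \<theta>\<^sub>1 + 8 * \<theta>\<^sub>0) * cbrt n \<le> G * Y" using G by (simp add: L_def field_simps)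
      moreover have "0 \<le> \<theta>\<^sub>0 * cbrt n" using n0 \<theta>\<^sub>0 by simp
      ultimately have CY: "C * cbrt n \<le> G / 8 * Y" by (simp add: C_def algebra_simps)
      have "(G / 8 * u) * cbrt (2 * n) \<le> (G / 8 * u) * (2 * cbrt n)"
        using c2 G L u by (intro mult_left_mono) auto
      also have "\<dots> \<le> G / 4 * Y" using y G mult_left_mono[of "u * cbrt n" Y "G / 4"] by (simp add: Y_def)
      finally have uY: "(G / 8 * u) * cbrt (2 * n) \<le> G / 4 * Y" .
      have "G * real_of_int x ^ 2 / real (2 * n) = G / 2 * Y" "(G / 8) * real_of_int x ^ 2 / real n = G / 8 * Y"
        by (simp_all add: Y_def)
      then show "\<mu> * real (2 * n) - G * real_of_int x ^ 2 / real (2 * n) + (G / 8 * u) * cbrt (2 * n) < flpp (2 * n) x (env \<omega>)"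
        using low CY uY unfolding as by linarith
    qed
    have "prob {\<omega> \<in> space M. crosses_high n x (env \<omega>)} \<le> prob (\<Union>s\<in>{1..n}. {\<omega> \<in> space M. E' s (env \<omega>)})"
      by (rule finite_measure_mono[OF incl]) measurable
    also have "\<dots> \<le> (\<Sum>s\<in>{1..n}. prob {\<omega> \<in> space M. E' s (env \<omega>)})"
      by (rule finite_measure_subadditive_finite) auto
    \<comment> \<open>The continuation is independent of the first bad height and succeeds with
      probability at least 1/2.\<close>
    also have "\<dots> \<le> (\<Sum>s\<in>{1..n}. 2 * prob {\<omega> \<in> space M. E' s (env \<omega>) \<and> F s (env \<omega>)})"
    proof (rule sum_mono)
      fix s assume "s \<in> {1..n}"
      from mult_left_mono[OF PF[OF this], of "prob {\<omega> \<in> space M. E' s (env \<omega>)}"]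
      show "prob {\<omega> \<in> space M. E' s (env \<omega>)} \<le> 2 * prob {\<omega> \<in> space M. E' s (env \<omega>) \<and> F s (env \<omega>)}"
        unfolding ind by simp
    qed
    also have "\<dots> = 2 * (\<Sum>s\<in>{1..n}. prob {\<omega> \<in> space M. E' s (env \<omega>) \<and> F s (env \<omega>)})" by (simp add: sum_distrib_left)
    also have "(\<Sum>s\<in>{1..n}. prob {\<omega> \<in> space M. E' s (env \<omega>) \<and> F s (env \<omega>)}) = prob (\<Union>s\<in>{1..n}. {\<omega> \<in> space M. E' s (env \<omega>) \<and> F s (env \<omega>)})"
    proof (rule finite_measure_finite_Union[symmetric])
      show "disjoint_family_on (\<lambda>s. {\<omega> \<in> space M. E' s (env \<omega>) \<and> F s (env \<omega>)}) {1..n}"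
        unfolding disjoint_family_on_def E'_def
        by (auto simp: E'_def)
    qed auto
    also have "\<dots> \<le> prob {\<omega> \<in> space M. flpp (2 * n) x (env \<omega>) > \<mu> * real (2 * n) - G * real_of_int x ^ 2 / real (2 * n) + (G / 8 * u) * cbrt (2 * n)}"
      by (rule finite_measure_mono[OF incl2]) measurable
    also have "\<dots> \<le> exp (- c * (G / 8 * u) powr \<alpha>)"
    proof (rule upper_tail)
      have "8 * \<theta>\<^sub>0 / G \<le> L" using \<theta>\<^sub>1 \<theta>\<^sub>0 G by (simp add: L_def divide_right_mono)
      then have "8 * \<theta>\<^sub>0 / G \<le> u" using u by simp
      then show "\<theta>\<^sub>0 \<le> G / 8 * u" using G by (simp add: field_simps)
    qed (use n x in auto)
    finally show "prob {\<omega> \<in> space M. crosses_high n x (env \<omega>)} \<le> 2 * exp (- c * (G / 8 * u) powr \<alpha>)" by simp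
  qed
qed

end

section \<open>Restriction of the lower tail to strips\<close>

context lpp_tails
begin

text \<open>The parameter b measures how the strip width has to grow with the deficit T.\<close>
definition strip_tail :: "real \<Rightarrow> real \<Rightarrow> bool" where
  "strip_tail a b \<longleftrightarrow> (\<exists>K>0. \<exists>B>0. \<exists>c>0. \<forall>\<^sub>F T in at_top. \<forall>m z x. 1 \<le> m \<longrightarrow>
     \<bar>real_of_int z\<bar> \<le> K * sqrt T * cbrt m ^ 2 \<longrightarrow> 2 * \<bar>real_of_int z\<bar> + B * T powr b * cbrt m ^ 2 \<le> x \<longrightarrow>
     prob {\<omega> \<in> space M. slpp x m z (env \<omega>) < \<mu> * real m - T * cbrt m} \<le> exp (- c * T powr a))"

text \<open>Restricted values are nonnegative, so the event asks for the impossible. This disposes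
  of all small m and serves as the base case of later arguments.\<close>

lemma prob_slpp_eq_0:
  assumes "\<mu> * cbrt m ^ 2 \<le> T"
  shows "prob {\<omega> \<in> space M. slpp x m z (env \<omega>) < \<mu> * real m - T * cbrt m} = 0"
proof -
  have "\<mu> * real m = \<mu> * cbrt m ^ 2 * cbrt m" by (subst cbrt_cube[symmetric]) (simp add: power_numeral_reduce)
  also have "\<dots> \<le> T * cbrt m" using assms by (intro mult_right_mono) auto
  finally have "{\<omega> \<in> space M. slpp x m z (env \<omega>) < \<mu> * real m - T * cbrt m} = {}"
    using slpp_nonneg[of x m z] by (auto simp: not_less intro: order_trans[of _ 0])
  then show ?thesis by (simp only:) simp
qed

text \<open>If the free value is not too low, its optimal path has deficit at most T m^(1/3). Were
  it to leave the strip, it would pass offset \<open>y\<close> or \<open>- y\<close>, where the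
  absence of high crossings, in the environment and its reflection, costs 8 T m^(1/3). The 9 counts
  one lower tail and four crossing events, each with factor 2.\<close>

lemma strip_tail_moderate:
  assumes L: "\<And>n x u. n\<^sub>0 \<le> n \<Longrightarrow> 1 \<le> n \<Longrightarrow> \<bar>real_of_int x\<bar> \<le> 2 * \<rho> * real n \<Longrightarrow> L \<le> u \<Longrightarrow>
     u * cbrt n ^ 4 \<le> real_of_int x ^ 2 \<Longrightarrow>
     prob {\<omega> \<in> space M. crosses_high n x (env \<omega>)} \<le> 2 * exp (- c * (G / 8 * u) powr \<alpha>)"
    and B: "B = 16 / sqrt G" and m: "n\<^sub>0 \<le> m" "r\<^sub>0 \<le> m" "1 \<le> m"
    and T: "0 < T" "B * sqrt T \<le> \<rho> * cbrt m" "2 \<le> B * sqrt T" "L \<le> 16 * T / G" "\<mu> \<le> T" "2 * \<theta>\<^sub>0 \<le> T"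
    and z: "\<bar>real_of_int z\<bar> \<le> B / 4 * sqrt T * cbrt m ^ 2" "\<bar>real_of_int z\<bar> \<le> 1 / (A + 1) * sqrt T * cbrt m ^ 2"
    and x: "B * sqrt T * cbrt m ^ 2 \<le> x"
  shows "prob {\<omega> \<in> space M. slpp x m z (env \<omega>) < \<mu> * real m - T * cbrt m} \<le> 9 * exp (- c * (T / 2) powr \<alpha>)"
proof -
  define k where "k = cbrt m"
  have k: "1 \<le> k" "k ^ 3 = real m" using cbrt_ge_1[OF m(3)] cbrt_cube by (auto simp: k_def)
  define Q where "Q = B * sqrt T * k ^ 2"
  have B0: "0 < B" using G B by simp
  have Q2: "2 \<le> Q" using T(3) k(1) mult_mono[of 2 "B * sqrt T" 1 "k ^ 2"] by (simp add: Q_def)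
  have Qm: "Q \<le> \<rho> * real m"
  proof -
    have "Q \<le> \<rho> * k * k ^ 2" unfolding Q_def using T(2) by (intro mult_right_mono) (auto simp: k_def)
    also have "\<dots> = \<rho> * real m" unfolding k(2)[symmetric] by (simp add: power_numeral_reduce)
    finally show ?thesis .
  qed
  \<comment> \<open>The value of B is chosen for this: y \<ge> Q / 2 makes G y^2 / 8 at least 8 T
    k^4, and offsets down to y / 2 still satisfy the hypothesis of \<open>L\<close> with u = 16 T /
    G.\<close>
  have QQ: "Q ^ 2 = 256 * T * k ^ 4 / G"
    unfolding Q_def B using T(1) G by (simp add: power_mult_distrib power_divide)
  define y where "y = \<lfloor>Q\<rfloor>"
  have y: "0 \<le> y" "real_of_int y \<le> Q" "Q / 2 \<le> real_of_int y" "real_of_int y \<le> x"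
    using Q2 x by (auto simp: y_def Q_def k_def) linarith+
  have zQ: "\<bar>real_of_int z\<bar> \<le> real_of_int y / 2" using z(1) y(3) by (simp add: Q_def k_def)
  have zm: "\<bar>real_of_int z\<bar> \<le> \<rho> * real m" using zQ y Qm by linarith
  then have zm': "\<bar>z\<bar> < int m"
    using \<rho> m(3) mult_strict_right_mono[of \<rho> 1 "real m"] by linarith
  let ?u = "16 * T / G"
  have y2: "Q ^ 2 / 4 \<le> real_of_int y ^ 2"
    using power_mono[OF y(3), of 2] Q2 by (simp add: power_divide)
  \<comment> \<open>The range covers \<open>y\<close>, \<open>- y\<close> and also
    \<open>z - y\<close>, \<open>z + y\<close>, since |z| \<le> y / 2.\<close>
  have p\<sigma>: "prob {\<omega> \<in> space M. crosses_high m \<sigma> (env \<omega>)} \<le> 2 * exp (- c * (T / 2) powr \<alpha>)"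
    if \<sigma>: "real_of_int y / 2 \<le> \<bar>real_of_int \<sigma>\<bar>" "\<bar>real_of_int \<sigma>\<bar> \<le> 3 / 2 * real_of_int y" for \<sigma>
  proof -
    have "Q ^ 2 / 16 \<le> real_of_int \<sigma> ^ 2"
      using power_mono[OF \<sigma>(1), of 2] y y2 by (simp add: power_divide)
    then have "?u * cbrt m ^ 4 \<le> real_of_int \<sigma> ^ 2" unfolding QQ k_def by simp
    moreover have "\<bar>real_of_int \<sigma>\<bar> \<le> 2 * \<rho> * real m" using \<sigma>(2) y(2) Qm by linarith
    ultimately have "prob {\<omega> \<in> space M. crosses_high m \<sigma> (env \<omega>)} \<le> 2 * exp (- c * (G / 8 * ?u) powr \<alpha>)"
      by (intro L m T)
    also have "G / 8 * ?u = 2 * T" using G by simp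
    also have "2 * exp (- c * (2 * T) powr \<alpha>) \<le> 2 * exp (- c * (T / 2) powr \<alpha>)"
      using c \<alpha> T(1) by (simp add: powr_mono2)
    finally show ?thesis .
  qed
  define E1 where "E1 \<sigma> = {\<omega> \<in> space M. crosses_high m \<sigma> (env \<omega>)}" for \<sigma>
  define E2 where "E2 \<sigma> = {\<omega> \<in> space M. crosses_high m \<sigma> (reflect (pt (Suc m) z) (env \<omega>))}" for \<sigma>
  define E0 where "E0 = {\<omega> \<in> space M. flpp m z (env \<omega>) < \<mu> * real m - T * cbrt m}"
  have [measurable]: "E1 \<sigma> \<in> events" "E2 \<sigma> \<in> events" "E0 \<in> events" for \<sigma>
    unfolding E1_def E2_def E0_def by measurable
  have pE2: "prob (E2 \<sigma>) = prob (E1 \<sigma>)" for \<sigma>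
    unfolding E1_def E2_def by (rule prob_reflect) (auto intro!: field_space_Collect)
  have pE0: "prob E0 \<le> exp (- c * (T / 2) powr \<alpha>)"
  proof -
    \<comment> \<open>The second bound on z lets the offset cost at most half of T, so the lower
      tail can be used with the other half.\<close>
    have "A * real_of_int z ^ 2 / real m \<le> T / 2 * k"
    proof -
      have "real_of_int z ^ 2 \<le> (1 / (A + 1) * sqrt T * k ^ 2) ^ 2"
        using power_mono[OF z(2), of 2] by (simp add: k_def)
      also have "\<dots> = T * k ^ 4 / (A + 1) ^ 2"
        using T(1) by (simp add: power_mult_distrib power_divide)
      finally have "A * real_of_int z ^ 2 \<le> A * (T * k ^ 4 / (A + 1) ^ 2)" using A by (intro mult_left_mono) auto
      also have "\<dots> = (A / (A + 1) ^ 2) * (T * k ^ 4)" by simp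
      also have "\<dots> \<le> (1 / 2) * (T * k ^ 4)"
      proof (rule mult_right_mono)
        show "A / (A + 1) ^ 2 \<le> 1 / 2" using A by (simp add: divide_simps power2_eq_square) (simp add: algebra_simps)
      qed (use T k in simp)
      also have "\<dots> = T / 2 * k * real m" unfolding k(2)[symmetric] by (simp add: power_numeral_reduce)
      finally show ?thesis using m(3) by (simp add: pos_divide_le_eq)
    qed
    then have "E0 \<subseteq> {\<omega> \<in> space M. flpp m z (env \<omega>) < \<mu> * real m - A * real_of_int z ^ 2 / real m - T / 2 * cbrt m}"
      unfolding E0_def k_def by auto
    then have "prob E0 \<le> prob {\<omega> \<in> space M. flpp m z (env \<omega>) < \<mu> * real m - A * real_of_int z ^ 2 / real m - T / 2 * cbrt m}"
      by (rule finite_measure_mono) measurable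
    also have "\<dots> \<le> exp (- c * (T / 2) powr \<alpha>)"
      by (rule lower_tail[OF m(2) zm]) (use T in simp)
    finally show ?thesis .
  qed
  have "{\<omega> \<in> space M. slpp x m z (env \<omega>) < \<mu> * real m - T * cbrt m}
      \<subseteq> E0 \<union> ((E1 y \<union> E1 (- y)) \<union> (E2 (z - y) \<union> E2 (z + y)))"
  proof
    fix \<omega> assume "\<omega> \<in> {\<omega> \<in> space M. slpp x m z (env \<omega>) < \<mu> * real m - T * cbrt m}"
    then have \<omega>: "\<omega> \<in> space M" and low: "slpp x m z (env \<omega>) < \<mu> * real m - T * k" by (auto simp: k_def)
    show "\<omega> \<in> E0 \<union> ((E1 y \<union> E1 (- y)) \<union> (E2 (z - y) \<union> E2 (z + y)))"
    proof (rule ccontr)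
      assume no: "\<omega> \<notin> E0 \<union> ((E1 y \<union> E1 (- y)) \<union> (E2 (z - y) \<union> E2 (z + y)))"
      have "\<exists>p. dpath (1, 1) (pt m z) p \<and> set p \<subseteq> UNIV"
      proof -
        have "real_of_int \<bar>z\<bar> \<le> real m" using zm' by linarith
        from pt_path_exists[OF zm' this] m(3) show ?thesis by auto
      qed
      from clpp_attained[of "env \<omega>", OF env_nonneg this] obtain p where
        p: "dpath (1, 1) (pt m z) p" "path_weight (env \<omega>) p = flpp m z (env \<omega>)" by auto
      have high: "\<mu> * real m - T * k \<le> path_weight (env \<omega>) p" using no \<omega> p(2) by (auto simp: E0_def k_def)
      have "\<not> set p \<subseteq> strip x" using clpp_ge[OF p(1), of "strip x" "env \<omega>"] low high by (auto simp: slpp_def)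
      from path_exits_strip[OF p(1) this y(1,4)] obtain s \<sigma> where
        s: "\<sigma> \<in> {y, - y}" "1 \<le> s" "s \<le> m" "pt s \<sigma> \<in> set p" by auto
      note b = dpath_bounds[OF p(1) s(4)]
      have r1: "\<bar>\<sigma>\<bar> < int s" using b(1,2) by (auto simp: pt_def)
      have r2: "\<bar>z - \<sigma>\<bar> < int (Suc m - s)" using b(3,4) s(3) by (auto simp: pt_def)
      have n1: "\<not> crosses_high m \<sigma> (env \<omega>)" using no s(1) \<omega> by (auto simp: E1_def)
      have n2: "\<not> crosses_high m (z - \<sigma>) (reflect (pt (Suc m) z) (env \<omega>))"
        using no s(1) \<omega> by (auto simp: E2_def)
      have f1: "flpp s \<sigma> (env \<omega>) \<le> \<mu> * real s - (G / 8) * real_of_int \<sigma> ^ 2 / real m"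
        using n1 r1 s unfolding crosses_high_def by (meson atLeastAtMost_iff not_le)
      have "flpp (Suc m - s) (z - \<sigma>) (reflect (pt (Suc m) z) (env \<omega>))
          \<le> \<mu> * real (Suc m - s) - (G / 8) * real_of_int (z - \<sigma>) ^ 2 / real m"
      proof -
        have "Suc m - s \<in> {1..m}" using s by auto
        then show ?thesis using n2 r2 unfolding crosses_high_def by (meson not_le)
      qed
      \<comment> \<open>The curvature of the second part is given up; the first part alone already
        loses 8 T k.\<close>
      also have "\<dots> \<le> \<mu> * real (Suc m - s)" using G by simp
      finally have f2: "flpp (Suc m - s) (z - \<sigma>) (reflect (pt (Suc m) z) (env \<omega>)) \<le> \<mu> * real (Suc m - s)" .
      have f3: "8 * T * k \<le> (G / 8) * real_of_int \<sigma> ^ 2 / real m"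
      proof -
        have "real_of_int \<sigma> ^ 2 = real_of_int y ^ 2" using s(1) by auto
        then have "8 * T * k ^ 4 \<le> (G / 8) * real_of_int \<sigma> ^ 2"
          using y2 G unfolding QQ by (simp add: field_simps)
        moreover have "8 * T * k ^ 4 = 8 * T * k * real m" unfolding k(2)[symmetric] by (simp add: power_numeral_reduce)
        ultimately show ?thesis using m(3) by (simp add: pos_le_divide_eq)
      qed
      \<comment> \<open>The crossing vertex lies in both parts, so the heights add up to m + 1; the
        extra \<mu> is paid by \<mu> \<le> T \<le> T k.\<close>
      have f4: "\<mu> * real s + \<mu> * real (Suc m - s) = \<mu> * real m + \<mu>" using s(3) by (simp add: of_nat_diff algebra_simps)
      have "path_weight (env \<omega>) p \<le> flpp s \<sigma> (env \<omega>) + flpp (Suc m - s) (z - \<sigma>) (reflect (pt (Suc m) z) (env \<omega>))"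
        by (rule path_weight_through[OF env_nonneg p(1) s(4) s(3)])
      then have "path_weight (env \<omega>) p \<le> \<mu> * real m + \<mu> - 8 * T * k" using f1 f2 f3 f4 by linarith
      moreover have "T \<le> T * k" using T(1) k(1) by simp
      ultimately show False using high T(1,5) by linarith
    qed
  qed
  then have "prob {\<omega> \<in> space M. slpp x m z (env \<omega>) < \<mu> * real m - T * cbrt m}
      \<le> prob (E0 \<union> ((E1 y \<union> E1 (- y)) \<union> (E2 (z - y) \<union> E2 (z + y))))"
    by (rule finite_measure_mono) measurable
  also have "\<dots> \<le> prob E0 + ((prob (E1 y) + prob (E1 (- y))) + (prob (E2 (z - y)) + prob (E2 (z + y))))"
    by (intro order_trans[OF measure_Un_le] add_mono order_refl; measurable)
  also have "\<dots> \<le> exp (- c * (T / 2) powr \<alpha>) + ((2 * exp (- c * (T / 2) powr \<alpha>) + 2 * exp (- c * (T / 2) powr \<alpha>))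
      + (2 * exp (- c * (T / 2) powr \<alpha>) + 2 * exp (- c * (T / 2) powr \<alpha>)))"
    unfolding pE2 using zQ y(1) by (intro add_mono pE0; unfold E1_def; intro p\<sigma>) (auto simp: abs_le_iff)
  finally show ?thesis by simp
qed

lemma strip_tail_base: "strip_tail \<alpha> (1 / 2)"
proof -
  obtain L n\<^sub>0 where L: "0 < L" "\<And>n x u. n\<^sub>0 \<le> n \<Longrightarrow> 1 \<le> n \<Longrightarrow> \<bar>real_of_int x\<bar> \<le> 2 * \<rho> * real n \<Longrightarrow> L \<le> u \<Longrightarrow>
     u * cbrt n ^ 4 \<le> real_of_int x ^ 2 \<Longrightarrow>
     prob {\<omega> \<in> space M. crosses_high n x (env \<omega>)} \<le> 2 * exp (- c * (G / 8 * u) powr \<alpha>)"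
    using crosses_high_tail by blast
  define B where "B = 16 / sqrt G"
  have B: "0 < B" using G by (simp add: B_def)
  \<comment> \<open>Localisation needs B sqrt T \<le> \<rho> m^(1/3), while T may go up to \<mu>
    m^(2/3). Applying it at \<eta> T covers the whole range.\<close>
  define \<eta> where "\<eta> = min 1 ((\<rho> / B) ^ 2 / \<mu>)"
  have \<eta>: "0 < \<eta>" "\<eta> \<le> 1" "\<eta> * \<mu> \<le> (\<rho> / B) ^ 2"
    using \<rho> B \<mu> by (auto simp: \<eta>_def min_def field_simps)
  define K where "K = min (B / 4) (1 / (A + 1)) * sqrt \<eta>"
  have K: "0 < K" using B A \<eta> by (simp add: K_def)
  define c2 where "c2 = c * (\<eta> / 2) powr \<alpha> / 2"
  have c2: "0 < c2" using c \<eta> by (simp add: c2_def)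
  \<comment> \<open>Requiring \<mu> R \<le> T makes m exceed both thresholds whenever T < \<mu>
    m^(2/3).\<close>
  define R where "R = real (max n\<^sub>0 r\<^sub>0)"
  have R: "0 \<le> R" by (simp add: R_def)
  have ev: "\<forall>\<^sub>F T in at_top. 0 < T \<and> 2 \<le> B * sqrt (\<eta> * T) \<and> L \<le> 16 * (\<eta> * T) / G \<and> \<mu> \<le> \<eta> * T
      \<and> 2 * \<theta>\<^sub>0 \<le> \<eta> * T \<and> \<mu> * R \<le> T \<and> 9 * exp (- 2 * c2 * T powr \<alpha>) \<le> exp (- c2 * T powr \<alpha>)"
  proof (intro eventually_conj)
    show "\<forall>\<^sub>F T in at_top. 2 \<le> B * sqrt (\<eta> * T)" using B \<eta> by real_asymp
    show "\<forall>\<^sub>F T in at_top. L \<le> 16 * (\<eta> * T) / G" using G \<eta> by real_asymp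
    show "\<forall>\<^sub>F T in at_top. \<mu> \<le> \<eta> * T" using \<eta> by real_asymp
    show "\<forall>\<^sub>F T in at_top. 2 * \<theta>\<^sub>0 \<le> \<eta> * T" using \<eta> by real_asymp
    show "\<forall>\<^sub>F T in at_top. 9 * exp (- 2 * c2 * T powr \<alpha>) \<le> exp (- c2 * T powr \<alpha>)" using c2 \<alpha> by real_asymp
  qed (auto intro: eventually_gt_at_top eventually_ge_at_top)
  have "\<forall>\<^sub>F T in at_top. \<forall>m z x. 1 \<le> m \<longrightarrow>
     \<bar>real_of_int z\<bar> \<le> K * sqrt T * cbrt m ^ 2 \<longrightarrow> 2 * \<bar>real_of_int z\<bar> + B * T powr (1 / 2) * cbrt m ^ 2 \<le> x \<longrightarrow>
     prob {\<omega> \<in> space M. slpp x m z (env \<omega>) < \<mu> * real m - T * cbrt m} \<le> exp (- c2 * T powr \<alpha>)"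
    using ev
  proof eventually_elim
    case (elim T)
    show ?case
    proof (intro allI impI)
      fix m z x assume m: "1 \<le> m" and z: "\<bar>real_of_int z\<bar> \<le> K * sqrt T * cbrt m ^ 2"
        and x: "2 * \<bar>real_of_int z\<bar> + B * T powr (1 / 2) * cbrt m ^ 2 \<le> x"
      define k where "k = cbrt m"
      have k: "1 \<le> k" "k ^ 3 = real m" using cbrt_ge_1[OF m] cbrt_cube by (auto simp: k_def)
      have T: "0 < T" using elim by auto
      show "prob {\<omega> \<in> space M. slpp x m z (env \<omega>) < \<mu> * real m - T * cbrt m} \<le> exp (- c2 * T powr \<alpha>)"
      proof (cases "T \<ge> \<mu> * k ^ 2")
        case True
        then show ?thesis by (simp add: k_def prob_slpp_eq_0)
      next
        case False
        have "\<mu> * R < \<mu> * k ^ 2" using False elim by linarith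
        then have "R < k ^ 2" using \<mu> by simp
        also have "\<dots> \<le> real m" unfolding k(2)[symmetric] using k(1) by (intro power_increasing) auto
        finally have mR: "n\<^sub>0 \<le> m" "r\<^sub>0 \<le> m" by (auto simp: R_def)
        have sq: "sqrt (\<eta> * T) = sqrt \<eta> * sqrt T" by (rule real_sqrt_mult)
        have K2: "K * sqrt T * cbrt m ^ 2 = min (B / 4) (1 / (A + 1)) * sqrt (\<eta> * T) * cbrt m ^ 2"
          unfolding K_def sq by simp
        have z1: "\<bar>real_of_int z\<bar> \<le> B / 4 * sqrt (\<eta> * T) * cbrt m ^ 2"
          using z unfolding K2 by (rule order_trans) (intro mult_right_mono min.cobounded1; use \<eta> T in simp)
        have z2: "\<bar>real_of_int z\<bar> \<le> 1 / (A + 1) * sqrt (\<eta> * T) * cbrt m ^ 2"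
          using z unfolding K2 by (rule order_trans) (intro mult_right_mono min.cobounded2; use \<eta> T in simp)
        have x1: "B * sqrt (\<eta> * T) * cbrt m ^ 2 \<le> x"
        proof -
          have "sqrt (\<eta> * T) \<le> sqrt T" using \<eta> T by (simp add: mult_left_le_one_le)
          then have "B * sqrt (\<eta> * T) * cbrt m ^ 2 \<le> B * sqrt T * cbrt m ^ 2"
            using B by (intro mult_right_mono mult_left_mono) auto
          then show ?thesis using x T by (simp add: powr_half_sqrt)
        qed
        have rho: "B * sqrt (\<eta> * T) \<le> \<rho> * cbrt m"
        proof -
          have "\<eta> * T \<le> \<eta> * (\<mu> * k ^ 2)" using False \<eta> by (intro mult_left_mono) auto
          also have "\<dots> \<le> (\<rho> / B) ^ 2 * k ^ 2" using mult_right_mono[OF \<eta>(3), of "k ^ 2"] by (simp add: mult.assoc)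
          also have "\<dots> = (\<rho> / B * k) ^ 2" by (rule power_mult_distrib[symmetric])
          finally have "sqrt (\<eta> * T) \<le> \<rho> / B * k" using \<rho> B k by (intro real_le_lsqrt) auto
          then show ?thesis using B unfolding k_def by (simp add: field_simps)
        qed
        have "prob {\<omega> \<in> space M. slpp x m z (env \<omega>) < \<mu> * real m - T * cbrt m}
          \<le> prob {\<omega> \<in> space M. slpp x m z (env \<omega>) < \<mu> * real m - \<eta> * T * cbrt m}"
        proof (rule finite_measure_mono)
          have "\<eta> * T * cbrt m \<le> T * cbrt m" using \<eta> T by (intro mult_right_mono) (auto simp: mult_left_le_one_le)
          then show "{\<omega> \<in> space M. slpp x m z (env \<omega>) < \<mu> * real m - T * cbrt m}
            \<subseteq> {\<omega> \<in> space M. slpp x m z (env \<omega>) < \<mu> * real m - \<eta> * T * cbrt m}" by auto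
        qed measurable
        also have "\<dots> \<le> 9 * exp (- c * (\<eta> * T / 2) powr \<alpha>)"
          by (rule strip_tail_moderate[OF L(2) B_def mR m _ rho _ _ _ _ z1 z2 x1]) (use elim \<eta> in auto)
        also have "c * (\<eta> * T / 2) powr \<alpha> = 2 * c2 * T powr \<alpha>"
          using powr_mult[of "\<eta> / 2" T \<alpha>] \<eta> T by (simp add: c2_def)
        then have "9 * exp (- c * (\<eta> * T / 2) powr \<alpha>) = 9 * exp (- 2 * c2 * T powr \<alpha>)" by simp
        also have "\<dots> \<le> exp (- c2 * T powr \<alpha>)" using elim by auto
        finally show ?thesis .
      qed
    qed
  qed
  then show ?thesis unfolding strip_tail_def using K B c2 by blast
qed

end

subsection \<open>Improving the tail exponent\<close>

lemma floor_multiples_bounds: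
  fixes m z k :: int
  assumes "0 < k"
  shows "real_of_int (i * m div k) \<le> real_of_int i * (real_of_int m / real_of_int k)"
    "real_of_int i * (real_of_int m / real_of_int k) < real_of_int (i * m div k) + 1"
proof -
  have e: "i * m div k = \<lfloor>real_of_int i * (real_of_int m / real_of_int k)\<rfloor>"
    using floor_divide_of_int_eq[of "i * m" k, where 'a = real] by simp
  show "real_of_int (i * m div k) \<le> real_of_int i * (real_of_int m / real_of_int k)"
    "real_of_int i * (real_of_int m / real_of_int k) < real_of_int (i * m div k) + 1"
    unfolding e by linarith+
qed

lemma floor_multiples_step:
  fixes m k :: int
  assumes "0 < k"
  shows "\<bar>real_of_int ((i + 1) * m div k) - real_of_int (i * m div k) - real_of_int m / real_of_int k\<bar> < 1"
proof -
  have "real_of_int (i + 1) * (real_of_int m / real_of_int k)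
      = real_of_int i * (real_of_int m / real_of_int k) + real_of_int m / real_of_int k"
    by (simp add: distrib_right add_divide_distrib)
  then show ?thesis
    using floor_multiples_bounds[OF assms, of i m] floor_multiples_bounds[OF assms, of "i + 1" m] by linarith
qed

text \<open>Equal cutting into k pieces of natural scale q = (m/k)^(1/3), with S the deficit per
  piece on that scale; after rounding, a piece has scale at most 2 q, whence S / 2. Concentration
  asks for the tail of one piece up to k N times this deficit, so the common half-width x' must suit
  the worst of them. This is the term with exponent b, which for b = 0 does not depend on k N. N = 1
  serves to improve the exponent, large N to reach the cubic one.\<close>

lemma (in lpp_tails) corridors_strip_tail:
  fixes K B c' T\<^sub>1 a b S x x' :: real and \<Delta> z :: int and m k N l :: nat
  assumes tail: "\<And>T m z x. T\<^sub>1 \<le> T \<Longrightarrow> 1 \<le> m \<Longrightarrow> \<bar>real_of_int z\<bar> \<le> K * sqrt T * cbrt m ^ 2 \<Longrightarrow>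
       2 * \<bar>real_of_int z\<bar> + B * T powr b * cbrt m ^ 2 \<le> x \<Longrightarrow>
       prob {\<omega> \<in> space M. slpp x m z (env \<omega>) < \<mu> * real m - T * cbrt m} \<le> exp (- c' * T powr a)"
    and pos: "0 < K" "0 < B" "0 < c'" "0 < a" "a \<le> 1" "0 \<le> b"
    and S: "2 * T\<^sub>1 \<le> S" "0 < S" and k: "1 \<le> k" "1 \<le> N" "2 * k \<le> m"
    and q: "q = (real m / real k) powr (1 / 3)"
    and hz: "\<bar>real_of_int z\<bar> / real k + 1 \<le> K / 4 * sqrt S * q ^ 2" "\<bar>real_of_int z\<bar> / real k + 1 < real m / real k - 1"
    and x': "2 * (\<bar>real_of_int z\<bar> / real k + 1) + 2 * B * (real (k * N) * S / 2) powr b * q ^ 2 \<le> x'" "1 \<le> x'"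
    and x: "\<bar>real_of_int z\<bar> + 1 + x' \<le> x" and \<Delta>: "2 * x' < real_of_int \<Delta>"
    and b1: "(\<Sum>n=1..k * N. exp (- (c' * (S / 2) powr a / 2) * real n powr a)) \<le> 1"
  shows "prob {\<omega> \<in> space M. \<forall>j<N. slpp x m z (shift_field (pt l (int j * \<Delta>)) (env \<omega>)) < \<mu> * real m - 4 * real k * (S * q)}
    \<le> (real (k * N) + 1) * exp (- (c' * (S / 2) powr a) * real (k * N) powr a)"
proof -
  \<comment> \<open>Rounding the cumulative positions and not the single lengths makes the end point
    exact: \<open>L k = m\<close> and \<open>Z k = z\<close>.\<close>
  define L where "L i = i * m div k" for i
  define Z where "Z i = int i * z div int k" for i
  define Q where "Q = real m / real k"
  have Q2: "2 \<le> Q" using k by (simp add: Q_def pos_le_divide_eq)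
  have q0: "0 < q" unfolding q using k by simp
  have kk: "0 < int k" using k by simp
  have Lint: "int (L i) = int i * int m div int k" for i by (simp add: L_def zdiv_int)
  have Lb: "\<bar>real (L (Suc i)) - real (L i) - Q\<bar> < 1" for i
    using floor_multiples_step[OF kk, of "int i" "int m"] unfolding Q_def
    by (metis Lint of_int_of_nat_eq of_nat_Suc add.commute)
  have Lmono: "L i \<le> L (Suc i)" for i unfolding L_def by (intro div_le_mono) simp
  have Zb: "\<bar>real_of_int (Z (Suc i) - Z i)\<bar> \<le> \<bar>real_of_int z\<bar> / real k + 1" for i
  proof -
    have "\<bar>real_of_int (Z (Suc i) - Z i) - real_of_int z / real k\<bar> < 1"
      using floor_multiples_step[OF kk, of "int i" z] unfolding Z_def by (simp add: add.commute)
    moreover have "\<bar>real_of_int z / real k\<bar> = \<bar>real_of_int z\<bar> / real k" by simp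
    ultimately show ?thesis by linarith
  qed
  have Zi: "\<bar>real_of_int (Z i)\<bar> \<le> \<bar>real_of_int z\<bar> + 1" if "i \<le> k" for i
  proof -
    have "\<bar>real_of_int (Z i) - real i * (real_of_int z / real k)\<bar> \<le> 1"
      using floor_multiples_bounds[OF kk, of "int i" z] unfolding Z_def by (simp add: abs_le_iff)
    moreover have "\<bar>real i * (real_of_int z / real k)\<bar> = (real i / real k) * \<bar>real_of_int z\<bar>" by (simp add: abs_mult)
    moreover have "(real i / real k) * \<bar>real_of_int z\<bar> \<le> 1 * \<bar>real_of_int z\<bar>"
      using that k by (intro mult_right_mono) auto
    ultimately show ?thesis by linarith
  qed
  define mm where "mm i = L (Suc i) - L i" for i
  have mm: "real (mm i) = real (L (Suc i)) - real (L i)" for i using Lmono[of i] by (simp add: mm_def of_nat_diff)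
  have mmQ: "Q - 1 < real (mm i)" "real (mm i) < Q + 1" for i using Lb[of i] mm[of i] by linarith+
  have mm1: "1 \<le> mm i" for i using mmQ(1)[of i] Q2 by simp
  have two: "(2::real) powr (1 / 3) \<le> 2" using powr_mono[of "1/3" 1 "2::real"] by simp
  have four: "((2::real) powr (1 / 3)) ^ 2 \<le> 2"
  proof -
    have "((2::real) powr (1 / 3)) ^ 2 = 2 powr (2 / 3)" by (simp add: powr_powr flip: powr_numeral)
    also have "\<dots> \<le> 2 powr 1" by (intro powr_mono) auto
    finally show ?thesis by simp
  qed
  have cm1: "cbrt (mm i) \<le> 2 powr (1 / 3) * q" for i
  proof -
    have "cbrt (mm i) \<le> (2 * Q) powr (1 / 3)" using mmQ(2)[of i] Q2 by (intro powr_mono2) auto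
    also have "\<dots> = 2 powr (1 / 3) * q" using Q2 powr_mult[of 2 Q "1 / 3"] unfolding q Q_def by simp
    finally show ?thesis .
  qed
  have cm1a: "cbrt (mm i) \<le> 2 * q" for i
    using cm1[of i] mult_right_mono[OF two, of q] q0 by linarith
  have cm1b: "cbrt (mm i) ^ 2 \<le> 2 * q ^ 2" for i
  proof -
    have "cbrt (mm i) ^ 2 \<le> (2 powr (1 / 3) * q) ^ 2" using cm1 by (intro power_mono) auto
    also have "\<dots> \<le> 2 * q ^ 2" unfolding power_mult_distrib using four by (intro mult_right_mono) auto
    finally show ?thesis .
  qed
  have cm2: "q ^ 2 \<le> 2 * cbrt (mm i) ^ 2" for i
  proof -
    have "q \<le> (2 * real (mm i)) powr (1 / 3)" unfolding q Q_def[symmetric] using mmQ(1)[of i] Q2 by (intro powr_mono2) auto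
    then have "q \<le> 2 powr (1 / 3) * cbrt (mm i)" by (simp add: powr_mult)
    then have "q ^ 2 \<le> (2 powr (1 / 3) * cbrt (mm i)) ^ 2" using q0 by (intro power_mono) auto
    also have "\<dots> \<le> 2 * cbrt (mm i) ^ 2" unfolding power_mult_distrib using four by (intro mult_right_mono) auto
    finally show ?thesis .
  qed
  have Lk: "L k = m" "Z k = z" using k by (auto simp: L_def Z_def)
  have "prob {\<omega> \<in> space M. \<forall>j<N. slpp x (L k) (Z k) (shift_field (pt l (int j * \<Delta>)) (env \<omega>)) < \<mu> * real (L k) - 4 * real k * (S * q)}
    \<le> (real (k * N) + 1) * exp (- (c' * (S / 2) powr a) * real (k * N) powr a)"
  proof (rule corridors_bound[where x' = x'])
    show "0 < S * q" using S q0 by simp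
    show "0 < c' * (S / 2) powr a" using pos S by simp
    show "L 0 = 0" "Z 0 = 0" by (auto simp: L_def Z_def)
    show "real_of_int \<bar>Z i\<bar> + x' \<le> x" if "i \<le> k" for i using Zi[OF that] x by simp
    show "real_of_int \<bar>Z (Suc i) - Z i\<bar> \<le> x'" for i
    proof -
      have "0 \<le> 2 * B * (real (k * N) * S / 2) powr b * q ^ 2" using pos by simp
      moreover have "0 \<le> \<bar>real_of_int z\<bar> / real k + 1" by simp
      moreover have "u \<le> t" if "0 \<le> p" "0 \<le> u" "2 * u + p \<le> t" for u p t :: real using that by linarith
      ultimately have "\<bar>real_of_int z\<bar> / real k + 1 \<le> x'" using x'(1) by blast
      then show ?thesis unfolding of_int_abs by (rule order_trans[OF Zb])
    qed
    show "\<bar>Z (Suc i) - Z i\<bar> < int (L (Suc i) - L i)" for i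
    proof -
      have "real_of_int \<bar>Z (Suc i) - Z i\<bar> < real (mm i)" using Zb[of i] hz(2) mmQ(1)[of i] by (simp add: Q_def)
      then show ?thesis unfolding mm_def by linarith
    qed
  next
    fix i n assume n: "1 \<le> n" "n \<le> k * N"
    let ?T = "real n * S / 2"
    have nS: "S / 2 \<le> ?T" using n S mult_right_mono[of 1 "real n" S] by simp
    have zi: "\<bar>real_of_int (Z (Suc i) - Z i)\<bar> \<le> K * sqrt ?T * cbrt (mm i) ^ 2"
    proof -
      have "sqrt S / 2 \<le> sqrt ?T"
      proof -
        have "sqrt S / 2 = sqrt (S / 4)" by (simp add: real_sqrt_divide)
        also have "\<dots> \<le> sqrt ?T" using nS S by (intro real_sqrt_le_mono) linarith
        finally show ?thesis .
      qed
      then have "sqrt S / 2 * (q ^ 2 / 2) \<le> sqrt ?T * cbrt (mm i) ^ 2"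
        using cm2[of i] S by (intro mult_mono) auto
      then have *: "K * (sqrt S / 2 * (q ^ 2 / 2)) \<le> K * (sqrt ?T * cbrt (mm i) ^ 2)"
        using pos by (intro mult_left_mono) auto
      have "\<bar>real_of_int (Z (Suc i) - Z i)\<bar> \<le> K / 4 * sqrt S * q ^ 2" by (rule order_trans[OF Zb hz(1)])
      also have "\<dots> = K * (sqrt S / 2 * (q ^ 2 / 2))" by simp
      also note *
      finally show ?thesis by (simp only: mult.assoc)
    qed
    have xi: "2 * \<bar>real_of_int (Z (Suc i) - Z i)\<bar> + B * ?T powr b * cbrt (mm i) ^ 2 \<le> x'"
    proof -
      have "real n \<le> real (k * N)" using n(2) by (rule of_nat_mono)
      then have "?T \<le> real (k * N) * S / 2" using S by (simp add: mult_right_mono)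
      then have "?T powr b \<le> (real (k * N) * S / 2) powr b" using pos n S by (intro powr_mono2) auto
      then have "B * ?T powr b * cbrt (mm i) ^ 2 \<le> B * (real (k * N) * S / 2) powr b * (2 * q ^ 2)"
        using cm1b[of i] pos by (intro mult_mono) auto
      also have "\<dots> = 2 * B * (real (k * N) * S / 2) powr b * q ^ 2" by simp
      finally have "B * ?T powr b * cbrt (mm i) ^ 2 \<le> 2 * B * (real (k * N) * S / 2) powr b * q ^ 2" .
      moreover have "2 * \<bar>real_of_int (Z (Suc i) - Z i)\<bar> \<le> 2 * (\<bar>real_of_int z\<bar> / real k + 1)"
        by (rule mult_left_mono[OF Zb]) simp
      ultimately show ?thesis by (intro order_trans[OF add_mono x'(1)])
    qed
    have "prob {\<omega> \<in> space M. slpp x' (mm i) (Z (Suc i) - Z i) (env \<omega>) < \<mu> * real (mm i) - real n * (S * q)}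
      \<le> prob {\<omega> \<in> space M. slpp x' (mm i) (Z (Suc i) - Z i) (env \<omega>) < \<mu> * real (mm i) - ?T * cbrt (mm i)}"
    proof (rule finite_measure_mono)
      have "?T * cbrt (mm i) \<le> ?T * (2 * q)" using cm1a n S by (intro mult_left_mono) auto
      then have "?T * cbrt (mm i) \<le> real n * (S * q)" by simp
      then show "{\<omega> \<in> space M. slpp x' (mm i) (Z (Suc i) - Z i) (env \<omega>) < \<mu> * real (mm i) - real n * (S * q)}
        \<subseteq> {\<omega> \<in> space M. slpp x' (mm i) (Z (Suc i) - Z i) (env \<omega>) < \<mu> * real (mm i) - ?T * cbrt (mm i)}" by auto
    qed measurable
    also have "\<dots> \<le> exp (- c' * ?T powr a)"
      by (rule tail[OF _ mm1 zi xi]) (use nS S in linarith)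
    also have "?T powr a = real n powr a * (S / 2) powr a"
      using powr_mult[of "real n" "S / 2" a] S n by simp
    finally show "prob {\<omega> \<in> space M. slpp x' (L (Suc i) - L i) (Z (Suc i) - Z i) (env \<omega>)
         < \<mu> * real (L (Suc i) - L i) - real n * (S * q)} \<le> exp (- (c' * (S / 2) powr a) * real n powr a)"
      by (simp add: mm_def mult_ac)
  qed (use k pos x' \<Delta> b1 Lmono in auto)
  then show ?thesis unfolding Lk .
qed

lemma sum_inverse_squares_le: "(\<Sum>n=1..k. 1 / real n ^ 2) \<le> 2 - 1 / real k"
proof (induction k)
  case (Suc k)
  show ?case
  proof (cases "k = 0")
    case False
    then have "1 / real (Suc k) ^ 2 \<le> 1 / real k - 1 / real (Suc k)"
      by (simp add: divide_simps power2_eq_square)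
    then show ?thesis using Suc by simp
  qed simp
qed simp

text \<open>Supplies the summability hypothesis of the concentration bound uniformly in the number
  of pieces: for large S every term is at most 1 / (2 n^2).\<close>

lemma stretched_exp_sum_le_1:
  assumes "0 < c" "0 < (a::real)"
  shows "\<forall>\<^sub>F S in at_top. \<forall>k::nat. (\<Sum>n=1..k. exp (- (c * (S / 2) powr a / 2) * real n powr a)) \<le> 1"
proof -
  have "\<forall>\<^sub>F y in at_top. exp (- (c / 2) * y powr a) \<le> 1 / (2 * y ^ 2)" using assms by real_asymp
  then obtain Y where Y: "\<And>y. Y \<le> y \<Longrightarrow> exp (- (c / 2) * y powr a) \<le> 1 / (2 * y ^ 2)"
    by (auto simp: eventually_at_top_linorder)
  have "\<forall>\<^sub>F S in at_top. 2 \<le> S \<and> 2 * Y \<le> S" by (intro eventually_conj eventually_ge_at_top)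
  then show ?thesis
  proof eventually_elim
    case (elim S)
    show ?case
    proof
      fix k
      have "(\<Sum>n=1..k. exp (- (c * (S / 2) powr a / 2) * real n powr a)) \<le> (\<Sum>n=1..k. 1 / 2 * (1 / real n ^ 2))"
      proof (rule sum_mono)
        fix n assume "n \<in> {1..k}"
        then have n: "1 \<le> real n" by simp
        then have nS: "S / 2 \<le> real n * (S / 2)" "real n \<le> real n * (S / 2)"
          using elim mult_right_mono[of 1 "real n" "S / 2"] mult_left_mono[of 1 "S / 2" "real n"] by auto
        have "exp (- (c * (S / 2) powr a / 2) * real n powr a) = exp (- (c / 2) * (real n * (S / 2)) powr a)"
          using elim n powr_mult[of "real n" "S / 2" a] by simp
        also have "\<dots> \<le> 1 / (2 * (real n * (S / 2)) ^ 2)" using nS elim by (intro Y) linarith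
        also have "\<dots> \<le> 1 / (2 * real n ^ 2)" using nS n by (intro divide_left_mono mult_left_mono power_mono) auto
        finally show "exp (- (c * (S / 2) powr a / 2) * real n powr a) \<le> 1 / 2 * (1 / real n ^ 2)" by simp
      qed
      also have "\<dots> = 1 / 2 * (\<Sum>n=1..k. 1 / real n ^ 2)" by (simp add: sum_distrib_left)
      also have "\<dots> \<le> 1 / 2 * 2" using sum_inverse_squares_le[of k]
        by (intro mult_left_mono) (auto intro: order_trans)
      finally show "(\<Sum>n=1..k. exp (- (c * (S / 2) powr a / 2) * real n powr a)) \<le> 1" by simp
    qed
  qed
qed

lemma cube_powr_third: "0 \<le> w \<Longrightarrow> (w ^ 3) powr (1 / 3) = (w :: real)"
  by (cases "w = 0") (simp_all add: powr_powr flip: powr_numeral)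

text \<open>In the applications v is the square root of a rescaled deficit, and v^3 is the number of
  pieces before rounding; 2 \<le> v^3 keeps the loss by rounding within a factor 2.\<close>

lemma floor_three_halves:
  fixes v :: real
  assumes "0 \<le> v" "2 \<le> v ^ 3" "k = nat \<lfloor>v ^ 3\<rfloor>"
  shows "2 \<le> k" "real k \<le> v ^ 3" "v ^ 3 / 2 \<le> real k" "cbrt k \<le> v" "v / 2 \<le> cbrt k"
proof -
  have k: "2 \<le> \<lfloor>v ^ 3\<rfloor>" using assms(2) by (simp add: le_floor_iff)
  then show "2 \<le> k" using assms(3) by linarith
  have rk: "real k = real_of_int \<lfloor>v ^ 3\<rfloor>" unfolding assms(3) by (rule of_nat_nat) (use k in linarith)
  then show k1: "real k \<le> v ^ 3" "v ^ 3 / 2 \<le> real k" using k by linarith+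
  have "cbrt k \<le> (v ^ 3) powr (1 / 3)" using k1 by (intro powr_mono2) auto
  then show "cbrt k \<le> v" using cube_powr_third assms(1) by simp
  have "((v / 2) ^ 3) powr (1 / 3) \<le> cbrt k"
    using k1 assms(1,2) by (intro powr_mono2) (auto simp: power_divide)
  then show "v / 2 \<le> cbrt k" using cube_powr_third[of "v / 2"] assms(1) by simp
qed

text \<open>With k of order T^(3/2) pieces, concentration at exponent a yields exp (- C k^a), that
  is exponent 3 a / 2 in T. The width exponent drops to 0 since the worst piece deficit, of order k,
  asks for width k^(1/2) (m/k)^(2/3), which is at most m^(2/3).\<close>

lemma (in lpp_tails) strip_tail_step:
  assumes "strip_tail a (1 / 2)" "0 < a" "a \<le> 1"
  shows "strip_tail (3 / 2 * a) 0"
proof -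
  obtain K B c' where pos: "0 < K" "0 < B" "0 < c'" and ev: "\<forall>\<^sub>F T in at_top. \<forall>m z x. 1 \<le> m \<longrightarrow>
     \<bar>real_of_int z\<bar> \<le> K * sqrt T * cbrt m ^ 2 \<longrightarrow> 2 * \<bar>real_of_int z\<bar> + B * T powr (1 / 2) * cbrt m ^ 2 \<le> x \<longrightarrow>
     prob {\<omega> \<in> space M. slpp x m z (env \<omega>) < \<mu> * real m - T * cbrt m} \<le> exp (- c' * T powr a)"
    using assms(1) unfolding strip_tail_def by blast
  then obtain T\<^sub>1 where tail: "\<And>T m z x. T\<^sub>1 \<le> T \<Longrightarrow> 1 \<le> m \<Longrightarrow> \<bar>real_of_int z\<bar> \<le> K * sqrt T * cbrt m ^ 2 \<Longrightarrow>
       2 * \<bar>real_of_int z\<bar> + B * T powr (1 / 2) * cbrt m ^ 2 \<le> x \<Longrightarrow>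
       prob {\<omega> \<in> space M. slpp x m z (env \<omega>) < \<mu> * real m - T * cbrt m} \<le> exp (- c' * T powr a)"
    unfolding eventually_at_top_linorder by blast
  have "\<forall>\<^sub>F S in at_top. 8 \<le> K * sqrt S" using pos by real_asymp
  then have "\<forall>\<^sub>F S in at_top. 8 \<le> K * sqrt S \<and> 2 * T\<^sub>1 \<le> S \<and> \<mu> \<le> S \<and>
      (\<forall>k::nat. (\<Sum>n=1..k. exp (- (c' * (S / 2) powr a / 2) * real n powr a)) \<le> 1)"
    by (intro eventually_conj eventually_ge_at_top stretched_exp_sum_le_1 pos assms)
  \<comment> \<open>S is fixed from here on. It exceeds the tail threshold, absorbs the rounding of
    slopes (8 \<le> K sqrt S), and \<mu> \<le> S ensures that at most m / 8 pieces are cut.\<close>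
  then obtain S where S: "8 \<le> K * sqrt S" "2 * T\<^sub>1 \<le> S" "\<mu> \<le> S"
      "\<And>k::nat. (\<Sum>n=1..k. exp (- (c' * (S / 2) powr a / 2) * real n powr a)) \<le> 1"
    using eventually_happens'[OF trivial_limit_at_top_linorder] by blast
  have S0: "0 < S" using S(3) \<mu> by simp
  define C where "C = c' * (S / 2) powr a"
  have C: "0 < C" using pos S0 by (simp add: C_def)
  \<comment> \<open>The first bound keeps the slope of each piece admissible for the given tail; the
    second gives |z| \<le> m / 2 when T < \<mu> m^(2/3).\<close>
  define K' where "K' = min (K / 32) (1 / (2 * sqrt \<mu>))"
  have K': "0 < K'" "K' \<le> K / 32" "K' * sqrt \<mu> \<le> 1 / 2"
    using pos \<mu> mult_right_mono[of K' "1 / (2 * sqrt \<mu>)" "sqrt \<mu>"] by (auto simp: K'_def)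
  define B' where "B' = 3 + 2 * B * sqrt S"
  have B': "0 < B'" using pos S0 by (simp add: B'_def add_pos_nonneg)
  \<comment> \<open>Chosen so that 4 k S q = 4 S k^(2/3) m^(1/3) is at most T m^(1/3) when k \<le>
    V^3.\<close>
  define V where "V T = sqrt (T / (4 * S))" for T
  define c2 where "c2 = (C / 2) * ((1 / 2) powr a * (1 / (4 * S)) powr (3 / 2 * a))"
  have c2: "0 < c2" using C S0 by (simp add: c2_def)
  have Vlim: "filterlim (\<lambda>T. V T ^ 3) at_top at_top" unfolding V_def using S0 by real_asymp
  have "\<forall>\<^sub>F u in at_top. 2 \<le> u \<and> (u + 1) * exp (- C * (u / 2) powr a) \<le> exp (- (C / 2) * (u / 2) powr a)"
    by (intro eventually_conj eventually_ge_at_top) (use C assms in real_asymp)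
  from filterlim_compose[OF filterlim_ident Vlim] this
  have ev2: "\<forall>\<^sub>F T in at_top. 2 \<le> V T ^ 3 \<and> (V T ^ 3 + 1) * exp (- C * (V T ^ 3 / 2) powr a) \<le> exp (- (C / 2) * (V T ^ 3 / 2) powr a)"
    using eventually_compose_filterlim Vlim by blast
  have "\<forall>\<^sub>F T in at_top. \<forall>m z x. 1 \<le> m \<longrightarrow>
     \<bar>real_of_int z\<bar> \<le> K' * sqrt T * cbrt m ^ 2 \<longrightarrow> 2 * \<bar>real_of_int z\<bar> + B' * T powr 0 * cbrt m ^ 2 \<le> x \<longrightarrow>
     prob {\<omega> \<in> space M. slpp x m z (env \<omega>) < \<mu> * real m - T * cbrt m} \<le> exp (- c2 * T powr (3 / 2 * a))"
    using ev2 eventually_gt_at_top[of 0]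
  proof eventually_elim
    case (elim T)
    show ?case
    proof (intro allI impI)
      fix m z x assume m: "1 \<le> m" and z: "\<bar>real_of_int z\<bar> \<le> K' * sqrt T * cbrt m ^ 2"
        and x: "2 * \<bar>real_of_int z\<bar> + B' * T powr 0 * cbrt m ^ 2 \<le> x"
      show "prob {\<omega> \<in> space M. slpp x m z (env \<omega>) < \<mu> * real m - T * cbrt m} \<le> exp (- c2 * T powr (3 / 2 * a))"
      proof (cases "\<mu> * cbrt m ^ 2 \<le> T")
        case True
        then show ?thesis by (simp add: prob_slpp_eq_0)
      next
        case False
        define \<kappa> where "\<kappa> = cbrt m"
        have \<kappa>: "1 \<le> \<kappa>" "\<kappa> ^ 3 = real m" using cbrt_ge_1[OF m] cbrt_cube by (auto simp: \<kappa>_def)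
        define v where "v = V T"
        define k where "k = nat \<lfloor>v ^ 3\<rfloor>"
        have T: "0 < T" "2 \<le> v ^ 3" using elim by (auto simp: v_def)
        have v0: "0 \<le> v" using T S0 by (simp add: v_def V_def)
        have v2: "v ^ 2 = T / (4 * S)" using T S0 by (simp add: v_def V_def)
        note k = floor_three_halves[OF v0 T(2) k_def]
        define k3 where "k3 = cbrt k"
        have k3: "1 \<le> k3" "k3 ^ 3 = real k" "k3 \<le> v" "v / 2 \<le> k3"
          using cbrt_ge_1[of k] k cbrt_cube by (auto simp: k3_def)
        have sT: "sqrt T \<le> 4 * sqrt S * k3"
        proof -
          have "sqrt T = 2 * sqrt S * v" unfolding v_def V_def using S0 T by (simp add: real_sqrt_divide real_sqrt_mult)
          also have "\<dots> \<le> 2 * sqrt S * (2 * k3)" using k3 S0 by (intro mult_left_mono) auto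
          finally show ?thesis by simp
        qed
        define q where "q = (real m / real k) powr (1 / 3)"
        have q\<kappa>: "q = \<kappa> / k3" unfolding q_def \<kappa>_def k3_def by (simp add: powr_divide)
        have v\<kappa>: "v \<le> \<kappa> / 2"
        proof -
          have "v ^ 2 \<le> (\<kappa> / 2) ^ 2"
          proof -
            have "T \<le> S * \<kappa> ^ 2" using False S(3) mult_right_mono[of \<mu> S "\<kappa> ^ 2"] by (simp add: \<kappa>_def)
            then show ?thesis unfolding v2 using S0 by (simp add: field_simps)
          qed
          then show ?thesis using \<kappa> by (intro power2_le_imp_le[of v]) auto
        qed
        have k8: "8 * real k \<le> real m"
        proof -
          have "real k \<le> v ^ 3" by (rule k)
          also have "\<dots> \<le> (\<kappa> / 2) ^ 3" using v\<kappa> v0 by (intro power_mono) auto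
          also have "\<dots> = real m / 8" using \<kappa>(2) by (simp add: power_divide)
          finally show ?thesis by simp
        qed
        have q1: "1 \<le> q" using v\<kappa> k3 \<kappa> by (simp add: q\<kappa>)
        have kpos: "0 < real k" "0 < k3" using k(1) k3 by auto
        have zk: "\<bar>real_of_int z\<bar> / real k \<le> K / 8 * sqrt S * q ^ 2"
        proof -
          have "\<bar>real_of_int z\<bar> / real k \<le> K' * sqrt T * \<kappa> ^ 2 / k3 ^ 3"
            unfolding k3 using z kpos by (intro divide_right_mono) (auto simp: \<kappa>_def)
          also have "\<dots> = K' * (sqrt T / k3) * q ^ 2"
            unfolding q\<kappa> using kpos by (simp add: power_divide power_numeral_reduce)
          also have "\<dots> \<le> K / 32 * (4 * sqrt S) * q ^ 2"
            using K' pos sT kpos S0 T by (intro mult_right_mono mult_mono) (auto simp: pos_divide_le_eq)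
          finally show ?thesis by simp
        qed
        have hz1: "\<bar>real_of_int z\<bar> / real k + 1 \<le> K / 4 * sqrt S * q ^ 2"
        proof -
          have "1 \<le> K / 8 * sqrt S" using S(1) by simp
          also have "\<dots> \<le> K / 8 * sqrt S * q ^ 2" using q1 pos S0 by simp
          finally show ?thesis using zk by linarith
        qed
        have zm: "\<bar>real_of_int z\<bar> \<le> real m / 2"
        proof -
          have "sqrt T \<le> sqrt \<mu> * \<kappa>"
            using False \<mu> \<kappa> T by (intro real_le_lsqrt) (auto simp: power_mult_distrib \<kappa>_def)
          then have "K' * sqrt T * \<kappa> ^ 2 \<le> K' * (sqrt \<mu> * \<kappa>) * \<kappa> ^ 2" using K' by (intro mult_right_mono mult_left_mono) auto
          also have "\<dots> = K' * sqrt \<mu> * real m" unfolding \<kappa>(2)[symmetric] by (simp add: power_numeral_reduce)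
          also have "\<dots> \<le> 1 / 2 * real m" using K'(3) by (intro mult_right_mono) auto
          finally show ?thesis using z by (simp add: \<kappa>_def)
        qed
        have hz2: "\<bar>real_of_int z\<bar> / real k + 1 < real m / real k - 1"
        proof -
          have "\<bar>real_of_int z\<bar> / real k \<le> (real m / 2) / real k" using zm kpos by (intro divide_right_mono) auto
          moreover have "8 \<le> real m / real k" using k8 kpos by (simp add: pos_le_divide_eq)
          ultimately show ?thesis by (simp add: field_simps)
        qed
        \<comment> \<open>All the room that the end point offset and one unit of rounding leave in
          the strip is given to the pieces.\<close>
        define x' where "x' = x - \<bar>real_of_int z\<bar> - 1"
        have x'z: "\<bar>real_of_int z\<bar> + B' * \<kappa> ^ 2 - 1 \<le> x'" using x T by (simp add: x'_def \<kappa>_def)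
        have \<kappa>1: "1 \<le> \<kappa> ^ 2" using \<kappa> by simp
        have B'\<kappa>: "3 + 2 * B * sqrt S * \<kappa> ^ 2 \<le> B' * \<kappa> ^ 2" using \<kappa>1 by (simp add: B'_def distrib_right)
        have x'1: "2 * (\<bar>real_of_int z\<bar> / real k + 1) + 2 * B * (real (k * 1) * S / 2) powr (1 / 2) * q ^ 2 \<le> x'"
        proof -
          have "\<bar>real_of_int z\<bar> / real k \<le> \<bar>real_of_int z\<bar> / 2" using k(1) by (intro divide_left_mono) auto
          moreover have "(real (k * 1) * S / 2) powr (1 / 2) * q ^ 2 \<le> sqrt S * \<kappa> ^ 2"
          proof -
            have "(real (k * 1) * S / 2) powr (1 / 2) = sqrt (real k * S / 2)" using S0 by (simp add: powr_half_sqrt)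
            \<comment> \<open>Bounding k = k3^3 by k3^4 makes the power of k cancel exactly against
              q^2.\<close>
            also have "\<dots> \<le> sqrt (k3 ^ 4 * S)"
            proof (rule real_sqrt_le_mono)
              have "real k \<le> k3 ^ 4" unfolding k3(2)[symmetric] using k3(1) by (intro power_increasing) auto
              then have "real k * S \<le> k3 ^ 4 * S" using S0 by (intro mult_right_mono) auto
              moreover have "0 \<le> real k * S" using S0 by simp
              ultimately show "real k * S / 2 \<le> k3 ^ 4 * S" by linarith
            qed
            also have "\<dots> = k3 ^ 2 * sqrt S"
            proof -
              have "sqrt (k3 ^ 4) = k3 ^ 2" by (rule real_sqrt_unique) simp_all
              then show ?thesis by (simp add: real_sqrt_mult)
            qed
            finally have "(real (k * 1) * S / 2) powr (1 / 2) * q ^ 2 \<le> k3 ^ 2 * sqrt S * q ^ 2" by (rule mult_right_mono) simp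
            also have "\<dots> = sqrt S * \<kappa> ^ 2" unfolding q\<kappa> using kpos by (simp add: power_divide)
            finally show ?thesis .
          qed
          then have "2 * B * ((real (k * 1) * S / 2) powr (1 / 2) * q ^ 2) \<le> 2 * B * (sqrt S * \<kappa> ^ 2)"
            using pos by (intro mult_left_mono) auto
          ultimately show ?thesis using x'z B'\<kappa> by (simp only: mult.assoc distrib_left)
        qed
        have x'2: "1 \<le> x'"
        proof -
          have "0 \<le> 2 * B * sqrt S * \<kappa> ^ 2" using pos S0 by simp
          then show ?thesis using x'z B'\<kappa> by linarith
        qed
        \<comment> \<open>A single corridor: the spacing is arbitrary as long as it exceeds 2
          x'.\<close>
        have "prob {\<omega> \<in> space M. \<forall>j<1. slpp x m z (shift_field (pt 0 (int j * (\<lceil>2 * x'\<rceil> + 1))) (env \<omega>)) < \<mu> * real m - 4 * real k * (S * q)}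
            \<le> (real (k * 1) + 1) * exp (- (c' * (S / 2) powr a) * real (k * 1) powr a)"
        proof (rule corridors_strip_tail[where K = K and B = B and b = "1 / 2" and T\<^sub>1 = T\<^sub>1, OF tail pos assms(2,3) _ S(2) S0 _ _ _ q_def hz1 hz2 x'1 x'2 _ _ S(4)])
          show "\<bar>real_of_int z\<bar> + 1 + x' \<le> x" by (simp add: x'_def)
          show "2 * x' < real_of_int (\<lceil>2 * x'\<rceil> + 1)" by linarith
          show "2 * k \<le> m" using k8 by linarith
        qed (use k in auto)
        moreover have "shift_field (pt 0 0) w = w" for w by (simp add: shift_field_def pt_def flip: zero_prod_def)
        ultimately have p: "prob {\<omega> \<in> space M. slpp x m z (env \<omega>) < \<mu> * real m - 4 * real k * (S * q)}
            \<le> (real k + 1) * exp (- C * real k powr a)" by (simp add: C_def)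
        have "4 * real k * (S * q) \<le> T * \<kappa>"
        proof -
          have "4 * real k * (S * q) = 4 * S * k3 ^ 2 * \<kappa>"
            unfolding q\<kappa> k3(2)[symmetric] using kpos by (simp add: power_numeral_reduce)
          also have "\<dots> \<le> 4 * S * v ^ 2 * \<kappa>" using k3 S0 \<kappa> by (intro mult_right_mono mult_left_mono power_mono) auto
          also have "\<dots> = T * \<kappa>" unfolding v2 using S0 by simp
          finally show ?thesis .
        qed
        then have "prob {\<omega> \<in> space M. slpp x m z (env \<omega>) < \<mu> * real m - T * cbrt m}
            \<le> prob {\<omega> \<in> space M. slpp x m z (env \<omega>) < \<mu> * real m - 4 * real k * (S * q)}"
          by (intro finite_measure_mono) (auto simp: \<kappa>_def)
        also note p
        also have "(real k + 1) * exp (- C * real k powr a) \<le> (v ^ 3 + 1) * exp (- C * (v ^ 3 / 2) powr a)"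
          using k v0 C assms by (intro mult_mono) (auto intro!: powr_mono2)
        also have "\<dots> \<le> exp (- (C / 2) * (v ^ 3 / 2) powr a)" using elim by (simp add: v_def)
        finally have fin: "prob {\<omega> \<in> space M. slpp x m z (env \<omega>) < \<mu> * real m - T * cbrt m} \<le> exp (- (C / 2) * (v ^ 3 / 2) powr a)" .
        have "(C / 2) * (v ^ 3 / 2) powr a = c2 * T powr (3 / 2 * a)"
        proof -
          have vp: "0 < v" using T(2) v0 by (cases "v = 0") auto
          have "v = (1 / (4 * S) * T) powr (1 / 2)" unfolding v_def V_def using T S0 by (simp add: powr_half_sqrt)
          then have "v ^ 3 = (1 / (4 * S) * T) powr (3 / 2)"
            using T S0 by (simp add: powr_powr flip: powr_numeral)
          then have "(v ^ 3 / 2) powr a = ((1 / 2) * (1 / (4 * S) * T) powr (3 / 2)) powr a" by simp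
          also have "\<dots> = (1 / 2) powr a * ((1 / (4 * S)) powr (3 / 2 * a) * T powr (3 / 2 * a))"
            using T S0 by (simp only: powr_mult powr_powr)
          finally show ?thesis by (simp add: c2_def)
        qed
        then have "- (C / 2) * (v ^ 3 / 2) powr a = - c2 * T powr (3 / 2 * a)" by (simp only: mult_minus_left)
        then show ?thesis using fin by (simp only:)
      qed
    qed
  qed
  then show ?thesis unfolding strip_tail_def using K'(1) B' c2 by blast
qed

lemma (in lpp_tails) strip_tail_weaken:
  assumes "strip_tail a b'" "a' \<le> a" "b' \<le> b"
  shows "strip_tail a' b"
proof -
  obtain K B c' where pos: "0 < K" "0 < B" "0 < c'" and ev: "\<forall>\<^sub>F T in at_top. \<forall>m z x. 1 \<le> m \<longrightarrow>
     \<bar>real_of_int z\<bar> \<le> K * sqrt T * cbrt m ^ 2 \<longrightarrow> 2 * \<bar>real_of_int z\<bar> + B * T powr b' * cbrt m ^ 2 \<le> x \<longrightarrow>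
     prob {\<omega> \<in> space M. slpp x m z (env \<omega>) < \<mu> * real m - T * cbrt m} \<le> exp (- c' * T powr a)"
    using assms(1) unfolding strip_tail_def by blast
  have "\<forall>\<^sub>F T in at_top. \<forall>m z x. 1 \<le> m \<longrightarrow>
     \<bar>real_of_int z\<bar> \<le> K * sqrt T * cbrt m ^ 2 \<longrightarrow> 2 * \<bar>real_of_int z\<bar> + B * T powr b * cbrt m ^ 2 \<le> x \<longrightarrow>
     prob {\<omega> \<in> space M. slpp x m z (env \<omega>) < \<mu> * real m - T * cbrt m} \<le> exp (- c' * T powr a')"
    using ev eventually_ge_at_top[of 1]
  proof eventually_elim
    case (elim T)
    have "T powr a' \<le> T powr a" using elim assms by (intro powr_mono) auto
    then have 1: "exp (- c' * T powr a) \<le> exp (- c' * T powr a')" using pos by simp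
    have "T powr b' \<le> T powr b" using elim assms by (intro powr_mono) auto
    then have 2: "B * T powr b' * cbrt m ^ 2 \<le> B * T powr b * cbrt m ^ 2" for m
      using pos by (intro mult_right_mono mult_left_mono) auto
    show ?case
    proof (intro allI impI)
      fix m z x assume *: "1 \<le> m" "\<bar>real_of_int z\<bar> \<le> K * sqrt T * cbrt m ^ 2" "2 * \<bar>real_of_int z\<bar> + B * T powr b * cbrt m ^ 2 \<le> x"
      have "2 * \<bar>real_of_int z\<bar> + B * T powr b' * cbrt m ^ 2 \<le> x" using *(3) 2[of m] by linarith
      then have "prob {\<omega> \<in> space M. slpp x m z (env \<omega>) < \<mu> * real m - T * cbrt m} \<le> exp (- c' * T powr a)"
        using elim(1) *(1,2) by blast
      then show "prob {\<omega> \<in> space M. slpp x m z (env \<omega>) < \<mu> * real m - T * cbrt m} \<le> exp (- c' * T powr a')"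
        using 1 by linarith
    qed
  qed
  then show ?thesis unfolding strip_tail_def using pos by blast
qed

subsection \<open>The cubic exponent\<close>

context lpp_tails
begin

text \<open>The exponent is capped at 1 because \<open>strip_tail_step\<close> requires a \<le> 1;
  after each round the width exponent is relaxed to 1/2 again so that the next one applies. The
  final round, started at exponent 1, is run only for the width exponent 0.\<close>

lemma strip_tail_1: "strip_tail 1 0"
proof -
  have step: "strip_tail (min 1 (\<alpha> * (3 / 2) ^ n)) (1 / 2)" for n
  proof (induction n)
    case 0
    show ?case by (rule strip_tail_weaken[OF strip_tail_base]) auto
  next
    case (Suc n)
    have "strip_tail (3 / 2 * min 1 (\<alpha> * (3 / 2) ^ n)) 0"
      by (rule strip_tail_step[OF Suc]) (use \<alpha> in auto)
    then show ?case by (rule strip_tail_weaken) (auto simp: min_def)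
  qed
  obtain n where "1 / \<alpha> < (3 / 2) ^ n" using real_arch_pow[of "3 / 2" "1 / \<alpha>"] by auto
  then have "1 \<le> \<alpha> * (3 / 2) ^ n" using \<alpha> by (simp add: field_simps)
  then have "strip_tail 1 (1 / 2)" using step[of n] by (simp add: min_def split: if_splits)
  then have "strip_tail (3 / 2 * 1) 0" by (rule strip_tail_step) auto
  then show ?thesis by (rule strip_tail_weaken) auto
qed

text \<open>Offsets z are part of the claim because the fans to which the induction is applied end
  at displaced points. The strong induction on r has no base case: once \<theta> \<ge> \<mu>
  r^(2/3), the event is empty.\<close>

lemma cubic_lower_tail:
  "\<exists>K>0. \<exists>c>0. \<exists>\<theta>\<^sub>1. \<forall>r z \<theta>. 1 \<le> r \<longrightarrow> \<theta>\<^sub>1 \<le> \<theta> \<longrightarrow> \<bar>real_of_int z\<bar> \<le> K * sqrt \<theta> * cbrt r ^ 2 \<longrightarrow>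
     prob {\<omega> \<in> space M. flpp r z (env \<omega>) < \<mu> * real r - \<theta> * cbrt r} \<le> exp (- c * \<theta> ^ 3)"
proof -
  obtain K\<^sub>1 B c\<^sub>1 where pos: "0 < K\<^sub>1" "0 < B" "0 < c\<^sub>1" and ev: "\<forall>\<^sub>F T in at_top. \<forall>m z x. 1 \<le> m \<longrightarrow>
     \<bar>real_of_int z\<bar> \<le> K\<^sub>1 * sqrt T * cbrt m ^ 2 \<longrightarrow> 2 * \<bar>real_of_int z\<bar> + B * T powr 0 * cbrt m ^ 2 \<le> x \<longrightarrow>
     prob {\<omega> \<in> space M. slpp x m z (env \<omega>) < \<mu> * real m - T * cbrt m} \<le> exp (- c\<^sub>1 * T powr 1)"
    using strip_tail_1 unfolding strip_tail_def by blast
  then obtain T\<^sub>1 where tail: "\<And>T m z x. T\<^sub>1 \<le> T \<Longrightarrow> 1 \<le> m \<Longrightarrow> \<bar>real_of_int z\<bar> \<le> K\<^sub>1 * sqrt T * cbrt m ^ 2 \<Longrightarrow>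
       2 * \<bar>real_of_int z\<bar> + B * T powr 0 * cbrt m ^ 2 \<le> x \<Longrightarrow>
       prob {\<omega> \<in> space M. slpp x m z (env \<omega>) < \<mu> * real m - T * cbrt m} \<le> exp (- c\<^sub>1 * T powr 1)"
    unfolding eventually_at_top_linorder by blast
  have "\<forall>\<^sub>F S in at_top. 8 \<le> K\<^sub>1 * sqrt S" "\<forall>\<^sub>F S in at_top. 2 \<le> c\<^sub>1 * (S / 2)" using pos by real_asymp+
  then have "\<forall>\<^sub>F S in at_top. 8 \<le> K\<^sub>1 * sqrt S \<and> 2 \<le> c\<^sub>1 * (S / 2) \<and> 2 * T\<^sub>1 \<le> S \<and> 2 * \<mu> \<le> S \<and>
      (\<forall>k::nat. (\<Sum>n=1..k. exp (- (c\<^sub>1 * (S / 2) powr 1 / 2) * real n powr 1)) \<le> 1)"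
    by (intro eventually_conj eventually_ge_at_top stretched_exp_sum_le_1 pos zero_less_one)
  \<comment> \<open>The condition 2 \<le> \<open>c\<^sub>1 * (S / 2)\<close> makes the decay per
    piece strong enough to absorb the prefactor k N + 1 \<le> exp (k N).\<close>
  then obtain S where S: "8 \<le> K\<^sub>1 * sqrt S" "2 \<le> c\<^sub>1 * (S / 2)" "2 * T\<^sub>1 \<le> S" "2 * \<mu> \<le> S"
      "\<And>k::nat. (\<Sum>n=1..k. exp (- (c\<^sub>1 * (S / 2) powr 1 / 2) * real n powr 1)) \<le> 1"
    using eventually_happens'[OF trivial_limit_at_top_linorder] by blast
  have S0: "0 < S" using S(4) \<mu> by simp
  \<comment> \<open>The first bound keeps the slopes within a corridor admissible; the second gives
    |z| \<le> r / 16 when \<theta> < \<mu> r^(2/3).\<close>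
  define K where "K = min (K\<^sub>1 / 192) (1 / (16 * sqrt \<mu>))"
  have K: "0 < K" "K \<le> K\<^sub>1 / 192" "K * sqrt \<mu> \<le> 1 / 16"
    using pos \<mu> mult_right_mono[of K "1 / (16 * sqrt \<mu>)" "sqrt \<mu>"] by (auto simp: K_def)
  \<comment> \<open>Half-width of a corridor in units of q^2: twice the admissible slope K_1 sqrt S
    / 4 of a piece, plus twice its strip constant B.\<close>
  define B\<^sub>2 where "B\<^sub>2 = K\<^sub>1 * sqrt S / 2 + 2 * B"
  have B2: "4 \<le> B\<^sub>2" using S(1) pos by (simp add: B\<^sub>2_def)
  \<comment> \<open>With a deficit of order S per piece, \<open>V \<theta> ^ 3\<close> is the number of pieces per corridor; \<open>W \<theta>\<close> bounds the number of corridors from below.\<close>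
  define V where "V \<theta> = sqrt (\<theta> / (8 * S))" for \<theta>
  define W where "W \<theta> = K * sqrt \<theta> * (V \<theta> / 2) ^ 2 / (500 * B\<^sub>2)" for \<theta>
  \<comment> \<open>The lower bounds V^3 / 2 for k and W / 2 for N multiply to exactly c5
    \<theta>^3.\<close>
  define c5 where "c5 = K / (512000 * B\<^sub>2 * S ^ 2 * sqrt (8 * S))"
  have c5: "0 < c5" using K B2 S0 by (simp add: c5_def)
  \<comment> \<open>Half of c5 leaves room for the fans: at level 2 \<theta> they contribute exp (-
    8 c3 \<theta>^3), against which a factor 2 \<theta>^2 is negligible.\<close>
  define c3 where "c3 = c5 / 2"
  have c3: "0 < c3" using c5 by (simp add: c3_def)
  have "\<forall>\<^sub>F \<theta> in at_top. 0 < \<theta> \<and> 2 \<le> V \<theta> ^ 3 \<and> 1 \<le> W \<theta> \<and> K * sqrt \<theta> * V \<theta> ^ 2 / (500 * B\<^sub>2) \<le> \<theta> ^ 2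
      \<and> 1024 * \<mu> \<le> \<theta> \<and> 2 * \<theta> ^ 2 * exp (- c3 * (2 * \<theta>) ^ 3) + exp (- c5 * \<theta> ^ 3) \<le> exp (- c3 * \<theta> ^ 3)"
  proof (intro eventually_conj)
    show "\<forall>\<^sub>F \<theta> in at_top. 2 \<le> V \<theta> ^ 3" unfolding V_def using S0 by real_asymp
    show "\<forall>\<^sub>F \<theta> in at_top. 1 \<le> W \<theta>" unfolding W_def V_def using S0 K B2 by real_asymp
    show "\<forall>\<^sub>F \<theta> in at_top. K * sqrt \<theta> * V \<theta> ^ 2 / (500 * B\<^sub>2) \<le> \<theta> ^ 2"
      unfolding V_def using S0 K B2 by real_asymp
    have "c5 = 2 * c3" by (simp add: c3_def)
    then show "\<forall>\<^sub>F \<theta> in at_top. 2 * \<theta> ^ 2 * exp (- c3 * (2 * \<theta>) ^ 3) + exp (- c5 * \<theta> ^ 3) \<le> exp (- c3 * \<theta> ^ 3)"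
      using c3 by (simp only:) real_asymp
  qed (auto intro: eventually_gt_at_top eventually_ge_at_top)
  then obtain \<theta>\<^sub>1 where \<theta>\<^sub>1: "\<And>\<theta>. \<theta>\<^sub>1 \<le> \<theta> \<Longrightarrow> 0 < \<theta> \<and> 2 \<le> V \<theta> ^ 3 \<and> 1 \<le> W \<theta> \<and> K * sqrt \<theta> * V \<theta> ^ 2 / (500 * B\<^sub>2) \<le> \<theta> ^ 2
      \<and> 1024 * \<mu> \<le> \<theta> \<and> 2 * \<theta> ^ 2 * exp (- c3 * (2 * \<theta>) ^ 3) + exp (- c5 * \<theta> ^ 3) \<le> exp (- c3 * \<theta> ^ 3)"
    unfolding eventually_at_top_linorder by blast
  have main: "prob {\<omega> \<in> space M. flpp r z (env \<omega>) < \<mu> * real r - \<theta> * cbrt r} \<le> exp (- c3 * \<theta> ^ 3)"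
    if "1 \<le> r" "\<theta>\<^sub>1 \<le> \<theta>" "\<bar>real_of_int z\<bar> \<le> K * sqrt \<theta> * cbrt r ^ 2" for r z \<theta>
    using that
  proof (induction r arbitrary: z \<theta> rule: less_induct)
    case (less r)
    note \<theta> = \<theta>\<^sub>1[OF less.prems(2)]
    show ?case
    proof (cases "\<mu> * cbrt r ^ 2 \<le> \<theta>")
      case True
      from prob_slpp_eq_0[OF this, of "real r" z] show ?thesis by (simp add: slpp_wide)
    next
      case False
      define \<kappa> where "\<kappa> = cbrt r"
      have \<kappa>: "1 \<le> \<kappa>" "\<kappa> ^ 3 = real r" using cbrt_ge_1[OF less.prems(1)] cbrt_cube by (auto simp: \<kappa>_def)
      have \<theta>\<kappa>: "\<theta> < \<mu> * \<kappa> ^ 2" using False by (simp add: \<kappa>_def)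
      have z: "\<bar>real_of_int z\<bar> \<le> K * sqrt \<theta> * \<kappa> ^ 2" using less.prems(3) by (simp add: \<kappa>_def)
      have s\<theta>: "sqrt \<theta> \<le> sqrt \<mu> * \<kappa>"
        using \<theta>\<kappa> \<mu> \<kappa> \<theta> by (intro real_le_lsqrt) (auto simp: power_mult_distrib)
      have K\<theta>: "K * sqrt \<theta> * \<kappa> ^ 2 \<le> real r / 16"
      proof -
        have "K * sqrt \<theta> * \<kappa> ^ 2 \<le> K * (sqrt \<mu> * \<kappa>) * \<kappa> ^ 2" using s\<theta> K by (intro mult_right_mono mult_left_mono) auto
        also have "\<dots> = K * sqrt \<mu> * real r" unfolding \<kappa>(2)[symmetric] by (simp add: power_numeral_reduce)
        also have "\<dots> \<le> 1 / 16 * real r" using K(3) by (intro mult_right_mono) auto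
        finally show ?thesis by simp
      qed
      have r1024: "1024 \<le> real r"
      proof -
        have "\<mu> * 1024 < \<mu> * \<kappa> ^ 2" using \<theta> \<theta>\<kappa> by simp
        then have "1024 < \<kappa> ^ 2" using \<mu> by simp
        also have "\<dots> \<le> \<kappa> ^ 3" using \<kappa>(1) by (intro power_increasing) auto
        finally show ?thesis using \<kappa>(2) by simp
      qed
      \<comment> \<open>512 = 8^3: a fan of this length has natural scale at most \<kappa> / 8, so
        two fans at level 2 \<theta> cost at most half of the deficit.\<close>
      define r' where "r' = r div 512"
      define m where "m = r - 2 * r'"
      have r': "real r' \<le> real r / 512" "real r / 1024 \<le> real r'" "1 \<le> r'" "r' < r" "r' + m + r' = r"
        "real m \<le> real r" "real r / 2 \<le> real m"
        using r1024 unfolding r'_def m_def by linarith+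
      define \<kappa>' where "\<kappa>' = cbrt r'"
      have \<kappa>'1: "\<kappa>' \<le> \<kappa> / 8"
      proof -
        have "\<kappa>' \<le> (real r / 512) powr (1 / 3)" unfolding \<kappa>'_def using r' by (intro powr_mono2) auto
        also have "\<dots> = \<kappa> / 512 powr (1 / 3)" by (simp add: powr_divide \<kappa>_def)
        also have "(512::real) powr (1 / 3) = (8 ^ 3) powr (1 / 3)" by simp
        also have "\<dots> = 8" by (rule cube_powr_third) simp
        finally show ?thesis .
      qed
      \<comment> \<open>11 is the least integer whose cube exceeds 1024, and 11^2 \<le> 125 is what
        \<open>fanK\<close> needs.\<close>
      have \<kappa>'2: "\<kappa> / 11 \<le> \<kappa>'"
      proof (rule power_le_imp_le_base[of _ 2])
        show "(\<kappa> / 11) ^ Suc 2 \<le> \<kappa>' ^ Suc 2"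
          using \<kappa>(2) cbrt_cube[of r'] r'(2) unfolding \<kappa>'_def by (simp add: power_divide)
      qed (simp add: \<kappa>'_def)
      define v where "v = V \<theta>"
      define k where "k = nat \<lfloor>v ^ 3\<rfloor>"
      have v0: "0 \<le> v" using \<theta> S0 by (simp add: v_def V_def)
      have v2: "v ^ 2 = \<theta> / (8 * S)" using \<theta> S0 by (simp add: v_def V_def)
      have v3: "2 \<le> v ^ 3" using \<theta> by (simp add: v_def)
      note k = floor_three_halves[OF v0 v3 k_def]
      define k3 where "k3 = cbrt k"
      have k3: "1 \<le> k3" "k3 ^ 3 = real k" "k3 \<le> v" "v / 2 \<le> k3"
        using cbrt_ge_1[of k] k cbrt_cube by (auto simp: k3_def)
      have kpos: "0 < real k" "0 < k3" using k(1) k3 by auto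
      have s\<theta>k: "sqrt \<theta> \<le> 6 * sqrt S * k3"
      proof -
        have "sqrt \<theta> = sqrt 8 * sqrt S * v" unfolding v_def V_def using S0 \<theta> by (simp add: real_sqrt_divide real_sqrt_mult)
        also have "\<dots> \<le> 3 * sqrt S * (2 * k3)"
          using k3 S0 v0 real_sqrt_le_mono[of 8 "3 ^ 2"] by (intro mult_mono) auto
        finally show ?thesis by simp
      qed
      define q where "q = (real m / real k) powr (1 / 3)"
      have q0: "0 \<le> q" by (simp add: q_def)
      have q\<kappa>: "q \<le> \<kappa> / k3"
      proof -
        have "q = cbrt m / k3" unfolding q_def k3_def by (simp add: powr_divide)
        also have "\<dots> \<le> \<kappa> / k3" unfolding \<kappa>_def using r' kpos by (intro divide_right_mono powr_mono2) auto
        finally show ?thesis .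
      qed
      have \<kappa>q: "\<kappa> \<le> 2 * k3 * q"
      proof -
        have "\<kappa> / 2 \<le> cbrt m"
        proof (rule power_le_imp_le_base[of _ 2])
          show "(\<kappa> / 2) ^ Suc 2 \<le> cbrt m ^ Suc 2"
            using \<kappa>(2) cbrt_cube[of m] r'(7) by (simp add: power_divide)
        qed simp
        moreover have "q = cbrt m / k3" unfolding q_def k3_def by (simp add: powr_divide)
        ultimately show ?thesis using kpos by simp
      qed
      have v\<kappa>: "v \<le> \<kappa> / 4"
      proof -
        have "\<theta> \<le> S / 2 * \<kappa> ^ 2" using \<theta>\<kappa> S(4) mult_right_mono[of \<mu> "S / 2" "\<kappa> ^ 2"] by simp
        then have "v ^ 2 \<le> (\<kappa> / 4) ^ 2" unfolding v2 using S0 by (simp add: field_simps)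
        then show ?thesis using \<kappa> by (intro power2_le_imp_le[of v]) auto
      qed
      have k64: "64 * real k \<le> real r"
      proof -
        have "real k \<le> v ^ 3" by (rule k)
        also have "\<dots> \<le> (\<kappa> / 4) ^ 3" using v\<kappa> v0 by (intro power_mono) auto
        also have "\<dots> = real r / 64" using \<kappa>(2) by (simp add: power_divide)
        finally show ?thesis by simp
      qed
      have mk: "32 * real k \<le> real m" using k64 r'(7) by linarith
      have q1: "1 \<le> q" unfolding q_def using mk kpos powr_mono2[of "1/3" 1 "real m / real k"] by (simp add: pos_le_divide_eq)
      have hz1: "\<bar>real_of_int z\<bar> / real k + 1 \<le> K\<^sub>1 / 4 * sqrt S * q ^ 2"
      proof -
        have "\<bar>real_of_int z\<bar> / real k \<le> K * sqrt \<theta> * \<kappa> ^ 2 / k3 ^ 3"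
          unfolding k3 using z kpos by (intro divide_right_mono) auto
        also have "\<dots> \<le> K * (6 * sqrt S * k3) * (2 * k3 * q) ^ 2 / k3 ^ 3"
          using s\<theta>k \<kappa>q \<kappa> K kpos \<theta> S0 by (intro divide_right_mono mult_mono power_mono) auto
        also have "\<dots> = K * (24 * sqrt S * q ^ 2)" using kpos by (simp add: power_mult_distrib power_numeral_reduce)
        also have "\<dots> \<le> K\<^sub>1 / 192 * (24 * sqrt S * q ^ 2)" using K S0 by (intro mult_right_mono) auto
        finally have "\<bar>real_of_int z\<bar> / real k \<le> K\<^sub>1 / 8 * sqrt S * q ^ 2" by simp
        moreover have "1 \<le> K\<^sub>1 / 8 * sqrt S" using S(1) by simp
        moreover have "K\<^sub>1 / 8 * sqrt S \<le> K\<^sub>1 / 8 * sqrt S * q ^ 2" using q1 pos S0 by simp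
        ultimately show ?thesis by linarith
      qed
      have zr: "\<bar>real_of_int z\<bar> \<le> real r / 16" using z K\<theta> by linarith
      have hz2: "\<bar>real_of_int z\<bar> / real k + 1 < real m / real k - 1"
      proof -
        have "\<bar>real_of_int z\<bar> \<le> real m / 2" using zr r' by linarith
        then have "\<bar>real_of_int z\<bar> / real k \<le> (real m / 2) / real k" using kpos by (intro divide_right_mono) auto
        moreover have "32 \<le> real m / real k" using mk kpos by (simp add: pos_le_divide_eq)
        ultimately show ?thesis by (simp add: field_simps)
      qed
      define x' where "x' = B\<^sub>2 * q ^ 2"
      have q2: "1 \<le> q ^ 2" using q1 by simp
      have x'4: "4 \<le> x'" using B2 q2 mult_mono[of 4 B\<^sub>2 1 "q ^ 2"] by (simp add: x'_def)
      define \<Delta> where "\<Delta> = \<lceil>2 * x'\<rceil> + 1"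
      have \<Delta>: "2 * x' < real_of_int \<Delta>" "real_of_int \<Delta> \<le> 4 * x'" "0 < \<Delta>" using x'4 unfolding \<Delta>_def by linarith+
      \<comment> \<open>Ratio of the admissible offset, of order K sqrt \<theta> \<kappa>^2, to the
        spacing, which is at most \<open>4 * B\<^sub>2 * q ^ 2\<close>. The denominator 500 keeps
        the fan within 1/125 of that offset.\<close>
      define w where "w = K * sqrt \<theta> * k3 ^ 2 / (500 * B\<^sub>2)"
      have w1: "W \<theta> \<le> w" unfolding W_def w_def v_def[symmetric] using k3 v0 K \<theta> B2
        by (intro divide_right_mono mult_left_mono power_mono) auto
      \<comment> \<open>Crude, but polynomial in \<theta>, which is all that the union bound over
        the fans needs.\<close>
      have w2: "w \<le> \<theta> ^ 2"
      proof -
        have "w \<le> K * sqrt \<theta> * v ^ 2 / (500 * B\<^sub>2)" unfolding w_def using k3 K \<theta> B2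
          by (intro divide_right_mono mult_left_mono power_mono) auto
        then show ?thesis using \<theta> by (simp add: v_def)
      qed
      define N where "N = nat \<lfloor>w\<rfloor>"
      have wge: "1 \<le> w" using w1 \<theta> by linarith
      then have fl: "1 \<le> \<lfloor>w\<rfloor>" by (simp add: le_floor_iff)
      then have Nw: "real N = real_of_int \<lfloor>w\<rfloor>" unfolding N_def by (intro of_nat_nat) linarith
      have N: "1 \<le> N" "real N \<le> w" "w / 2 \<le> real N"
        using fl Nw unfolding N_def by linarith+
      have fan: "real j * real_of_int \<Delta> \<le> K * sqrt \<theta> * \<kappa> ^ 2 / 125" if "j < N" for j
      proof -
        have "real j * real_of_int \<Delta> \<le> w * (4 * x')" using that N \<Delta> by (intro mult_mono) auto
        also have "\<dots> = K * sqrt \<theta> * (k3 * q) ^ 2 / 125" unfolding w_def x'_def using B2 by (simp add: power_mult_distrib)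
        also have "\<dots> \<le> K * sqrt \<theta> * \<kappa> ^ 2 / 125"
          using q\<kappa> kpos q0 K \<theta> by (intro divide_right_mono mult_left_mono power_mono) (auto simp: pos_le_divide_eq mult.commute)
        finally show ?thesis .
      qed
      have fanK: "\<bar>real_of_int (\<sigma> * (int j * \<Delta>))\<bar> \<le> K * sqrt (2 * \<theta>) * \<kappa>' ^ 2" if "j < N" "\<bar>\<sigma>\<bar> = 1" for j \<sigma>
      proof -
        have "\<bar>real_of_int (\<sigma> * (int j * \<Delta>))\<bar> = real j * real_of_int \<Delta>"
          using that \<Delta>(3) by (simp add: abs_mult flip: of_int_abs)
        also have "\<dots> \<le> K * sqrt \<theta> * \<kappa> ^ 2 / 125" by (rule fan[OF that(1)])
        also have "\<dots> \<le> K * sqrt \<theta> * (\<kappa> / 11) ^ 2" using K \<theta> by (simp add: power_divide)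
        also have "\<dots> \<le> K * sqrt (2 * \<theta>) * \<kappa>' ^ 2" using K \<theta> \<kappa> \<kappa>'2 by (intro mult_mono power_mono) auto
        finally show ?thesis .
      qed
      have fanr: "int j * \<Delta> < int r'" "0 \<le> int j * \<Delta>" if "j < N" for j
      proof -
        have "real j * real_of_int \<Delta> \<le> real r / 16 / 125" using fan[OF that] K\<theta> by linarith
        then have "real_of_int (int j * \<Delta>) < real r'" using r'(2) r1024 by simp
        then show "int j * \<Delta> < int r'" by linarith
      qed (use \<Delta> in simp)
      define x where "x = \<bar>real_of_int z\<bar> + 1 + x'"
      define C where "C = {\<omega> \<in> space M. \<forall>j<N. slpp x m z (shift_field (pt r' (int j * \<Delta>)) (env \<omega>)) < \<mu> * real m - 4 * real k * (S * q)}"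
      define A1 where "A1 j = {\<omega> \<in> space M. flpp r' (int j * \<Delta>) (env \<omega>) < \<mu> * real r' - 2 * \<theta> * cbrt r'}" for j
      define A2 where "A2 j = {\<omega> \<in> space M. flpp r' (- (int j * \<Delta>)) (shift_field (pt (r' + m) (int j * \<Delta> + z)) (env \<omega>)) < \<mu> * real r' - 2 * \<theta> * cbrt r'}" for j
      have [measurable]: "C \<in> events" "A1 j \<in> events" "A2 j \<in> events" for j
        unfolding C_def A1_def A2_def by measurable
      have pC: "prob C \<le> exp (- c5 * \<theta> ^ 3)"
      proof -
        have "prob C \<le> (real (k * N) + 1) * exp (- (c\<^sub>1 * (S / 2) powr 1) * real (k * N) powr 1)"
          unfolding C_def
        proof (rule corridors_strip_tail[where K = K\<^sub>1 and B = B and b = 0 and T\<^sub>1 = T\<^sub>1 and x' = x', OF tail pos _ _ _ S(3) S0 _ N(1) _ q_def hz1 hz2 _ _ _ \<Delta>(1) S(5)])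
          have p0: "(real (k * N) * S / 2) powr 0 = 1" using kpos N S0 by simp
          have "2 * (\<bar>real_of_int z\<bar> / real k + 1) \<le> 2 * (K\<^sub>1 / 4 * sqrt S * q ^ 2)"
            using hz1 by (rule mult_left_mono) simp
          moreover have "2 * (K\<^sub>1 / 4 * sqrt S * q ^ 2) + 2 * B * 1 * q ^ 2 = x'"
            by (simp add: x'_def B\<^sub>2_def distrib_right)
          ultimately show "2 * (\<bar>real_of_int z\<bar> / real k + 1) + 2 * B * (real (k * N) * S / 2) powr 0 * q ^ 2 \<le> x'"
            unfolding p0 by linarith
          show "\<bar>real_of_int z\<bar> + 1 + x' \<le> x" by (simp add: x_def)
          show "2 * k \<le> m" using mk by linarith
        qed (use k x'4 in auto)
        also have "\<dots> \<le> exp (real (k * N)) * exp (- (c\<^sub>1 * (S / 2)) * real (k * N))"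
          using S0 exp_ge_add_one_self[of "real (k * N)"] by (intro mult_mono) (auto simp: add.commute)
        also have "\<dots> = exp (real (k * N) - (c\<^sub>1 * (S / 2)) * real (k * N))" unfolding exp_add[symmetric] by simp
        also have "\<dots> \<le> exp (- real (k * N))"
        proof -
          have "2 * real (k * N) \<le> (c\<^sub>1 * (S / 2)) * real (k * N)" using S(2) by (intro mult_right_mono) auto
          then show ?thesis unfolding exp_le_cancel_iff by linarith
        qed
        also have "\<dots> \<le> exp (- c5 * \<theta> ^ 3)"
        proof -
          have "(v ^ 3 / 2) * (W \<theta> / 2) \<le> real k * real N"
          proof (rule mult_mono)
            show "W \<theta> / 2 \<le> real N" using w1 N by linarith
          qed (use k v0 \<theta> in auto)
          moreover have "(v ^ 3 / 2) * (W \<theta> / 2) = c5 * \<theta> ^ 3"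
          proof -
            have vv: "v = sqrt \<theta> / sqrt (8 * S)" unfolding v_def V_def by (simp add: real_sqrt_divide)
            have v3': "v ^ 3 = v * v ^ 2" by (simp add: power_numeral_reduce)
            have "(v ^ 3 / 2) * (W \<theta> / 2) = (sqrt \<theta> / sqrt (8 * S)) * (\<theta> / (8 * S)) / 2 * (K * sqrt \<theta> * (\<theta> / (8 * S) / 4) / (500 * B\<^sub>2) / 2)"
              unfolding W_def v_def[symmetric] v3' power_divide v2 by (simp add: vv)
            also have "\<dots> = (sqrt \<theta> * sqrt \<theta>) * \<theta> ^ 2 * (K / (sqrt (8 * S) * (8 * S) * 2 * (8 * S) * 4 * (500 * B\<^sub>2) * 2))"
              by (simp add: power2_eq_square)
            also have "sqrt \<theta> * sqrt \<theta> = \<theta>" using \<theta> by simp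
            also have "\<theta> * \<theta> ^ 2 * (K / (sqrt (8 * S) * (8 * S) * 2 * (8 * S) * 4 * (500 * B\<^sub>2) * 2)) = c5 * \<theta> ^ 3"
              unfolding c5_def by (simp add: power_numeral_reduce mult_ac)
            finally show ?thesis .
          qed
          ultimately show ?thesis by simp
        qed
        finally show ?thesis .
      qed
      have IH: "prob {\<omega> \<in> space M. flpp r' (\<sigma> * (int j * \<Delta>)) (env \<omega>) < \<mu> * real r' - 2 * \<theta> * cbrt r'} \<le> exp (- c3 * (2 * \<theta>) ^ 3)"
        if "j < N" "\<bar>\<sigma>\<bar> = 1" for j \<sigma>
        by (rule less.IH[OF r'(4,3)]) (use less.prems \<theta> fanK[OF that] in \<open>auto simp: \<kappa>'_def\<close>)
      have pA1: "prob (A1 j) \<le> exp (- c3 * (2 * \<theta>) ^ 3)" if "j < N" for j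
        using IH[OF that, of 1] by (simp add: A1_def)
      have pA2: "prob (A2 j) \<le> exp (- c3 * (2 * \<theta>) ^ 3)" if "j < N" for j
      proof -
        have "prob (A2 j) = prob {\<omega> \<in> space M. flpp r' (- (int j * \<Delta>)) (env \<omega>) < \<mu> * real r' - 2 * \<theta> * cbrt r'}"
          unfolding A2_def by (rule prob_shift_field, rule field_space_Collect) measurable
        then show ?thesis using IH[OF that, of "-1"] by simp
      qed
      have "{\<omega> \<in> space M. flpp r z (env \<omega>) < \<mu> * real r - \<theta> * cbrt r} \<subseteq> C \<union> (\<Union>j<N. A1 j \<union> A2 j)"
      proof
        fix \<omega> assume "\<omega> \<in> {\<omega> \<in> space M. flpp r z (env \<omega>) < \<mu> * real r - \<theta> * cbrt r}"
        then have \<omega>: "\<omega> \<in> space M" and low: "flpp r z (env \<omega>) < \<mu> * real r - \<theta> * \<kappa>" by (auto simp: \<kappa>_def)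
        show "\<omega> \<in> C \<union> (\<Union>j<N. A1 j \<union> A2 j)"
        proof (rule ccontr)
          assume no: "\<omega> \<notin> C \<union> (\<Union>j<N. A1 j \<union> A2 j)"
          let ?d = "\<lambda>j. int j * \<Delta>"
          \<comment> \<open>Outside \<open>C\<close> some corridor is good; its two fans are good
            because all of them are, so it does not matter which corridor it is.\<close>
          obtain j where j: "j < N" "\<mu> * real m - 4 * real k * (S * q) \<le> slpp x m z (shift_field (pt r' (?d j)) (env \<omega>))"
            using no \<omega> by (auto simp: C_def not_less)
          have a1: "\<mu> * real r' - 2 * \<theta> * \<kappa>' \<le> flpp r' (?d j) (env \<omega>)"
            using no \<omega> j by (auto simp: A1_def \<kappa>'_def not_less)
          have a2: "\<mu> * real r' - 2 * \<theta> * \<kappa>' \<le> flpp r' (- ?d j) (shift_field (pt (r' + m) (?d j + z)) (env \<omega>))"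
            using no \<omega> j by (auto simp: A2_def \<kappa>'_def not_less)
          have a3: "slpp x m z (shift_field (pt r' (?d j)) (env \<omega>)) \<le> flpp m z (shift_field (pt r' (?d j)) (env \<omega>))"
            unfolding slpp_def by (rule clpp_mono) simp
          have d: "\<bar>?d j\<bar> < int r'" using fanr[OF j(1)] by simp
          have zm: "\<bar>z\<bar> < int m" using zr r' r1024 by linarith
          have b1: "flpp r' (?d j) (env \<omega>) + flpp m z (shift_field (pt r' (?d j)) (env \<omega>)) \<le> flpp (r' + m) (?d j + z) (env \<omega>)"
            by (rule flpp_superadd[OF env_nonneg d zm])
          have "flpp (r' + m) (?d j + z) (env \<omega>) + flpp r' (- ?d j) (shift_field (pt (r' + m) (?d j + z)) (env \<omega>))
            \<le> flpp (r' + m + r') (?d j + z + - ?d j) (env \<omega>)"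
            by (rule flpp_superadd[OF env_nonneg]) (use d zm in auto)
          then have b2: "flpp (r' + m) (?d j + z) (env \<omega>) + flpp r' (- ?d j) (shift_field (pt (r' + m) (?d j + z)) (env \<omega>))
            \<le> flpp r z (env \<omega>)" using r'(5) by simp
          have e1: "4 * real k * (S * q) \<le> \<theta> / 2 * \<kappa>"
          proof -
            have "4 * real k * (S * q) \<le> 4 * k3 ^ 3 * (S * (\<kappa> / k3))"
              unfolding k3(2) using q\<kappa> S0 by (intro mult_left_mono) auto
            also have "\<dots> = 4 * S * k3 ^ 2 * \<kappa>" using kpos by (simp add: power_numeral_reduce)
            also have "\<dots> \<le> 4 * S * v ^ 2 * \<kappa>" using k3 S0 \<kappa> by (intro mult_right_mono mult_left_mono power_mono) auto
            also have "\<dots> = \<theta> / 2 * \<kappa>" unfolding v2 using S0 by simp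
            finally show ?thesis .
          qed
          have e2: "2 * \<theta> * \<kappa>' \<le> \<theta> / 4 * \<kappa>" using mult_left_mono[OF \<kappa>'1, of "2 * \<theta>"] \<theta> by simp
          have e3: "\<mu> * real r' + \<mu> * real m + \<mu> * real r' = \<mu> * real r"
            unfolding r'(5)[symmetric] by (simp add: algebra_simps)
          \<comment> \<open>Half of the deficit is spent in the corridor and a quarter in each
            fan.\<close>
          have e4: "\<theta> / 2 * \<kappa> + \<theta> / 4 * \<kappa> + \<theta> / 4 * \<kappa> = \<theta> * \<kappa>" by simp
          show False using j(2) a1 a2 a3 b1 b2 e1 e2 e3 e4 low by linarith
        qed
      qed
      then have "prob {\<omega> \<in> space M. flpp r z (env \<omega>) < \<mu> * real r - \<theta> * cbrt r} \<le> prob (C \<union> (\<Union>j<N. A1 j \<union> A2 j))"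
        by (rule finite_measure_mono) measurable
      also have "\<dots> \<le> prob C + prob (\<Union>j<N. A1 j \<union> A2 j)" by (rule measure_Un_le) measurable
      \<comment> \<open>Fans share their end points, so a union bound replaces independence
        here.\<close>
      also have "prob (\<Union>j<N. A1 j \<union> A2 j) \<le> (\<Sum>j<N. prob (A1 j \<union> A2 j))"
        by (rule finite_measure_subadditive_finite) auto
      also have "\<dots> \<le> (\<Sum>j<N. 2 * exp (- c3 * (2 * \<theta>) ^ 3))"
      proof (rule sum_mono)
        fix j assume "j \<in> {..<N}"
        then have "j < N" by simp
        have "prob (A1 j \<union> A2 j) \<le> prob (A1 j) + prob (A2 j)" by (rule measure_Un_le) measurable
        then show "prob (A1 j \<union> A2 j) \<le> 2 * exp (- c3 * (2 * \<theta>) ^ 3)"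
          using pA1[OF \<open>j < N\<close>] pA2[OF \<open>j < N\<close>] by linarith
      qed
      also have "\<dots> = real N * (2 * exp (- c3 * (2 * \<theta>) ^ 3))" by simp
      also have "\<dots> \<le> \<theta> ^ 2 * (2 * exp (- c3 * (2 * \<theta>) ^ 3))"
        using N w2 by (intro mult_right_mono) auto
      also note pC
      finally show ?thesis using \<theta> by simp
    qed
  qed
  then show ?thesis using K c3 by blast
qed

end

section \<open>From the assumptions to tails centred at \<mu> r\<close>

lemma Xrz_measurable:
  assumes "\<And>v. \<xi> v \<in> borel_measurable M"
  shows "Xrz \<xi> r z \<in> borel_measurable M"
proof -
  have "(\<lambda>\<omega>. path_weight (\<lambda>v. \<xi> v \<omega>) p) \<in> borel_measurable M" for p
    unfolding path_weight_def using assms by (induction p) simp_all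
  then have "(\<lambda>\<omega>. Max ((\<lambda>p. path_weight (\<lambda>v. \<xi> v \<omega>) p) ` {p. dpath (1, 1) (int r - z, int r + z) p})) \<in> borel_measurable M"
    by (intro borel_measurable_Max finite_dpaths)
  then show ?thesis unfolding Xrz_def[abs_def] lpp_def by simp
qed

theorem theorem3:
  fixes M :: "'a measure" and \<xi> :: "point \<Rightarrow> 'a \<Rightarrow> real"
    and \<nu> :: "real measure" and \<mu> :: real
  assumes "prob_space M"
    and rv: "\<And>v. \<xi> v \<in> borel_measurable M"
    and indep: "prob_space.indep_vars M (\<lambda>_. borel) \<xi> UNIV"
    and law: "\<And>v. distr M borel (\<xi> v) = \<nu>"
    and supp: "measure \<nu> {0..} = 1"
    and integ: "\<And>v. integrable M (\<xi> v)"
    and mu: "(\<lambda>r. prob_space.expectation M (Xrz \<xi> r 0) / real r) \<longlonglongrightarrow> \<mu>"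
    and LS: "\<exists>\<rho> G H g1 g2 R. 0 < \<rho> \<and> \<rho> < 1 \<and> 0 < G \<and> 0 < H \<and> 0 < g1 \<and> 0 < g2 \<and>
       (\<forall>r::nat. r \<ge> R \<longrightarrow> (\<forall>z::int. \<bar>real_of_int z\<bar> \<le> \<rho> * real r \<longrightarrow>
          \<mu> * real r - G * real_of_int z ^ 2 / real r - H * real_of_int z ^ 4 / real r ^ 3
             - g1 * real r powr (1/3)
            \<le> prob_space.expectation M (Xrz \<xi> r z) \<and>
          prob_space.expectation M (Xrz \<xi> r z)
            \<le> \<mu> * real r - G * real_of_int z ^ 2 / real r - g2 * real r powr (1/3)))"
    and alpha: "0 < \<alpha>"
    and UT_LT: "\<forall>\<epsilon>>0. \<exists>c \<theta>\<^sub>0 r\<^sub>0. 0 < c \<and> 0 < \<theta>\<^sub>0 \<and> 0 < r\<^sub>0 \<and>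
       (\<forall>r::nat. \<forall>\<theta>::real. \<forall>z::int. real r > r\<^sub>0 \<longrightarrow> \<theta> > \<theta>\<^sub>0 \<longrightarrow>
          \<bar>real_of_int z\<bar> \<le> (1 - \<epsilon>) * real r \<longrightarrow>
          prob_space.prob M {\<omega> \<in> space M. Xrz \<xi> r z \<omega> - prob_space.expectation M (Xrz \<xi> r z)
               > \<theta> * real r powr (1/3)} \<le> exp (- c * \<theta> powr \<alpha>) \<and>
          prob_space.prob M {\<omega> \<in> space M. Xrz \<xi> r z \<omega> - prob_space.expectation M (Xrz \<xi> r z)
               < - \<theta> * real r powr (1/3)} \<le> exp (- c * \<theta> powr \<alpha>))"
  shows "\<exists>c \<theta>\<^sub>0 r\<^sub>0. 0 < c \<and>
     (\<forall>\<theta>::real. \<forall>r::nat. \<theta> > \<theta>\<^sub>0 \<longrightarrow> real r > r\<^sub>0 \<longrightarrow>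
        prob_space.prob M {\<omega> \<in> space M. Xrz \<xi> r 0 \<omega> - prob_space.expectation M (Xrz \<xi> r 0)
            \<le> - \<theta> * real r powr (1/3)} \<le> exp (- c * \<theta> ^ 3))"
proof -
  interpret prob_space M by fact
  note rv\<^sub>0 = rv and law\<^sub>0 = law
  obtain \<rho> G H g1 g2 R where LSpos: "0 < \<rho>" "\<rho> < 1" "0 < G" "0 < H" "0 < g1" "0 < g2"
    and LSlow: "\<And>r z. R \<le> r \<Longrightarrow> \<bar>real_of_int z\<bar> \<le> \<rho> * real r \<Longrightarrow>
      \<mu> * real r - G * real_of_int z ^ 2 / real r - H * real_of_int z ^ 4 / real r ^ 3 - g1 * cbrt r
        \<le> expectation (Xrz \<xi> r z)"
    and LSup: "\<And>r z. R \<le> r \<Longrightarrow> \<bar>real_of_int z\<bar> \<le> \<rho> * real r \<Longrightarrow>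
      expectation (Xrz \<xi> r z) \<le> \<mu> * real r - G * real_of_int z ^ 2 / real r - g2 * cbrt r"
    using LS by blast
  \<comment> \<open>Taking 1 - \<rho> for \<epsilon> makes the tail hypotheses hold on the same
    range of offsets as (LS).\<close>
  have "0 < 1 - \<rho>" using LSpos by simp
  from UT_LT[rule_format, OF this] obtain c \<theta>\<^sub>0 r\<^sub>0 where UL: "0 < c \<and> 0 < \<theta>\<^sub>0 \<and> 0 < r\<^sub>0 \<and>
     (\<forall>r::nat. \<forall>\<theta>::real. \<forall>z::int. real r > r\<^sub>0 \<longrightarrow> \<theta> > \<theta>\<^sub>0 \<longrightarrow> \<bar>real_of_int z\<bar> \<le> (1 - (1 - \<rho>)) * real r \<longrightarrow>
          prob {\<omega> \<in> space M. Xrz \<xi> r z \<omega> - expectation (Xrz \<xi> r z) > \<theta> * cbrt r} \<le> exp (- c * \<theta> powr \<alpha>) \<and>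
          prob {\<omega> \<in> space M. Xrz \<xi> r z \<omega> - expectation (Xrz \<xi> r z) < - \<theta> * cbrt r} \<le> exp (- c * \<theta> powr \<alpha>))"
    by (elim exE) (rule that)
  have pos: "0 < c" "0 < \<theta>\<^sub>0" "0 < r\<^sub>0" using UL by blast+
  note T = UL[THEN conjunct2, THEN conjunct2, THEN conjunct2, rule_format]
  \<comment> \<open>The law gives nonnegativity only almost surely. The truncated weights are
    nonnegative everywhere and agree with the original ones off a null set.\<close>
  define \<xi>' where "\<xi>' v \<omega> = max 0 (\<xi> v \<omega>)" for v \<omega>
  define \<nu>' where "\<nu>' = distr \<nu> borel (max (0::real))"
  interpret iid_field M \<xi>' \<nu>'
  proof
    show "\<xi>' v \<in> borel_measurable M" for v unfolding \<xi>'_def using rv by measurable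
    show "indep_vars (\<lambda>_. borel) \<xi>' UNIV" unfolding \<xi>'_def
      by (rule indep_vars_compose2[OF indep]) measurable
    show "distr M borel (\<xi>' v) = \<nu>'" for v
      unfolding \<nu>'_def law[of v, symmetric] \<xi>'_def using rv[of v] by (subst distr_distr) (auto simp: comp_def)
    show "0 \<le> \<xi>' v \<omega>" for v \<omega> by (simp add: \<xi>'_def)
  qed
  have AEv: "AE \<omega> in M. 0 \<le> \<xi> v \<omega>" for v
  proof -
    have "prob (\<xi> v -` {0..} \<inter> space M) = measure \<nu> {0..}"
      unfolding law\<^sub>0[of v, symmetric] by (rule measure_distr[symmetric]) (auto simp: rv\<^sub>0)
    then have "AE \<omega> in M. \<omega> \<in> \<xi> v -` {0..} \<inter> space M" using supp by (intro AE_prob_1) simp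
    then show ?thesis by eventually_elim auto
  qed
  then have "AE \<omega> in M. \<forall>v. 0 \<le> \<xi> v \<omega>" by (simp add: AE_all_countable)
  then have AEX: "AE \<omega> in M. \<forall>r z. \<bar>z\<bar> < int r \<longrightarrow> Xrz \<xi> r z \<omega> = flpp r z (env \<omega>)"
  proof eventually_elim
    case (elim \<omega>)
    have e: "(\<lambda>v. \<xi> v \<omega>) = env \<omega>" using elim by (auto simp: env_def \<xi>'_def fun_eq_iff)
    show ?case
    proof (intro allI impI)
      fix r z assume z: "\<bar>z\<bar> < int r"
      then have "real_of_int \<bar>z\<bar> \<le> real r" "1 / 2 \<le> real r" by linarith+
      from pt_path_exists[OF z this] have "\<exists>p. dpath (1, 1) (pt r z) p" by blast
      then show "Xrz \<xi> r z \<omega> = flpp r z (env \<omega>)"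
        unfolding Xrz_def e pt_def[symmetric] by (rule lpp_eq_clpp[OF env_nonneg])
    qed
  qed
  have Xm[measurable]: "Xrz \<xi> r z \<in> borel_measurable M" for r z by (rule Xrz_measurable[OF rv\<^sub>0])
  have z_lt: "\<bar>z\<bar> < int r" if "1 \<le> r" "\<bar>real_of_int z\<bar> \<le> \<rho> * real r" for r z
    using that LSpos mult_strict_right_mono[of \<rho> 1 "real r"] by linarith
  \<comment> \<open>Nonnegative weights force 0 \<le> E[X_r] \<le> \<mu> r - g2 r^(1/3), so
    positivity comes from the strict correction in (LS).\<close>
  have \<mu>: "0 < \<mu>"
  proof -
    define r where "r = max R 1"
    have r: "R \<le> r" "1 \<le> r" by (auto simp: r_def)
    have "AE \<omega> in M. 0 \<le> Xrz \<xi> r 0 \<omega>" using AEX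
    proof eventually_elim
      case (elim \<omega>)
      then have "Xrz \<xi> r 0 \<omega> = flpp r 0 (env \<omega>)" using r by simp
      then show ?case by (simp add: clpp_nonneg)
    qed
    then have "0 \<le> expectation (Xrz \<xi> r 0)" by (rule integral_nonneg_AE)
    also have "\<dots> \<le> \<mu> * real r - g2 * cbrt r" using LSup[OF r(1), of 0] LSpos by simp
    finally have "g2 * cbrt r \<le> \<mu> * real r" by simp
    moreover have "0 < g2 * cbrt r" using LSpos r by simp
    ultimately have "0 < \<mu> * real r" by linarith
    then show ?thesis using r by (simp add: zero_less_mult_iff)
  qed
  define R\<^sub>0 where "R\<^sub>0 = max (max R 1) (nat \<lceil>r\<^sub>0\<rceil> + 1)"
  have R0: "R \<le> r" "1 \<le> r" "r\<^sub>0 < real r" if "R\<^sub>0 \<le> r" for r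
    using that unfolding R\<^sub>0_def by linarith+
  have half: "c * (\<theta> / 2) powr \<alpha> = c * (1 / 2) powr \<alpha> * \<theta> powr \<alpha>" if "0 < \<theta>" for \<theta>
    using powr_mult[of "1 / 2" \<theta> \<alpha>] that by simp
  \<comment> \<open>In the lower tail half of \<theta> pays for the correction g1 of (LS) and the
    other half remains as the deviation, hence the factor (1/2)^\<alpha>. As |z| \<le> r, the
    quartic term is at most H z^2 / r, hence \<open>G + H\<close> for A.\<close>
  interpret lpp_tails M \<xi>' \<nu>' \<mu> \<alpha> \<rho> G "G + H" "c * (1 / 2) powr \<alpha>" "2 * g1 + 2 * \<theta>\<^sub>0 + 1" R\<^sub>0
  proof
    fix r z and \<theta> :: real
    assume r: "R\<^sub>0 \<le> r" and z: "\<bar>real_of_int z\<bar> \<le> \<rho> * real r" and \<theta>: "2 * g1 + 2 * \<theta>\<^sub>0 + 1 \<le> \<theta>"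
    note r = R0[OF r]
    have \<theta>2: "\<theta>\<^sub>0 < \<theta> / 2" "g1 \<le> \<theta> / 2" "0 < \<theta>" using \<theta> LSpos pos by auto
    have k0: "0 < cbrt r" using r by simp
    have zr: "\<bar>z\<bar> < int r" by (rule z_lt[OF r(2) z])
    have T': "prob {\<omega> \<in> space M. Xrz \<xi> r z \<omega> - expectation (Xrz \<xi> r z) > \<theta> / 2 * cbrt r} \<le> exp (- c * (\<theta> / 2) powr \<alpha>)"
      "prob {\<omega> \<in> space M. Xrz \<xi> r z \<omega> - expectation (Xrz \<xi> r z) < - (\<theta> / 2) * cbrt r} \<le> exp (- c * (\<theta> / 2) powr \<alpha>)"
      using T[OF r(3) \<theta>2(1), of z] z by auto
    have c': "exp (- c * (\<theta> / 2) powr \<alpha>) = exp (- (c * (1 / 2) powr \<alpha>) * \<theta> powr \<alpha>)"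
      using half[OF \<theta>2(3)] by simp
    have \<theta>k: "\<theta> / 2 * cbrt r \<le> \<theta> * cbrt r" using \<theta>2 k0 by (intro mult_right_mono) auto
    have H: "H * real_of_int z ^ 4 / real r ^ 3 \<le> H * real_of_int z ^ 2 / real r"
    proof -
      have "\<bar>real_of_int z\<bar> \<le> real r" using zr by linarith
      then have "real_of_int z ^ 2 \<le> real r ^ 2" by (simp add: abs_le_square_iff[symmetric])
      then have "real_of_int z ^ 2 * real_of_int z ^ 2 \<le> real r ^ 2 * real_of_int z ^ 2" by (rule mult_right_mono) simp
      then have "H * (real_of_int z ^ 4) \<le> H * (real r ^ 2 * real_of_int z ^ 2)"
        using LSpos by (intro mult_left_mono) (auto simp: power_numeral_reduce)
      then have "H * real_of_int z ^ 4 / real r ^ 3 \<le> H * (real r ^ 2 * real_of_int z ^ 2) / real r ^ 3"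
        by (rule divide_right_mono) simp
      also have "\<dots> = H * real_of_int z ^ 2 / real r" using r by (simp add: power_numeral_reduce)
      finally show ?thesis .
    qed
    have g: "g1 * cbrt r + \<theta> / 2 * cbrt r \<le> \<theta> * cbrt r"
      using mult_right_mono[OF \<theta>2(2), of "cbrt r"] by simp
    have GH: "(G + H) * real_of_int z ^ 2 / real r = G * real_of_int z ^ 2 / real r + H * real_of_int z ^ 2 / real r"
      by (simp add: distrib_right add_divide_distrib)
    have "prob {\<omega> \<in> space M. flpp r z (env \<omega>) < \<mu> * real r - (G + H) * real_of_int z ^ 2 / real r - \<theta> * cbrt r}
      \<le> prob {\<omega> \<in> space M. Xrz \<xi> r z \<omega> - expectation (Xrz \<xi> r z) < - (\<theta> / 2) * cbrt r}"
    proof (rule finite_measure_mono_AE)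
      show "AE \<omega> in M. \<omega> \<in> {\<omega> \<in> space M. flpp r z (env \<omega>) < \<mu> * real r - (G + H) * real_of_int z ^ 2 / real r - \<theta> * cbrt r} \<longrightarrow>
        \<omega> \<in> {\<omega> \<in> space M. Xrz \<xi> r z \<omega> - expectation (Xrz \<xi> r z) < - (\<theta> / 2) * cbrt r}"
        using AEX
      proof eventually_elim
        case (elim \<omega>)
        then have "Xrz \<xi> r z \<omega> = flpp r z (env \<omega>)" using zr by blast
        then show ?case using LSlow[OF r(1) z] H g unfolding GH by auto
      qed
    qed measurable
    then show "prob {\<omega> \<in> space M. flpp r z (env \<omega>) < \<mu> * real r - (G + H) * real_of_int z ^ 2 / real r - \<theta> * cbrt r}
      \<le> exp (- (c * (1 / 2) powr \<alpha>) * \<theta> powr \<alpha>)" using T'(2) unfolding c' by linarith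
    have "prob {\<omega> \<in> space M. flpp r z (env \<omega>) > \<mu> * real r - G * real_of_int z ^ 2 / real r + \<theta> * cbrt r}
      \<le> prob {\<omega> \<in> space M. Xrz \<xi> r z \<omega> - expectation (Xrz \<xi> r z) > \<theta> / 2 * cbrt r}"
    proof (rule finite_measure_mono_AE)
      show "AE \<omega> in M. \<omega> \<in> {\<omega> \<in> space M. flpp r z (env \<omega>) > \<mu> * real r - G * real_of_int z ^ 2 / real r + \<theta> * cbrt r} \<longrightarrow>
        \<omega> \<in> {\<omega> \<in> space M. Xrz \<xi> r z \<omega> - expectation (Xrz \<xi> r z) > \<theta> / 2 * cbrt r}"
        using AEX
      proof eventually_elim
        case (elim \<omega>)
        then have e: "Xrz \<xi> r z \<omega> = flpp r z (env \<omega>)" using zr by blast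
        have "0 \<le> g2 * cbrt r" using LSpos by simp
        then show ?case using LSup[OF r(1) z] \<theta>k e by auto
      qed
    qed measurable
    then show "prob {\<omega> \<in> space M. flpp r z (env \<omega>) > \<mu> * real r - G * real_of_int z ^ 2 / real r + \<theta> * cbrt r}
      \<le> exp (- (c * (1 / 2) powr \<alpha>) * \<theta> powr \<alpha>)" using T'(1) unfolding c' by linarith
  qed (use \<mu> alpha LSpos pos in auto)
  obtain K c3 \<theta>\<^sub>1 where final: "0 < K" "0 < c3"
    "\<And>r z \<theta>. 1 \<le> r \<Longrightarrow> \<theta>\<^sub>1 \<le> \<theta> \<Longrightarrow> \<bar>real_of_int z\<bar> \<le> K * sqrt \<theta> * cbrt r ^ 2 \<Longrightarrow>
     prob {\<omega> \<in> space M. flpp r z (env \<omega>) < \<mu> * real r - \<theta> * cbrt r} \<le> exp (- c3 * \<theta> ^ 3)"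
    using cubic_lower_tail by blast
  show ?thesis
  proof (rule exI[of _ c3], rule exI[of _ "max \<theta>\<^sub>1 0"], rule exI[of _ "real R\<^sub>0"], intro conjI allI impI final(2))
    fix \<theta> :: real and r :: nat assume \<theta>: "max \<theta>\<^sub>1 0 < \<theta>" and r: "real R\<^sub>0 < real r"
    have r': "R \<le> r" "1 \<le> r" using R0[of r] r by auto
    have "prob {\<omega> \<in> space M. Xrz \<xi> r 0 \<omega> - expectation (Xrz \<xi> r 0) \<le> - \<theta> * cbrt r}
        \<le> prob {\<omega> \<in> space M. flpp r 0 (env \<omega>) < \<mu> * real r - \<theta> * cbrt r}"
    proof (rule finite_measure_mono_AE)
      show "AE \<omega> in M. \<omega> \<in> {\<omega> \<in> space M. Xrz \<xi> r 0 \<omega> - expectation (Xrz \<xi> r 0) \<le> - \<theta> * cbrt r} \<longrightarrow>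
        \<omega> \<in> {\<omega> \<in> space M. flpp r 0 (env \<omega>) < \<mu> * real r - \<theta> * cbrt r}"
        using AEX
      proof eventually_elim
        case (elim \<omega>)
        have "Xrz \<xi> r 0 \<omega> = flpp r 0 (env \<omega>)" using elim r' by simp
        \<comment> \<open>The strictness turns the closed event of the conclusion into the open one
          of \<open>cubic_lower_tail\<close>.\<close>
        moreover have "expectation (Xrz \<xi> r 0) < \<mu> * real r"
        proof -
          have "0 < g2 * cbrt r" using LSpos r' by simp
          then show ?thesis using LSup[OF r'(1), of 0] LSpos by simp
        qed
        ultimately show ?case by auto
      qed
    qed measurable
    also have "\<dots> \<le> exp (- c3 * \<theta> ^ 3)"
      by (rule final(3)) (use r' \<theta> final(1) in auto)
    finally show "prob {\<omega> \<in> space M. Xrz \<xi> r 0 \<omega> - expectation (Xrz \<xi> r 0) \<le> - \<theta> * real r powr (1/3)} \<le> exp (- c3 * \<theta> ^ 3)" .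
  qed
qed

end
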